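(* Let $F,G\colon\mathscr{D}\to\mathscr{E}$ be exact morphisms of strong stable derivators, let $\alpha\colon F\to G$ be a natural transformation, and let $A$ be a small category. The natural transformation $\alpha_A\colon F_A\to G_A$ is exact with respect to the canonical exact structures $\sigma_{F,A}\colon F_A\circ\Sigma\xrightarrow{\cong}\Sigma\circ F_A$ and $\sigma_{G,A}\colon G_A\circ\Sigma\xrightarrow{\cong}\Sigma\circ G_A$, i.e., the square $$\Sigma\alpha_A\circ\sigma_{F,A}=\sigma_{G,A}\circ\alpha_A\Sigma\colon F_A\circ\Sigma\to\Sigma\circ G_A$$ commutes.
   Context: **Derivators.** $\mathbf{Cat}$ is the 2-category of small categories, $\mathbf{CAT}$ that of not necessarily small categories, $\mathbb{1}$ is the terminal category, $\pi_A\colon A\to\mathbb{1}$ the unique functor; objects $a\in A$ are identified with functors $a\colon\mathbb{1}\to A$. A prederivator is a strict 2-functor $\mathscr{D}\colon\mathbf{Cat}^{\mathrm{op}}\to\mathbf{CAT}$ (op reverses functors only); $u\colon A\to B$ induces $u^\ast\colon\mathscr{D}(B)\to\mathscr{D}(A)$, and $X_a:=a^\ast X$. It is a derivator if: (Der1) $\mathscr{D}$ sends coproducts to products; (Der2) $f$ in $\mathscr{D}(A)$ is an isomorphism iff $f_a$ is so for all $a\in A$; (Der3) each $u^\ast$ has a left adjoint $u_!$ and a right adjoint $u_\ast$ (write $\operatorname{colim}_A=(\pi_A)_!$, $\lim_A=(\pi_A)_\ast$); (Der4) for $u\colon A\to B$, $b\in B$, with projections $p\colon(u/b)\to A$, $q\colon(b/u)\to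 A$, the canonical mates $\operatorname{colim}_{(u/b)}p^\ast\to b^\ast u_!$ and $b^\ast u_\ast\to\lim_{(b/u)}q^\ast$ are isomorphisms. The shifted derivator is $\mathscr{D}^B(A)=\mathscr{D}(B\times A)$. $\mathscr{D}$ is strong if $\mathscr{D}(A\times[1])\to\mathscr{D}(A)^{[1]}$ is full and essentially surjective for every $A$. **Pointed and stable.** $\mathscr{D}$ is pointed if $\mathscr{D}(\mathbb{1})$ has a zero object. Let $\square=[1]\times[1]$ with inclusions $i_\ulcorner\colon\ulcorner\to\square$ (omitting $(1,1)$) and $i_\lrcorner\colon\lrcorner\to\square$ (omitting $(0,0)$). $X\in\mathscr{D}(\square)$ is cocartesian (cartesian) if it lies in the essential image of $(i_\ulcorner)_!$ (of $(i_\lrcorner)_\ast$). A pointed derivator is stable if the cartesian and cocartesian squares coincide. **Morphisms.** A morphism $F\colon\mathscr{D}\to\mathscr{E}$ is a pseudo-natural transformation: functors $F_A\colon\mathscr{D}(A)\to\mathscr{E}(A)$ and coherent natural isomorphisms $\gamma_u\colon u^\ast F_B\cong F_Au^\ast$ for $u\colon A\to B$. It induces $F^A\colon\mathscr{D}^A\to\mathscr{E}^A$. A natural transformation $\alpha\colon F\to G$ is a modification: natural transformations $\alpha_A\colon F_A\to G_A$ compatible with the $\gamma_u$. There are canonical mates $$u_!F_A\xrightarrow{\eta}u_!F_Au^\ast u_!\xrightarrow{\gamma_u^{-1}}u_!u^\ast F_Bu_!\xrightarrow{\varepsilon}F_Bu_!,\qquad F_Bu_\ast\xrightarrow{\eta}u_\ast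 u^\ast F_Bu_\ast\xrightarrow{\gamma_u}u_\ast F_Au^\ast u_\ast\xrightarrow{\varepsilon}u_\ast F_A,$$ and $F$ preserves left (right) Kan extensions along $u$ if the first (second) is an isomorphism. $F$ is right exact if it preserves left Kan extensions along $\emptyset\to\mathbb{1}$ (initial objects) and along $\ulcorner\to\mathbb{1}$ (pushouts); left exact is dual (terminal objects and limits of shape $\lrcorner$); exact means left and right exact. $F$ between pointed derivators is pointed if it preserves zero objects; such $F$ preserves right Kan extensions along sieves. **Suspension and canonical exact structure.** With $i=(0,0)\colon\mathbb{1}\to\ulcorner$ (a sieve), $\Sigma=(1,1)^\ast(i_\ulcorner)_!\,i_\ast\colon\mathscr{D}(\mathbb{1})\to\mathscr{D}(\mathbb{1})$. For pointed $F$ the comparison map $\psi\colon\Sigma F_{\mathbb{1}}\to F_{\mathbb{1}}\Sigma$ is $$(1,1)^\ast(i_\ulcorner)_!\,i_\ast F_{\mathbb{1}}\xrightarrow{\cong}(1,1)^\ast(i_\ulcorner)_!F_\ulcorner i_\ast\to(1,1)^\ast F_\square(i_\ulcorner)_!\,i_\ast\xrightarrow{\cong}F_{\mathbb{1}}(1,1)^\ast(i_\ulcorner)_!\,i_\ast,$$ where the first map is the inverse of the mate $F_\ulcorner i_\ast\to i_\ast F_{\mathbb 1}$, the second is the mate for $(i_\ulcorner)_!$, and the third is $\gamma_{(1,1)}$. For right exact $F$ it is invertible; for exact $F$ between stable derivators set $\sigma_{F,\mathbb{1}}=\psi^{-1}$, and define $\sigma_{F,A}\colon F_A\Sigma\to\Sigma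 F_A$ by the same construction applied to $F^A\colon\mathscr{D}^A\to\mathscr{E}^A$, where $\Sigma$ on $\mathscr{D}(A)=\mathscr{D}^A(\mathbb{1})$ is that of $\mathscr{D}^A$. This is the canonical exact structure on $F_A$ (with respect to the canonical triangulations on $\mathscr{D}(A)$ and $\mathscr{E}(A)$, whose suspension functors are these $\Sigma$). *)

theory Defs
  imports Main "HOL-Library.FuncSet"
begin

unbundle cardinal_syntax

section \<open>Categories, functors and natural transformations\<close>

text \<open>Every structure map is required to be \<^const>\<open>undefined\<close> outside its domain.  Hence the records
  below are in bijection with the categories, functors and natural transformations they encode, and
  the strict equations of a 2-functor are plain equations between records.\<close>

record ('o, 'm) cat =
  Obj :: "'o set"
  Arr :: "'m set"
  Dom :: "'m \<Rightarrow> 'o"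
  Cod :: "'m \<Rightarrow> 'o"
  Idn :: "'o \<Rightarrow> 'm"
  Cmp :: "'m \<Rightarrow> 'm \<Rightarrow> 'm"  \<comment> \<open>\<open>Cmp C g f\<close> is the composite of first \<open>f\<close>, then \<open>g\<close>\<close>

definition Hom :: "('o, 'm) cat \<Rightarrow> 'o \<Rightarrow> 'o \<Rightarrow> 'm set" where
  "Hom C x y = {f \<in> Arr C. Dom C f = x \<and> Cod C f = y}"

definition composable :: "('o, 'm) cat \<Rightarrow> 'm \<Rightarrow> 'm \<Rightarrow> bool" where
  "composable C g f \<longleftrightarrow> f \<in> Arr C \<and> g \<in> Arr C \<and> Cod C f = Dom C g"

locale category =
  fixes C :: "('o, 'm) cat"
  assumes Dom_Obj: "f \<in> Arr C \<Longrightarrow> Dom C f \<in> Obj C"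
    and Cod_Obj: "f \<in> Arr C \<Longrightarrow> Cod C f \<in> Obj C"
    and Idn_Hom: "x \<in> Obj C \<Longrightarrow> Idn C x \<in> Hom C x x"
    and Cmp_Hom: "f \<in> Hom C x y \<Longrightarrow> g \<in> Hom C y z \<Longrightarrow> Cmp C g f \<in> Hom C x z"
    and Cmp_Idn_right: "f \<in> Hom C x y \<Longrightarrow> Cmp C f (Idn C x) = f"
    and Cmp_Idn_left: "f \<in> Hom C x y \<Longrightarrow> Cmp C (Idn C y) f = f"
    and Cmp_assoc: "f \<in> Hom C w x \<Longrightarrow> g \<in> Hom C x y \<Longrightarrow> h \<in> Hom C y z \<Longrightarrow>
      Cmp C h (Cmp C g f) = Cmp C (Cmp C h g) f"
    and Dom_ext: "Dom C \<in> extensional (Arr C)"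
    and Cod_ext: "Cod C \<in> extensional (Arr C)"
    and Idn_ext: "Idn C \<in> extensional (Obj C)"
    and Cmp_ext: "\<not> composable C g f \<Longrightarrow> Cmp C g f = undefined"

definition inverse_arr :: "('o, 'm) cat \<Rightarrow> 'm \<Rightarrow> 'm \<Rightarrow> bool" where
  "inverse_arr C f g \<longleftrightarrow> f \<in> Arr C \<and> g \<in> Hom C (Cod C f) (Dom C f) \<and>
    Cmp C g f = Idn C (Dom C f) \<and> Cmp C f g = Idn C (Cod C f)"

definition iso_arr :: "('o, 'm) cat \<Rightarrow> 'm \<Rightarrow> bool" where
  "iso_arr C f \<longleftrightarrow> (\<exists>g. inverse_arr C f g)"

definition isomorphic :: "('o, 'm) cat \<Rightarrow> 'o \<Rightarrow> 'o \<Rightarrow> bool" where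
  "isomorphic C x y \<longleftrightarrow> (\<exists>f \<in> Hom C x y. iso_arr C f)"

definition initial_obj :: "('o, 'm) cat \<Rightarrow> 'o \<Rightarrow> bool" where
  "initial_obj C x \<longleftrightarrow> x \<in> Obj C \<and> (\<forall>y \<in> Obj C. \<exists>!f. f \<in> Hom C x y)"

definition terminal_obj :: "('o, 'm) cat \<Rightarrow> 'o \<Rightarrow> bool" where
  "terminal_obj C x \<longleftrightarrow> x \<in> Obj C \<and> (\<forall>y \<in> Obj C. \<exists>!f. f \<in> Hom C y x)"

definition zero_obj :: "('o, 'm) cat \<Rightarrow> 'o \<Rightarrow> bool" where
  "zero_obj C x \<longleftrightarrow> initial_obj C x \<and> terminal_obj C x"

record ('o, 'm, 'p, 'q) ftr =
  Src :: "('o, 'm) cat"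
  Tgt :: "('p, 'q) cat"
  FO :: "'o \<Rightarrow> 'p"
  FA :: "'m \<Rightarrow> 'q"

locale is_functor =
  fixes F :: "('o, 'm, 'p, 'q) ftr"
  assumes Src_category: "category (Src F)"
    and Tgt_category: "category (Tgt F)"
    and FO_Obj: "x \<in> Obj (Src F) \<Longrightarrow> FO F x \<in> Obj (Tgt F)"
    and FA_Hom: "f \<in> Hom (Src F) x y \<Longrightarrow> FA F f \<in> Hom (Tgt F) (FO F x) (FO F y)"
    and FA_Idn: "x \<in> Obj (Src F) \<Longrightarrow> FA F (Idn (Src F) x) = Idn (Tgt F) (FO F x)"
    and FA_Cmp: "f \<in> Hom (Src F) x y \<Longrightarrow> g \<in> Hom (Src F) y z \<Longrightarrow>
      FA F (Cmp (Src F) g f) = Cmp (Tgt F) (FA F g) (FA F f)"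
    and FO_ext: "FO F \<in> extensional (Obj (Src F))"
    and FA_ext: "FA F \<in> extensional (Arr (Src F))"

definition functor_between ::
    "('o, 'm, 'p, 'q) ftr \<Rightarrow> ('o, 'm) cat \<Rightarrow> ('p, 'q) cat \<Rightarrow> bool" where
  "functor_between F C D \<longleftrightarrow> is_functor F \<and> Src F = C \<and> Tgt F = D"

definition fid :: "('o, 'm) cat \<Rightarrow> ('o, 'm, 'o, 'm) ftr" where
  "fid C = \<lparr>Src = C, Tgt = C, FO = (\<lambda>x \<in> Obj C. x), FA = (\<lambda>f \<in> Arr C. f)\<rparr>"

definition fcomp :: "('p, 'q, 'r, 's) ftr \<Rightarrow> ('o, 'm, 'p, 'q) ftr \<Rightarrow> ('o, 'm, 'r, 's) ftr"
    (infixr "\<odot>" 75) where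
  "G \<odot> F = \<lparr>Src = Src F, Tgt = Tgt G,
    FO = (\<lambda>x \<in> Obj (Src F). FO G (FO F x)), FA = (\<lambda>f \<in> Arr (Src F). FA G (FA F f))\<rparr>"

definition full :: "('o, 'm, 'p, 'q) ftr \<Rightarrow> bool" where
  "full F \<longleftrightarrow> (\<forall>x \<in> Obj (Src F). \<forall>y \<in> Obj (Src F). \<forall>g \<in> Hom (Tgt F) (FO F x) (FO F y).
    \<exists>f \<in> Hom (Src F) x y. FA F f = g)"

definition in_ess_image :: "('o, 'm, 'p, 'q) ftr \<Rightarrow> 'p \<Rightarrow> bool" where
  "in_ess_image F y \<longleftrightarrow> y \<in> Obj (Tgt F) \<and> (\<exists>x \<in> Obj (Src F). isomorphic (Tgt F) (FO F x) y)"

definition ess_surj :: "('o, 'm, 'p, 'q) ftr \<Rightarrow> bool" where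
  "ess_surj F \<longleftrightarrow> (\<forall>y \<in> Obj (Tgt F). in_ess_image F y)"

record ('o, 'm, 'p, 'q) nt =
  NSrc :: "('o, 'm, 'p, 'q) ftr"
  NTgt :: "('o, 'm, 'p, 'q) ftr"
  At :: "'o \<Rightarrow> 'q"

locale is_nt =
  fixes t :: "('o, 'm, 'p, 'q) nt"
  assumes NSrc_functor: "is_functor (NSrc t)"
    and NTgt_functor: "is_functor (NTgt t)"
    and Src_eq: "Src (NSrc t) = Src (NTgt t)"
    and Tgt_eq: "Tgt (NSrc t) = Tgt (NTgt t)"
    and At_Hom: "x \<in> Obj (Src (NSrc t)) \<Longrightarrow>
      At t x \<in> Hom (Tgt (NSrc t)) (FO (NSrc t) x) (FO (NTgt t) x)"
    and naturality: "f \<in> Hom (Src (NSrc t)) x y \<Longrightarrow>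
      Cmp (Tgt (NSrc t)) (At t y) (FA (NSrc t) f) = Cmp (Tgt (NSrc t)) (FA (NTgt t) f) (At t x)"
    and At_ext: "At t \<in> extensional (Obj (Src (NSrc t)))"

definition nt_between ::
    "('o, 'm, 'p, 'q) nt \<Rightarrow> ('o, 'm, 'p, 'q) ftr \<Rightarrow> ('o, 'm, 'p, 'q) ftr \<Rightarrow> bool" where
  "nt_between t F G \<longleftrightarrow> is_nt t \<and> NSrc t = F \<and> NTgt t = G"

definition nat_iso :: "('o, 'm, 'p, 'q) nt \<Rightarrow> bool" where
  "nat_iso t \<longleftrightarrow> is_nt t \<and> (\<forall>x \<in> Obj (Src (NSrc t)). iso_arr (Tgt (NSrc t)) (At t x))"

definition nid :: "('o, 'm, 'p, 'q) ftr \<Rightarrow> ('o, 'm, 'p, 'q) nt" where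
  "nid F = \<lparr>NSrc = F, NTgt = F, At = (\<lambda>x \<in> Obj (Src F). Idn (Tgt F) (FO F x))\<rparr>"

text \<open>\<open>t \<cdot> s\<close> is the vertical composite of first \<open>s\<close>, then \<open>t\<close>; \<open>G \<triangleright> t\<close> and \<open>t \<triangleleft> F\<close> are the
  whiskerings of \<open>t\<close> with \<open>G\<close> after it and with \<open>F\<close> before it, usually written \<open>Gt\<close> and \<open>tF\<close>.\<close>

definition vcomp :: "('o, 'm, 'p, 'q) nt \<Rightarrow> ('o, 'm, 'p, 'q) nt \<Rightarrow> ('o, 'm, 'p, 'q) nt"
    (infixr "\<cdot>" 65) where
  "t \<cdot> s = \<lparr>NSrc = NSrc s, NTgt = NTgt t,
    At = (\<lambda>x \<in> Obj (Src (NSrc s)). Cmp (Tgt (NSrc s)) (At t x) (At s x))\<rparr>"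

definition whisk_l :: "('p, 'q, 'r, 's) ftr \<Rightarrow> ('o, 'm, 'p, 'q) nt \<Rightarrow> ('o, 'm, 'r, 's) nt"
    (infixr "\<triangleright>" 70) where
  "G \<triangleright> t = \<lparr>NSrc = G \<odot> NSrc t, NTgt = G \<odot> NTgt t,
    At = (\<lambda>x \<in> Obj (Src (NSrc t)). FA G (At t x))\<rparr>"

definition whisk_r :: "('p, 'q, 'r, 's) nt \<Rightarrow> ('o, 'm, 'p, 'q) ftr \<Rightarrow> ('o, 'm, 'r, 's) nt"
    (infixl "\<triangleleft>" 72) where
  "t \<triangleleft> F = \<lparr>NSrc = NSrc t \<odot> F, NTgt = NTgt t \<odot> F,
    At = (\<lambda>x \<in> Obj (Src F). At t (FO F x))\<rparr>"

definition hcomp :: "('p, 'q, 'r, 's) nt \<Rightarrow> ('o, 'm, 'p, 'q) nt \<Rightarrow> ('o, 'm, 'r, 's) nt" where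
  "hcomp s t = (s \<triangleleft> NTgt t) \<cdot> (NSrc s \<triangleright> t)"

definition nt_inv :: "('o, 'm, 'p, 'q) nt \<Rightarrow> ('o, 'm, 'p, 'q) nt" where
  "nt_inv t = \<lparr>NSrc = NTgt t, NTgt = NSrc t,
    At = (\<lambda>x \<in> Obj (Src (NSrc t)). THE g. inverse_arr (Tgt (NSrc t)) (At t x) g)\<rparr>"

definition equivalence_functor :: "('o, 'm, 'p, 'q) ftr \<Rightarrow> bool" where
  "equivalence_functor F \<longleftrightarrow> is_functor F \<and> (\<exists>G s t. functor_between G (Tgt F) (Src F) \<and>
    nat_iso s \<and> nt_between s (fid (Src F)) (G \<odot> F) \<and>
    nat_iso t \<and> nt_between t (F \<odot> G) (fid (Tgt F)))"

definition functor_cat ::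
    "('o, 'm) cat \<Rightarrow> ('p, 'q) cat \<Rightarrow> (('o, 'm, 'p, 'q) ftr, ('o, 'm, 'p, 'q) nt) cat" where
  "functor_cat B C = (let N = {t. is_nt t \<and> Src (NSrc t) = B \<and> Tgt (NSrc t) = C} in
    \<lparr>Obj = {F. functor_between F B C},
     Arr = N,
     Dom = (\<lambda>t \<in> N. NSrc t),
     Cod = (\<lambda>t \<in> N. NTgt t),
     Idn = (\<lambda>F \<in> {F. functor_between F B C}. nid F),
     Cmp = (\<lambda>t s. if t \<in> N \<and> s \<in> N \<and> NTgt s = NSrc t then t \<cdot> s else undefined)\<rparr>)"

definition family_prod :: "'i set \<Rightarrow> ('i \<Rightarrow> ('o, 'm) cat) \<Rightarrow> ('i \<Rightarrow> 'o, 'i \<Rightarrow> 'm) cat" where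
  "family_prod I C = (let M = (\<Pi>\<^sub>E i \<in> I. Arr (C i)) in
    \<lparr>Obj = (\<Pi>\<^sub>E i \<in> I. Obj (C i)),
     Arr = M,
     Dom = (\<lambda>f \<in> M. \<lambda>i \<in> I. Dom (C i) (f i)),
     Cod = (\<lambda>f \<in> M. \<lambda>i \<in> I. Cod (C i) (f i)),
     Idn = (\<lambda>x \<in> (\<Pi>\<^sub>E i \<in> I. Obj (C i)). \<lambda>i \<in> I. Idn (C i) (x i)),
     Cmp = (\<lambda>g f. if f \<in> M \<and> g \<in> M \<and> (\<forall>i \<in> I. Cod (C i) (f i) = Dom (C i) (g i))
       then (\<lambda>i \<in> I. Cmp (C i) (g i) (f i)) else undefined)\<rparr>)"

definition family_tuple ::
    "('o, 'm) cat \<Rightarrow> 'i set \<Rightarrow> ('i \<Rightarrow> ('o, 'm, 'p, 'q) ftr) \<Rightarrow> ('o, 'm, 'i \<Rightarrow> 'p, 'i \<Rightarrow> 'q) ftr" where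
  "family_tuple C I F = \<lparr>Src = C, Tgt = family_prod I (\<lambda>i. Tgt (F i)),
    FO = (\<lambda>x \<in> Obj C. \<lambda>i \<in> I. FO (F i) x), FA = (\<lambda>f \<in> Arr C. \<lambda>i \<in> I. FA (F i) f)\<rparr>"

section \<open>Adjunctions\<close>

definition adjunction ::
    "('o, 'm, 'p, 'q) ftr \<Rightarrow> ('p, 'q, 'o, 'm) ftr \<Rightarrow> ('o, 'm, 'o, 'm) nt \<Rightarrow> ('p, 'q, 'p, 'q) nt \<Rightarrow> bool"
  where
  "adjunction L R \<eta> \<epsilon> \<longleftrightarrow> is_functor L \<and> is_functor R \<and> Src L = Tgt R \<and> Tgt L = Src R \<and>
    nt_between \<eta> (fid (Src L)) (R \<odot> L) \<and> nt_between \<epsilon> (L \<odot> R) (fid (Src R)) \<and>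
    (\<epsilon> \<triangleleft> L) \<cdot> (L \<triangleright> \<eta>) = nid L \<and> (R \<triangleright> \<epsilon>) \<cdot> (\<eta> \<triangleleft> R) = nid R"

text \<open>An arbitrary but fixed choice of adjoint, unit and counit, meaningful if an adjoint exists.\<close>

definition chosen_left_adjoint :: "('p, 'q, 'o, 'm) ftr \<Rightarrow>
    ('o, 'm, 'p, 'q) ftr \<times> ('o, 'm, 'o, 'm) nt \<times> ('p, 'q, 'p, 'q) nt" where
  "chosen_left_adjoint R = (SOME (L, \<eta>, \<epsilon>). adjunction L R \<eta> \<epsilon>)"

definition chosen_right_adjoint :: "('o, 'm, 'p, 'q) ftr \<Rightarrow>
    ('p, 'q, 'o, 'm) ftr \<times> ('o, 'm, 'o, 'm) nt \<times> ('p, 'q, 'p, 'q) nt" where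
  "chosen_right_adjoint L = (SOME (R, \<eta>, \<epsilon>). adjunction L R \<eta> \<epsilon>)"

section \<open>Small categories\<close>

text \<open>The small categories are those whose objects and arrows form subsets of a fixed type
  \<open>'u\<close> of cardinality less than \<open>\<kappa> = |UNIV :: 'u set|\<close>.  If \<open>\<kappa>\<close> is strongly inaccessible, these are, up
  to isomorphism, exactly the categories that are small with respect to the Grothendieck universe of
  rank \<open>\<kappa>\<close>.  All that is required of \<open>\<kappa>\<close> here is that it is infinite and regular, so that the small
  categories are closed under products, comma categories and small coproducts.\<close>

class universe =
  assumes infinite_universe: "infinite (UNIV :: 'a set)"
    and regular_universe: "regularCard |UNIV :: 'a set|"

type_synonym 'u scat = "('u, 'u) cat"
type_synonym 'u sftr = "('u, 'u, 'u, 'u) ftr"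
type_synonym 'u snt = "('u, 'u, 'u, 'u) nt"

definition small_set :: "'u set \<Rightarrow> bool" where
  "small_set S \<longleftrightarrow> |S| <o |UNIV :: 'u set|"

definition small_cat :: "'u scat \<Rightarrow> bool" where
  "small_cat A \<longleftrightarrow> category A \<and> small_set (Obj A) \<and> small_set (Arr A)"

definition small_functor :: "'u sftr \<Rightarrow> bool" where
  "small_functor u \<longleftrightarrow> is_functor u \<and> small_cat (Src u) \<and> small_cat (Tgt u)"

definition small_nt :: "'u snt \<Rightarrow> bool" where
  "small_nt t \<longleftrightarrow> is_nt t \<and> small_functor (NSrc t) \<and> small_functor (NTgt t)"

text \<open>As \<open>'u\<close> is infinite, it contains codes for natural numbers and for pairs.\<close>

definition unat :: "nat \<Rightarrow> 'u::universe" where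
  "unat = (SOME c. inj c)"

definition upair_code :: "'u \<times> 'u \<Rightarrow> 'u::universe" where
  "upair_code = (SOME c. inj c)"

definition upair :: "'u \<Rightarrow> 'u \<Rightarrow> 'u::universe" where
  "upair x y = upair_code (x, y)"

definition ufst :: "'u::universe \<Rightarrow> 'u" where
  "ufst z = fst (inv upair_code z)"

definition usnd :: "'u::universe \<Rightarrow> 'u" where
  "usnd z = snd (inv upair_code z)"

lemma inj_unat: "inj (unat :: nat \<Rightarrow> 'u::universe)"
proof -
  have "\<exists>c :: nat \<Rightarrow> 'u. inj c"
    using infinite_countable_subset[OF infinite_universe[where 'a = 'u]] by blast
  then show ?thesis
    unfolding unat_def by (rule someI_ex)
qed

lemma inj_upair_code: "inj (upair_code :: 'u \<times> 'u \<Rightarrow> 'u::universe)"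
proof -
  have "|UNIV \<times> UNIV :: ('u \<times> 'u) set| =o |UNIV :: 'u set|"
    using card_of_Times_same_infinite infinite_universe by blast
  then have "\<exists>c :: 'u \<times> 'u \<Rightarrow> 'u. inj c"
    using card_of_ordIso[of "UNIV \<times> UNIV :: ('u \<times> 'u) set" "UNIV :: 'u set"]
    by (auto simp: bij_betw_def)
  then show ?thesis
    unfolding upair_code_def by (rule someI_ex)
qed

lemma upair_eq_iff [simp]: "upair x y = upair x' y' \<longleftrightarrow> x = x' \<and> y = y'"
  unfolding upair_def using inj_upair_code by (auto dest: injD)

lemma ufst_upair [simp]: "ufst (upair x y) = x"
  by (simp add: ufst_def upair_def inv_f_f[OF inj_upair_code])

lemma usnd_upair [simp]: "usnd (upair x y) = y"
  by (simp add: usnd_def upair_def inv_f_f[OF inj_upair_code])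

definition empty_cat :: "'u scat" where
  "empty_cat = \<lparr>Obj = {}, Arr = {}, Dom = (\<lambda>_. undefined), Cod = (\<lambda>_. undefined),
    Idn = (\<lambda>_. undefined), Cmp = (\<lambda>_ _. undefined)\<rparr>"

text \<open>The poset \<open>[n] = {0 < \<dots> < n}\<close>, with the pair \<open>(i, j)\<close> as the arrow \<open>i \<rightarrow> j\<close>.\<close>

definition simplex :: "nat \<Rightarrow> 'u::universe scat" where
  "simplex n = (let P = unat ` {..n}; M = {upair (unat i) (unat j) | i j. i \<le> j \<and> j \<le> n} in
    \<lparr>Obj = P,
     Arr = M,
     Dom = (\<lambda>f \<in> M. ufst f),
     Cod = (\<lambda>f \<in> M. usnd f),
     Idn = (\<lambda>x \<in> P. upair x x),
     Cmp = (\<lambda>g f. if f \<in> M \<and> g \<in> M \<and> usnd f = ufst g then upair (ufst f) (usnd g)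
       else undefined)\<rparr>)"

definition one :: "'u::universe scat" where
  "one = simplex 0"

definition to_one :: "'u::universe scat \<Rightarrow> 'u sftr" where
  "to_one A = \<lparr>Src = A, Tgt = one, FO = (\<lambda>x \<in> Obj A. unat 0),
    FA = (\<lambda>f \<in> Arr A. Idn one (unat 0))\<rparr>"

definition point :: "'u::universe scat \<Rightarrow> 'u \<Rightarrow> 'u sftr" where
  "point A a = \<lparr>Src = one, Tgt = A, FO = (\<lambda>x \<in> Obj one. a), FA = (\<lambda>f \<in> Arr one. Idn A a)\<rparr>"

definition cat_prod :: "'u::universe scat \<Rightarrow> 'u scat \<Rightarrow> 'u scat" (infixr "\<otimes>" 80) where
  "A \<otimes> B = (let P = {upair a b | a b. a \<in> Obj A \<and> b \<in> Obj B};
      M = {upair f g | f g. f \<in> Arr A \<and> g \<in> Arr B} in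
    \<lparr>Obj = P,
     Arr = M,
     Dom = (\<lambda>h \<in> M. upair (Dom A (ufst h)) (Dom B (usnd h))),
     Cod = (\<lambda>h \<in> M. upair (Cod A (ufst h)) (Cod B (usnd h))),
     Idn = (\<lambda>x \<in> P. upair (Idn A (ufst x)) (Idn B (usnd x))),
     Cmp = (\<lambda>k h. if h \<in> M \<and> k \<in> M \<and>
         composable A (ufst k) (ufst h) \<and> composable B (usnd k) (usnd h)
       then upair (Cmp A (ufst k) (ufst h)) (Cmp B (usnd k) (usnd h)) else undefined)\<rparr>)"

definition ftr_prod :: "'u::universe sftr \<Rightarrow> 'u sftr \<Rightarrow> 'u sftr" where
  "ftr_prod u v = \<lparr>Src = Src u \<otimes> Src v, Tgt = Tgt u \<otimes> Tgt v,
    FO = (\<lambda>x \<in> Obj (Src u \<otimes> Src v). upair (FO u (ufst x)) (FO v (usnd x))),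
    FA = (\<lambda>h \<in> Arr (Src u \<otimes> Src v). upair (FA u (ufst h)) (FA v (usnd h)))\<rparr>"

definition nt_prod :: "'u::universe snt \<Rightarrow> 'u snt \<Rightarrow> 'u snt" where
  "nt_prod s t = \<lparr>NSrc = ftr_prod (NSrc s) (NSrc t), NTgt = ftr_prod (NTgt s) (NTgt t),
    At = (\<lambda>x \<in> Obj (Src (NSrc s) \<otimes> Src (NSrc t)). upair (At s (ufst x)) (At t (usnd x)))\<rparr>"

definition prod_fst :: "'u::universe scat \<Rightarrow> 'u scat \<Rightarrow> 'u sftr" where
  "prod_fst A B = \<lparr>Src = A \<otimes> B, Tgt = A,
    FO = (\<lambda>x \<in> Obj (A \<otimes> B). ufst x), FA = (\<lambda>h \<in> Arr (A \<otimes> B). ufst h)\<rparr>"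

text \<open>The functor \<open>a \<mapsto> (a, b)\<close> for an object \<open>b\<close> of \<open>B\<close>, and its functoriality in \<open>b\<close>.\<close>

definition slice_at :: "'u::universe scat \<Rightarrow> 'u scat \<Rightarrow> 'u \<Rightarrow> 'u sftr" where
  "slice_at A B b = \<lparr>Src = A, Tgt = A \<otimes> B,
    FO = (\<lambda>a \<in> Obj A. upair a b), FA = (\<lambda>f \<in> Arr A. upair f (Idn B b))\<rparr>"

definition slice_along :: "'u::universe scat \<Rightarrow> 'u scat \<Rightarrow> 'u \<Rightarrow> 'u snt" where
  "slice_along A B \<beta> = \<lparr>NSrc = slice_at A B (Dom B \<beta>), NTgt = slice_at A B (Cod B \<beta>),
    At = (\<lambda>a \<in> Obj A. upair (Idn A a) \<beta>)\<rparr>"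

definition coprod :: "'u set \<Rightarrow> ('u \<Rightarrow> 'u scat) \<Rightarrow> 'u::universe scat" where
  "coprod I A = (let P = {upair i x | i x. i \<in> I \<and> x \<in> Obj (A i)};
      M = {upair i f | i f. i \<in> I \<and> f \<in> Arr (A i)} in
    \<lparr>Obj = P,
     Arr = M,
     Dom = (\<lambda>h \<in> M. upair (ufst h) (Dom (A (ufst h)) (usnd h))),
     Cod = (\<lambda>h \<in> M. upair (ufst h) (Cod (A (ufst h)) (usnd h))),
     Idn = (\<lambda>x \<in> P. upair (ufst x) (Idn (A (ufst x)) (usnd x))),
     Cmp = (\<lambda>k h. if h \<in> M \<and> k \<in> M \<and> ufst h = ufst k \<and> composable (A (ufst h)) (usnd k) (usnd h)
       then upair (ufst h) (Cmp (A (ufst h)) (usnd k) (usnd h)) else undefined)\<rparr>)"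

definition coprod_incl :: "'u set \<Rightarrow> ('u \<Rightarrow> 'u scat) \<Rightarrow> 'u \<Rightarrow> 'u::universe sftr" where
  "coprod_incl I A i = \<lparr>Src = A i, Tgt = coprod I A,
    FO = (\<lambda>x \<in> Obj (A i). upair i x), FA = (\<lambda>f \<in> Arr (A i). upair i f)\<rparr>"

definition full_subcat :: "('o, 'm) cat \<Rightarrow> 'o set \<Rightarrow> ('o, 'm) cat" where
  "full_subcat C S = (let P = Obj C \<inter> S; M = {f \<in> Arr C. Dom C f \<in> S \<and> Cod C f \<in> S} in
    \<lparr>Obj = P,
     Arr = M,
     Dom = (\<lambda>f \<in> M. Dom C f),
     Cod = (\<lambda>f \<in> M. Cod C f),
     Idn = (\<lambda>x \<in> P. Idn C x),
     Cmp = (\<lambda>g f. if f \<in> M \<and> g \<in> M \<and> composable C g f then Cmp C g f else undefined)\<rparr>)"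

definition full_subcat_incl :: "('o, 'm) cat \<Rightarrow> 'o set \<Rightarrow> ('o, 'm, 'o, 'm) ftr" where
  "full_subcat_incl C S = \<lparr>Src = full_subcat C S, Tgt = C,
    FO = (\<lambda>x \<in> Obj (full_subcat C S). x), FA = (\<lambda>f \<in> Arr (full_subcat C S). f)\<rparr>"

text \<open>The comma category of \<open>u : A \<rightarrow> C\<close> and \<open>v : B \<rightarrow> C\<close>.  Its objects are triples \<open>(a, b, f)\<close> with
  \<open>f : u a \<rightarrow> v b\<close>; an arrow \<open>x \<rightarrow> y\<close> given by \<open>h\<close> in \<open>A\<close> and \<open>k\<close> in \<open>B\<close> is coded as
  \<open>((x, y), (h, k))\<close>.\<close>

definition comma_objs :: "'u::universe sftr \<Rightarrow> 'u sftr \<Rightarrow> 'u set" where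
  "comma_objs u v = {upair a (upair b f) | a b f.
    a \<in> Obj (Src u) \<and> b \<in> Obj (Src v) \<and> f \<in> Hom (Tgt u) (FO u a) (FO v b)}"

definition comma_arrs :: "'u::universe sftr \<Rightarrow> 'u sftr \<Rightarrow> 'u set" where
  "comma_arrs u v = {upair (upair (upair a (upair b f)) (upair a' (upair b' f'))) (upair h k)
    | a b f a' b' f' h k.
    upair a (upair b f) \<in> comma_objs u v \<and> upair a' (upair b' f') \<in> comma_objs u v \<and>
    h \<in> Hom (Src u) a a' \<and> k \<in> Hom (Src v) b b' \<and>
    Cmp (Tgt u) f' (FA u h) = Cmp (Tgt u) (FA v k) f}"

definition comma :: "'u::universe sftr \<Rightarrow> 'u sftr \<Rightarrow> 'u scat" where
  "comma u v = (let M = comma_arrs u v in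
    \<lparr>Obj = comma_objs u v,
     Arr = M,
     Dom = (\<lambda>w \<in> M. ufst (ufst w)),
     Cod = (\<lambda>w \<in> M. usnd (ufst w)),
     Idn = (\<lambda>x \<in> comma_objs u v.
       upair (upair x x) (upair (Idn (Src u) (ufst x)) (Idn (Src v) (ufst (usnd x))))),
     Cmp = (\<lambda>z w. if w \<in> M \<and> z \<in> M \<and> usnd (ufst w) = ufst (ufst z)
       then upair (upair (ufst (ufst w)) (usnd (ufst z)))
         (upair (Cmp (Src u) (ufst (usnd z)) (ufst (usnd w)))
           (Cmp (Src v) (usnd (usnd z)) (usnd (usnd w))))
       else undefined)\<rparr>)"

definition comma_fst :: "'u::universe sftr \<Rightarrow> 'u sftr \<Rightarrow> 'u sftr" where
  "comma_fst u v = \<lparr>Src = comma u v, Tgt = Src u,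
    FO = (\<lambda>x \<in> comma_objs u v. ufst x), FA = (\<lambda>w \<in> comma_arrs u v. ufst (usnd w))\<rparr>"

definition comma_snd :: "'u::universe sftr \<Rightarrow> 'u sftr \<Rightarrow> 'u sftr" where
  "comma_snd u v = \<lparr>Src = comma u v, Tgt = Src v,
    FO = (\<lambda>x \<in> comma_objs u v. ufst (usnd x)), FA = (\<lambda>w \<in> comma_arrs u v. usnd (usnd w))\<rparr>"

definition comma_nt :: "'u::universe sftr \<Rightarrow> 'u sftr \<Rightarrow> 'u snt" where
  "comma_nt u v = \<lparr>NSrc = u \<odot> comma_fst u v, NTgt = v \<odot> comma_snd u v,
    At = (\<lambda>x \<in> comma_objs u v. usnd (usnd x))\<rparr>"

definition square :: "'u::universe scat" where
  "square = simplex 1 \<otimes> simplex 1"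

definition corner :: "nat \<Rightarrow> nat \<Rightarrow> 'u::universe" where
  "corner i j = upair (unat i) (unat j)"

definition ulcorner :: "'u::universe scat" where
  "ulcorner = full_subcat square (- {corner 1 1})"

definition ulcorner_incl :: "'u::universe sftr" where
  "ulcorner_incl = full_subcat_incl square (- {corner 1 1})"

definition lrcorner :: "'u::universe scat" where
  "lrcorner = full_subcat square (- {corner 0 0})"

definition lrcorner_incl :: "'u::universe sftr" where
  "lrcorner_incl = full_subcat_incl square (- {corner 0 0})"

section \<open>Derivators\<close>

text \<open>\<open>DFun D u\<close> and \<open>DNat D t\<close> are the functor \<open>u\<^sup>*\<close> and the natural transformation \<open>t\<^sup>*\<close>.\<close>

record ('u, 'o, 'm) pder =
  DCat :: "'u scat \<Rightarrow> ('o, 'm) cat"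
  DFun :: "'u sftr \<Rightarrow> ('o, 'm, 'o, 'm) ftr"
  DNat :: "'u snt \<Rightarrow> ('o, 'm, 'o, 'm) nt"

locale prederivator =
  fixes D :: "('u::universe, 'o, 'm) pder"
  assumes DCat_category: "small_cat A \<Longrightarrow> category (DCat D A)"
    and DFun_functor: "small_functor u \<Longrightarrow>
      functor_between (DFun D u) (DCat D (Tgt u)) (DCat D (Src u))"
    and DNat_nt: "small_nt t \<Longrightarrow> nt_between (DNat D t) (DFun D (NSrc t)) (DFun D (NTgt t))"
    and DFun_fid: "small_cat A \<Longrightarrow> DFun D (fid A) = fid (DCat D A)"
    and DFun_fcomp: "small_functor u \<Longrightarrow> small_functor v \<Longrightarrow> Tgt u = Src v \<Longrightarrow>
      DFun D (v \<odot> u) = DFun D u \<odot> DFun D v"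
    and DNat_nid: "small_functor u \<Longrightarrow> DNat D (nid u) = nid (DFun D u)"
    and DNat_vcomp: "small_nt s \<Longrightarrow> small_nt t \<Longrightarrow> NTgt s = NSrc t \<Longrightarrow>
      DNat D (t \<cdot> s) = DNat D t \<cdot> DNat D s"
    and DNat_hcomp: "small_nt t \<Longrightarrow> small_nt s \<Longrightarrow> Tgt (NSrc t) = Src (NSrc s) \<Longrightarrow>
      DNat D (hcomp s t) = hcomp (DNat D t) (DNat D s)"

text \<open>The left Kan extension functor \<open>u\<^sub>!\<close>, with unit \<open>id \<rightarrow> u\<^sup>* u\<^sub>!\<close> and counit \<open>u\<^sub>! u\<^sup>* \<rightarrow> id\<close>.\<close>

definition lan :: "('u, 'o, 'm) pder \<Rightarrow> 'u sftr \<Rightarrow> ('o, 'm, 'o, 'm) ftr" where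
  "lan D u = fst (chosen_left_adjoint (DFun D u))"

definition lan_unit :: "('u, 'o, 'm) pder \<Rightarrow> 'u sftr \<Rightarrow> ('o, 'm, 'o, 'm) nt" where
  "lan_unit D u = fst (snd (chosen_left_adjoint (DFun D u)))"

definition lan_counit :: "('u, 'o, 'm) pder \<Rightarrow> 'u sftr \<Rightarrow> ('o, 'm, 'o, 'm) nt" where
  "lan_counit D u = snd (snd (chosen_left_adjoint (DFun D u)))"

text \<open>The right Kan extension functor \<open>u\<^sub>*\<close>, with unit \<open>id \<rightarrow> u\<^sub>* u\<^sup>*\<close> and counit \<open>u\<^sup>* u\<^sub>* \<rightarrow> id\<close>.\<close>

definition ran :: "('u, 'o, 'm) pder \<Rightarrow> 'u sftr \<Rightarrow> ('o, 'm, 'o, 'm) ftr" where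
  "ran D u = fst (chosen_right_adjoint (DFun D u))"

definition ran_unit :: "('u, 'o, 'm) pder \<Rightarrow> 'u sftr \<Rightarrow> ('o, 'm, 'o, 'm) nt" where
  "ran_unit D u = fst (snd (chosen_right_adjoint (DFun D u)))"

definition ran_counit :: "('u, 'o, 'm) pder \<Rightarrow> 'u sftr \<Rightarrow> ('o, 'm, 'o, 'm) nt" where
  "ran_counit D u = snd (snd (chosen_right_adjoint (DFun D u)))"

text \<open>The mates of \<open>\<phi>\<^sup>* : p\<^sup>* u\<^sup>* \<rightarrow> q\<^sup>* v\<^sup>*\<close> for a natural transformation \<open>\<phi> : u p \<rightarrow> v q\<close>: the first is
  \<open>q\<^sub>! p\<^sup>* \<rightarrow> q\<^sub>! p\<^sup>* u\<^sup>* u\<^sub>! \<rightarrow> q\<^sub>! q\<^sup>* v\<^sup>* u\<^sub>! \<rightarrow> v\<^sup>* u\<^sub>!\<close>, the second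
  \<open>u\<^sup>* v\<^sub>* \<rightarrow> p\<^sub>* p\<^sup>* u\<^sup>* v\<^sub>* \<rightarrow> p\<^sub>* q\<^sup>* v\<^sup>* v\<^sub>* \<rightarrow> p\<^sub>* q\<^sup>*\<close>.\<close>

definition left_square_mate :: "('u, 'o, 'm) pder \<Rightarrow> 'u sftr \<Rightarrow> 'u sftr \<Rightarrow> 'u sftr \<Rightarrow> 'u sftr \<Rightarrow>
    'u snt \<Rightarrow> ('o, 'm, 'o, 'm) nt" where
  "left_square_mate D p q u v \<phi> =
    (lan_counit D q \<triangleleft> (DFun D v \<odot> lan D u))
    \<cdot> (lan D q \<triangleright> (DNat D \<phi> \<triangleleft> lan D u))
    \<cdot> ((lan D q \<odot> DFun D p) \<triangleright> lan_unit D u)"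

definition right_square_mate :: "('u, 'o, 'm) pder \<Rightarrow> 'u sftr \<Rightarrow> 'u sftr \<Rightarrow> 'u sftr \<Rightarrow> 'u sftr \<Rightarrow>
    'u snt \<Rightarrow> ('o, 'm, 'o, 'm) nt" where
  "right_square_mate D p q u v \<phi> =
    ((ran D p \<odot> DFun D q) \<triangleright> ran_counit D v)
    \<cdot> (ran D p \<triangleright> (DNat D \<phi> \<triangleleft> ran D v))
    \<cdot> (ran_unit D p \<triangleleft> (DFun D u \<odot> ran D v))"

text \<open>In the last two axioms, \<open>comma u (point B b)\<close> is \<open>(u/b)\<close> and \<open>comma (point B b) u\<close> is \<open>(b/u)\<close>,
  with the unique functors to \<^const>\<open>one\<close> as second and first projection, respectively.\<close>

locale derivator = prederivator D
  for D :: "('u::universe, 'o, 'm) pder" +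
  assumes der1: "small_set I \<Longrightarrow> (\<And>i. i \<in> I \<Longrightarrow> small_cat (K i)) \<Longrightarrow>
      equivalence_functor
        (family_tuple (DCat D (coprod I K)) I (\<lambda>i. DFun D (coprod_incl I K i)))"
    and der2: "small_cat A \<Longrightarrow> f \<in> Arr (DCat D A) \<Longrightarrow>
      iso_arr (DCat D A) f \<longleftrightarrow> (\<forall>a \<in> Obj A. iso_arr (DCat D one) (FA (DFun D (point A a)) f))"
    and der3_left: "small_functor u \<Longrightarrow> \<exists>L \<eta> \<epsilon>. adjunction L (DFun D u) \<eta> \<epsilon>"
    and der3_right: "small_functor u \<Longrightarrow> \<exists>R \<eta> \<epsilon>. adjunction (DFun D u) R \<eta> \<epsilon>"
    and der4_left: "small_functor u \<Longrightarrow> b \<in> Obj (Tgt u) \<Longrightarrow>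
      nat_iso (let b' = point (Tgt u) b in
        left_square_mate D (comma_fst u b') (comma_snd u b') u b' (comma_nt u b'))"
    and der4_right: "small_functor u \<Longrightarrow> b \<in> Obj (Tgt u) \<Longrightarrow>
      nat_iso (let b' = point (Tgt u) b in
        right_square_mate D (comma_fst b' u) (comma_snd b' u) b' u (comma_nt b' u))"

definition shift :: "'u::universe scat \<Rightarrow> ('u, 'o, 'm) pder \<Rightarrow> ('u, 'o, 'm) pder" where
  "shift B D = \<lparr>DCat = (\<lambda>A. DCat D (B \<otimes> A)),
    DFun = (\<lambda>u. DFun D (ftr_prod (fid B) u)),
    DNat = (\<lambda>t. DNat D (nt_prod (nid (fid B)) t))\<rparr>"

text \<open>The underlying diagram functor \<open>D(A \<times> B) \<rightarrow> D(A)\<^sup>B\<close>.\<close>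

definition underlying_diagram :: "('u::universe, 'o, 'm) pder \<Rightarrow> 'u scat \<Rightarrow> 'u scat \<Rightarrow>
    ('o, 'm, ('u, 'u, 'o, 'm) ftr, ('u, 'u, 'o, 'm) nt) ftr" where
  "underlying_diagram D A B = (let
      dia = (\<lambda>X. \<lparr>Src = B, Tgt = DCat D A,
        FO = (\<lambda>b \<in> Obj B. FO (DFun D (slice_at A B b)) X),
        FA = (\<lambda>\<beta> \<in> Arr B. At (DNat D (slice_along A B \<beta>)) X)\<rparr>) in
    \<lparr>Src = DCat D (A \<otimes> B), Tgt = functor_cat B (DCat D A),
     FO = (\<lambda>X \<in> Obj (DCat D (A \<otimes> B)). dia X),
     FA = (\<lambda>f \<in> Arr (DCat D (A \<otimes> B)).
       \<lparr>NSrc = dia (Dom (DCat D (A \<otimes> B)) f), NTgt = dia (Cod (DCat D (A \<otimes> B)) f),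
        At = (\<lambda>b \<in> Obj B. FA (DFun D (slice_at A B b)) f)\<rparr>)\<rparr>)"

definition strong :: "('u::universe, 'o, 'm) pder \<Rightarrow> bool" where
  "strong D \<longleftrightarrow> (\<forall>A. small_cat A \<longrightarrow>
    full (underlying_diagram D A (simplex 1)) \<and> ess_surj (underlying_diagram D A (simplex 1)))"

definition pointed :: "('u::universe, 'o, 'm) pder \<Rightarrow> bool" where
  "pointed D \<longleftrightarrow> (\<exists>x. zero_obj (DCat D one) x)"

definition cocartesian :: "('u::universe, 'o, 'm) pder \<Rightarrow> 'o \<Rightarrow> bool" where
  "cocartesian D X \<longleftrightarrow> in_ess_image (lan D ulcorner_incl) X"

definition cartesian :: "('u::universe, 'o, 'm) pder \<Rightarrow> 'o \<Rightarrow> bool" where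
  "cartesian D X \<longleftrightarrow> in_ess_image (ran D lrcorner_incl) X"

locale stable_derivator = derivator D
  for D :: "('u::universe, 'o, 'm) pder" +
  assumes pointed: "pointed D"
    and stable: "X \<in> Obj (DCat D square) \<Longrightarrow> cartesian D X \<longleftrightarrow> cocartesian D X"

locale strong_stable_derivator = stable_derivator D
  for D :: "('u::universe, 'o, 'm) pder" +
  assumes strong: "strong D"

section \<open>Morphisms of derivators\<close>

record ('u, 'o, 'm, 'p, 'q) pmor =
  MFun :: "'u scat \<Rightarrow> ('o, 'm, 'p, 'q) ftr"
  MIso :: "'u sftr \<Rightarrow> ('o, 'm, 'p, 'q) nt"  \<comment> \<open>\<open>MIso F u\<close> is \<open>\<gamma>\<^sub>u : u\<^sup>* F\<^sub>B \<rightarrow> F\<^sub>A u\<^sup>*\<close> for \<open>u : A \<rightarrow> B\<close>\<close>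

locale morphism =
  fixes D :: "('u::universe, 'o, 'm) pder" and E :: "('u, 'p, 'q) pder"
    and F :: "('u, 'o, 'm, 'p, 'q) pmor"
  assumes MFun_functor: "small_cat A \<Longrightarrow> functor_between (MFun F A) (DCat D A) (DCat E A)"
    and MIso_iso: "small_functor u \<Longrightarrow> nat_iso (MIso F u)"
    and MIso_between: "small_functor u \<Longrightarrow>
      nt_between (MIso F u) (DFun E u \<odot> MFun F (Tgt u)) (MFun F (Src u) \<odot> DFun D u)"
    and MIso_fid: "small_cat A \<Longrightarrow> MIso F (fid A) = nid (MFun F A)"
    and MIso_fcomp: "small_functor u \<Longrightarrow> small_functor v \<Longrightarrow> Tgt u = Src v \<Longrightarrow>
      MIso F (v \<odot> u) = (MIso F u \<triangleleft> DFun D v) \<cdot> (DFun E u \<triangleright> MIso F v)"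
    and MIso_natural: "small_nt t \<Longrightarrow>
      (MFun F (Src (NSrc t)) \<triangleright> DNat D t) \<cdot> MIso F (NSrc t)
      = MIso F (NTgt t) \<cdot> (DNat E t \<triangleleft> MFun F (Tgt (NSrc t)))"

locale modification =
  fixes D :: "('u::universe, 'o, 'm) pder" and E :: "('u, 'p, 'q) pder"
    and F G :: "('u, 'o, 'm, 'p, 'q) pmor" and \<alpha> :: "'u scat \<Rightarrow> ('o, 'm, 'p, 'q) nt"
  assumes component_nt: "small_cat A \<Longrightarrow> nt_between (\<alpha> A) (MFun F A) (MFun G A)"
    and component_compat: "small_functor u \<Longrightarrow>
      (\<alpha> (Src u) \<triangleleft> DFun D u) \<cdot> MIso F u = MIso G u \<cdot> (DFun E u \<triangleright> \<alpha> (Tgt u))"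

definition shift_mor ::
    "'u::universe scat \<Rightarrow> ('u, 'o, 'm, 'p, 'q) pmor \<Rightarrow> ('u, 'o, 'm, 'p, 'q) pmor" where
  "shift_mor B F = \<lparr>MFun = (\<lambda>A. MFun F (B \<otimes> A)), MIso = (\<lambda>u. MIso F (ftr_prod (fid B) u))\<rparr>"

text \<open>The canonical mates \<open>u\<^sub>! F\<^sub>A \<rightarrow> F\<^sub>B u\<^sub>!\<close> and \<open>F\<^sub>B u\<^sub>* \<rightarrow> u\<^sub>* F\<^sub>A\<close> for \<open>u : A \<rightarrow> B\<close>.\<close>

definition left_mate :: "('u, 'o, 'm) pder \<Rightarrow> ('u, 'p, 'q) pder \<Rightarrow> ('u, 'o, 'm, 'p, 'q) pmor \<Rightarrow>
    'u sftr \<Rightarrow> ('o, 'm, 'p, 'q) nt" where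
  "left_mate D E F u =
    (lan_counit E u \<triangleleft> (MFun F (Tgt u) \<odot> lan D u))
    \<cdot> (lan E u \<triangleright> (nt_inv (MIso F u) \<triangleleft> lan D u))
    \<cdot> ((lan E u \<odot> MFun F (Src u)) \<triangleright> lan_unit D u)"

definition right_mate :: "('u, 'o, 'm) pder \<Rightarrow> ('u, 'p, 'q) pder \<Rightarrow> ('u, 'o, 'm, 'p, 'q) pmor \<Rightarrow>
    'u sftr \<Rightarrow> ('o, 'm, 'p, 'q) nt" where
  "right_mate D E F u =
    ((ran E u \<odot> MFun F (Src u)) \<triangleright> ran_counit D u)
    \<cdot> (ran E u \<triangleright> (MIso F u \<triangleleft> ran D u))
    \<cdot> (ran_unit E u \<triangleleft> (MFun F (Tgt u) \<odot> ran D u))"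

definition preserves_lan :: "('u, 'o, 'm) pder \<Rightarrow> ('u, 'p, 'q) pder \<Rightarrow>
    ('u, 'o, 'm, 'p, 'q) pmor \<Rightarrow> 'u sftr \<Rightarrow> bool" where
  "preserves_lan D E F u \<longleftrightarrow> nat_iso (left_mate D E F u)"

definition preserves_ran :: "('u, 'o, 'm) pder \<Rightarrow> ('u, 'p, 'q) pder \<Rightarrow>
    ('u, 'o, 'm, 'p, 'q) pmor \<Rightarrow> 'u sftr \<Rightarrow> bool" where
  "preserves_ran D E F u \<longleftrightarrow> nat_iso (right_mate D E F u)"

locale exact_morphism = morphism D E F
  for D :: "('u::universe, 'o, 'm) pder" and E :: "('u, 'p, 'q) pder"
    and F :: "('u, 'o, 'm, 'p, 'q) pmor" +
  assumes preserves_initial: "preserves_lan D E F (to_one empty_cat)"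
    and preserves_pushouts: "preserves_lan D E F (to_one ulcorner)"
    and preserves_terminal: "preserves_ran D E F (to_one empty_cat)"
    and preserves_pullbacks: "preserves_ran D E F (to_one lrcorner)"

section \<open>Suspension and the canonical exact structure\<close>

definition suspension :: "('u::universe, 'o, 'm) pder \<Rightarrow> ('o, 'm, 'o, 'm) ftr" where
  "suspension D =
    DFun D (point square (corner 1 1)) \<odot> lan D ulcorner_incl \<odot> ran D (point ulcorner (corner 0 0))"

text \<open>The comparison \<open>\<psi> : \<Sigma> F \<rightarrow> F \<Sigma>\<close> at the terminal category.\<close>

definition suspension_comparison :: "('u::universe, 'o, 'm) pder \<Rightarrow> ('u, 'p, 'q) pder \<Rightarrow>
    ('u, 'o, 'm, 'p, 'q) pmor \<Rightarrow> ('o, 'm, 'p, 'q) nt" where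
  "suspension_comparison D E F = (let i = point ulcorner (corner 0 0); e = point square (corner 1 1) in
    (MIso F e \<triangleleft> (lan D ulcorner_incl \<odot> ran D i))
    \<cdot> (DFun E e \<triangleright> (left_mate D E F ulcorner_incl \<triangleleft> ran D i))
    \<cdot> ((DFun E e \<odot> lan E ulcorner_incl) \<triangleright> nt_inv (right_mate D E F i)))"

definition exact_structure_one :: "('u::universe, 'o, 'm) pder \<Rightarrow> ('u, 'p, 'q) pder \<Rightarrow>
    ('u, 'o, 'm, 'p, 'q) pmor \<Rightarrow> ('o, 'm, 'p, 'q) nt" where
  "exact_structure_one D E F = nt_inv (suspension_comparison D E F)"

text \<open>The suspension of the shifted derivator is an endofunctor of \<open>D(A \<times> \<one>)\<close> rather than of \<open>D(A)\<close>.
  It is transported along the isomorphism \<open>r : A \<times> \<one> \<rightarrow> A\<close> with inverse \<open>s\<close>, which induces an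
  isomorphism of categories \<open>r\<^sup>* : D(A) \<rightarrow> D(A \<times> \<one>)\<close> with inverse \<open>s\<^sup>*\<close>.  Accordingly, the exact
  structure on \<open>F\<^sub>A\<close> is
  \<open>F\<^sub>A s\<^sup>* \<Sigma> r\<^sup>* \<rightarrow> s\<^sup>* F\<^bsub>A \<times> \<one>\<^esub> \<Sigma> r\<^sup>* \<rightarrow> s\<^sup>* \<Sigma> F\<^bsub>A \<times> \<one>\<^esub> r\<^sup>* \<rightarrow> s\<^sup>* \<Sigma> r\<^sup>* F\<^sub>A\<close>.\<close>

definition suspension_at ::
    "('u::universe, 'o, 'm) pder \<Rightarrow> 'u scat \<Rightarrow> ('o, 'm, 'o, 'm) ftr" where
  "suspension_at D A =
    DFun D (slice_at A one (unat 0)) \<odot> suspension (shift A D) \<odot> DFun D (prod_fst A one)"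

definition canonical_exact_structure :: "('u::universe, 'o, 'm) pder \<Rightarrow> ('u, 'p, 'q) pder \<Rightarrow>
    ('u, 'o, 'm, 'p, 'q) pmor \<Rightarrow> 'u scat \<Rightarrow> ('o, 'm, 'p, 'q) nt" where
  "canonical_exact_structure D E F A = (let s = slice_at A one (unat 0); r = prod_fst A one in
    ((DFun E s \<odot> suspension (shift A E)) \<triangleright> nt_inv (MIso F r))
    \<cdot> (DFun E s \<triangleright> (exact_structure_one (shift A D) (shift A E) (shift_mor A F) \<triangleleft> DFun D r))
    \<cdot> (nt_inv (MIso F s) \<triangleleft> (suspension (shift A D) \<odot> DFun D r)))"

end

theory Submission
  imports Defs
begin

text \<open>
  A natural transformation of morphisms of derivators commutes with the structure isomorphisms
  \<open>\<gamma>\<^sub>u\<close> and, by naturality, with the images of units and counits.  The mates of \<open>F\<close> along \<open>u\<^sub>!\<close> and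
  \<open>u\<^sub>*\<close> are transposes of composites of just these arrows, so \<open>\<alpha>\<close> commutes with the mates as well
  (\<open>component_left_mate\<close>, \<open>component_right_mate\<close>): both composites have the same transpose.  The
  comparison \<open>\<psi> : \<Sigma> F \<rightarrow> F \<Sigma>\<close> is put together from two mates and a \<open>\<gamma>\<close>, and the exact structure is its
  inverse.  A commutative square remains commutative when two parallel sides are inverted, which gives
  the claim.

  The inversion is the point where exactness enters.  Inverses are picked by a definite description,
  so nothing can be said about the exact structure unless \<open>\<psi>\<close> is invertible for the morphism
  \<open>F\<^sup>A\<close> between the shifted derivators, while exactness of \<open>F\<close> concerns colimits and limits in the
  unshifted ones.  Isomorphisms are detected at the objects \<open>(a, x)\<close> of a product, and the values of
  the Kan extensions there are described by Der4 and by adjunctions between the diagrams.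

  \<^item> For \<open>\<psi>\<close>, the mate along \<open>A \<times> ulcorner \<rightarrow> A \<times> square\<close> has to be invertible only at the objects \<open>(a, (1, 1))\<close>.
    The slice over such an object contains \<open>{a} \<times> ulcorner\<close> as a reflective subcategory, hence as a final
    one, because \<open>(1, 1)\<close> is terminal in the square.  The left Kan extension is therefore the colimit
    over \<open>ulcorner\<close>, which \<open>F\<close> preserves (\<open>left_mate_iso_terminal\<close>).
  \<^item> The mate along \<open>A \<times> \<one> \<rightarrow> A \<times> ulcorner\<close> at \<open>(0, 0)\<close> has to be invertible everywhere.  At \<open>(a, (0, 0))\<close> this
    holds because \<open>(0, 0)\<close> is initial, so that the right Kan extension does not change the values
    there.  At the other objects the slices are empty, so the values are terminal objects, which \<open>F\<close>
    preserves (\<open>right_mate_iso_sieve\<close>).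

  Adjoints, units and counits are arbitrary choices, and a mate depends on them.  Invertibility of a mate
  does not: it says that a certain arrow, which involves one adjoint fewer, is universal
  (\<open>transpose_iso_iff\<close>).  Universal arrows can be restricted, pasted and transported along \<open>F\<close> one
  object at a time, and this replaces most of the calculus of mates.
\<close>

section \<open>Inverses in a category\<close>

definition inv_arr :: "('o, 'm) cat \<Rightarrow> 'm \<Rightarrow> 'm" where
  "inv_arr C f = (THE g. inverse_arr C f g)"

context category
begin

lemma cmp_simps [simp]:
  assumes "f \<in> Arr C" "g \<in> Arr C" "Cod C f = Dom C g"
  shows "Cmp C g f \<in> Arr C" "Dom C (Cmp C g f) = Dom C f" "Cod C (Cmp C g f) = Cod C g"
  using Cmp_Hom[of f "Dom C f" "Cod C f" g "Cod C g"] assms by (auto simp: Hom_def)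

lemma idn_simps [simp]:
  assumes "x \<in> Obj C"
  shows "Idn C x \<in> Arr C" "Dom C (Idn C x) = x" "Cod C (Idn C x) = x"
  using Idn_Hom[OF assms] by (auto simp: Hom_def)

lemma cmp_assoc:
  assumes "f \<in> Arr C" "g \<in> Arr C" "h \<in> Arr C" "Cod C f = Dom C g" "Cod C g = Dom C h"
  shows "Cmp C (Cmp C h g) f = Cmp C h (Cmp C g f)"
  using Cmp_assoc[of f "Dom C f" "Cod C f" g "Cod C g" h "Cod C h"] assms by (auto simp: Hom_def)

lemma cmp_idn [simp]:
  assumes "f \<in> Arr C"
  shows "Dom C f = x \<Longrightarrow> Cmp C f (Idn C x) = f" "Cod C f = x \<Longrightarrow> Cmp C (Idn C x) f = f"
  using Cmp_Idn_left[of f "Dom C f" "Cod C f"] Cmp_Idn_right[of f "Dom C f" "Cod C f"] assms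
  by (auto simp: Hom_def)

lemma obj_simps [simp]: "f \<in> Arr C \<Longrightarrow> Dom C f \<in> Obj C" "f \<in> Arr C \<Longrightarrow> Cod C f \<in> Obj C"
  by (fact Dom_Obj Cod_Obj)+

lemma hom_obj: "f \<in> Hom C x y \<Longrightarrow> x \<in> Obj C" "f \<in> Hom C x y \<Longrightarrow> y \<in> Obj C"
  by (auto simp: Hom_def)

lemma inverse_arr_unique:
  assumes "inverse_arr C f g" "inverse_arr C f h"
  shows "g = h"
proof -
  have f: "f \<in> Arr C" and g: "g \<in> Arr C" "Dom C g = Cod C f" "Cod C g = Dom C f"
    and h: "h \<in> Arr C" "Dom C h = Cod C f" "Cod C h = Dom C f"
    using assms by (auto simp: inverse_arr_def Hom_def)
  have "g = Cmp C g (Cmp C f h)"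
    using assms g by (simp add: inverse_arr_def)
  also have "\<dots> = Cmp C (Cmp C g f) h"
    using f g h by (simp add: cmp_assoc)
  also have "\<dots> = h"
    using assms h by (simp add: inverse_arr_def)
  finally show ?thesis .
qed

lemma inv_arr_eq: "inverse_arr C f g \<Longrightarrow> inv_arr C f = g"
  unfolding inv_arr_def by (blast intro: inverse_arr_unique)

lemma inv_arr_simps [simp]:
  assumes "iso_arr C f"
  shows "f \<in> Arr C" "inv_arr C f \<in> Arr C"
    "Dom C (inv_arr C f) = Cod C f" "Cod C (inv_arr C f) = Dom C f"
    "Cmp C (inv_arr C f) f = Idn C (Dom C f)" "Cmp C f (inv_arr C f) = Idn C (Cod C f)"
proof -
  obtain g where "inverse_arr C f g"
    using assms unfolding iso_arr_def by blast
  with inv_arr_eq[OF this] have "inverse_arr C f (inv_arr C f)"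
    by simp
  then show "f \<in> Arr C" "inv_arr C f \<in> Arr C"
    "Dom C (inv_arr C f) = Cod C f" "Cod C (inv_arr C f) = Dom C f"
    "Cmp C (inv_arr C f) f = Idn C (Dom C f)" "Cmp C f (inv_arr C f) = Idn C (Cod C f)"
    unfolding inverse_arr_def Hom_def by blast+
qed

lemma isoI:
  assumes "f \<in> Hom C x y" "g \<in> Hom C y x" "Cmp C g f = Idn C x" "Cmp C f g = Idn C y"
  shows "iso_arr C f"
proof -
  have "inverse_arr C f g"
    using assms by (simp add: inverse_arr_def Hom_def)
  then show ?thesis
    unfolding iso_arr_def by blast
qed

lemma iso_inv: "iso_arr C f \<Longrightarrow> iso_arr C (inv_arr C f)"
  by (rule isoI[of _ "Cod C f" "Dom C f" f]) (auto simp: Hom_def)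

lemma cmp_inv_cancel [simp]:
  assumes "iso_arr C f" "g \<in> Arr C"
  shows "Cod C g = Dom C f \<Longrightarrow> Cmp C (inv_arr C f) (Cmp C f g) = g"
    and "Cod C g = Cod C f \<Longrightarrow> Cmp C f (Cmp C (inv_arr C f) g) = g"
proof -
  show "Cmp C (inv_arr C f) (Cmp C f g) = g" if "Cod C g = Dom C f"
    using that assms cmp_assoc[of g f "inv_arr C f"] by simp
  show "Cmp C f (Cmp C (inv_arr C f) g) = g" if "Cod C g = Cod C f"
    using that assms cmp_assoc[of g "inv_arr C f" f] by simp
qed

lemma inverse_arr_cmp:
  assumes "iso_arr C f" "iso_arr C g" "Cod C f = Dom C g"
  shows "inverse_arr C (Cmp C g f) (Cmp C (inv_arr C f) (inv_arr C g))"
  using assms by (auto simp: inverse_arr_def Hom_def cmp_assoc)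

lemma iso_cmp: "iso_arr C f \<Longrightarrow> iso_arr C g \<Longrightarrow> Cod C f = Dom C g \<Longrightarrow> iso_arr C (Cmp C g f)"
  unfolding iso_arr_def[of C "Cmp C g f"] by (rule exI, rule inverse_arr_cmp)

lemma iso_cancel_left:
  assumes "iso_arr C (Cmp C g f)" "iso_arr C g" "f \<in> Arr C" "Cod C f = Dom C g"
  shows "iso_arr C f"
  using iso_cmp[OF assms(1) iso_inv[OF assms(2)]] assms by simp

lemma inv_square:
  assumes "iso_arr C t" "iso_arr C t'" "a \<in> Hom C (Dom C t) (Dom C t')"
    "b \<in> Hom C (Cod C t) (Cod C t')" "Cmp C b t = Cmp C t' a"
  shows "Cmp C a (inv_arr C t) = Cmp C (inv_arr C t') b"
proof -
  have "Cmp C a (inv_arr C t) = Cmp C (inv_arr C t') (Cmp C (Cmp C t' a) (inv_arr C t))"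
    using assms(1-4) by (auto simp: Hom_def cmp_assoc)
  also have "\<dots> = Cmp C (inv_arr C t') b"
    using assms(1-4) by (simp add: assms(5)[symmetric] Hom_def cmp_assoc)
  finally show ?thesis .
qed

lemma terminal_iso:
  assumes "terminal_obj C x" "terminal_obj C y" "f \<in> Hom C x y"
  shows "iso_arr C f"
proof -
  obtain g where g: "g \<in> Hom C y x"
    using assms(1,2) unfolding terminal_obj_def by blast
  have "Cmp C g f \<in> Hom C x x" "Idn C x \<in> Hom C x x" "Cmp C f g \<in> Hom C y y" "Idn C y \<in> Hom C y y"
    using assms g Idn_Hom by (auto intro: Cmp_Hom simp: terminal_obj_def)
  then have "Cmp C g f = Idn C x" "Cmp C f g = Idn C y"
    using assms(1,2) unfolding terminal_obj_def by blast+
  then show ?thesis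
    using isoI assms(3) g by blast
qed

lemma terminal_obj_iso:
  assumes "terminal_obj C y" "f \<in> Hom C x y" "iso_arr C f"
  shows "terminal_obj C x"
  unfolding terminal_obj_def
proof (intro conjI ballI)
  show x: "x \<in> Obj C" using assms(2) hom_obj by blast
  fix z assume z: "z \<in> Obj C"
  then obtain h where h: "h \<in> Hom C z y" "\<And>k. k \<in> Hom C z y \<Longrightarrow> k = h"
    using assms(1) unfolding terminal_obj_def by blast
  show "\<exists>!g. g \<in> Hom C z x"
  proof
    show "Cmp C (inv_arr C f) h \<in> Hom C z x"
      using h(1) assms by (auto simp: Hom_def)
    show "g = Cmp C (inv_arr C f) h" if "g \<in> Hom C z x" for g
      using h(2)[of "Cmp C f g", symmetric] that assms by (auto simp: Hom_def)
  qed
qed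

end

section \<open>Functors and natural transformations\<close>

lemma functor_betweenD:
  assumes "functor_between F C D"
  shows "category C" "category D" "Src F = C" "Tgt F = D" "is_functor F"
  using assms is_functor.Src_category is_functor.Tgt_category
  unfolding functor_between_def by auto

lemma functor_simps:
  assumes "functor_between F C D"
  shows "Src F = C" "Tgt F = D"
    and "x \<in> Obj C \<Longrightarrow> FO F x \<in> Obj D"
    and "f \<in> Arr C \<Longrightarrow> FA F f \<in> Arr D"
    and "f \<in> Arr C \<Longrightarrow> Dom D (FA F f) = FO F (Dom C f)"
    and "f \<in> Arr C \<Longrightarrow> Cod D (FA F f) = FO F (Cod C f)"
    and "x \<in> Obj C \<Longrightarrow> FA F (Idn C x) = Idn D (FO F x)"
    and "f \<in> Arr C \<Longrightarrow> g \<in> Arr C \<Longrightarrow> Cod C f = Dom C g \<Longrightarrow>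
      FA F (Cmp C g f) = Cmp D (FA F g) (FA F f)"
proof -
  interpret is_functor F by (rule functor_betweenD[OF assms])
  have [simp]: "Src F = C" "Tgt F = D" using functor_betweenD[OF assms] by auto
  show "Src F = C" "Tgt F = D" by simp_all
  show "x \<in> Obj C \<Longrightarrow> FO F x \<in> Obj D" using FO_Obj by simp
  show "f \<in> Arr C \<Longrightarrow> FA F f \<in> Arr D" "f \<in> Arr C \<Longrightarrow> Dom D (FA F f) = FO F (Dom C f)"
    "f \<in> Arr C \<Longrightarrow> Cod D (FA F f) = FO F (Cod C f)"
    using FA_Hom[of f "Dom C f" "Cod C f"] by (simp_all add: Hom_def)
  show "x \<in> Obj C \<Longrightarrow> FA F (Idn C x) = Idn D (FO F x)" using FA_Idn by simp
  show "FA F (Cmp C g f) = Cmp D (FA F g) (FA F f)"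
    if "f \<in> Arr C" "g \<in> Arr C" "Cod C f = Dom C g"
    using FA_Cmp[of f "Dom C f" "Cod C f" g "Cod C g"] that by (simp add: Hom_def)
qed

lemma functor_hom: "functor_between F C D \<Longrightarrow> f \<in> Hom C x y \<Longrightarrow> FA F f \<in> Hom D (FO F x) (FO F y)"
  using functor_simps[of F C D] by (auto simp: Hom_def)

lemma functor_inverse:
  assumes F: "functor_between F C D" and f: "iso_arr C f"
  shows "inverse_arr D (FA F f) (FA F (inv_arr C f))"
proof -
  interpret C: category C by (rule functor_betweenD[OF F])
  note [simp] = functor_simps[OF F]
  have "FA F (Cmp C (inv_arr C f) f) = Idn D (FO F (Dom C f))"
    "FA F (Cmp C f (inv_arr C f)) = Idn D (FO F (Cod C f))"
    using f by simp_all
  then show ?thesis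
    using f by (simp add: inverse_arr_def Hom_def del: C.inv_arr_simps(5,6))
qed

lemma functor_iso:
  assumes F: "functor_between F C D" and f: "iso_arr C f"
  shows "iso_arr D (FA F f)" and "FA F (inv_arr C f) = inv_arr D (FA F f)"
proof -
  show "iso_arr D (FA F f)"
    using functor_inverse[OF assms] unfolding iso_arr_def by blast
  show "FA F (inv_arr C f) = inv_arr D (FA F f)"
    using category.inv_arr_eq[OF functor_betweenD(2)[OF F] functor_inverse[OF assms]] by simp
qed

lemma functor_eqI:
  assumes "functor_between F C D" "functor_between G C D"
    "\<And>x. x \<in> Obj C \<Longrightarrow> FO F x = FO G x" "\<And>f. f \<in> Arr C \<Longrightarrow> FA F f = FA G f"
  shows "F = G"
proof (rule ftr.equality)
  show "FO F = FO G" "FA F = FA G"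
    using assms is_functor.FO_ext is_functor.FA_ext unfolding functor_between_def
    by (metis extensionalityI)+
qed (use assms in \<open>auto simp: functor_between_def\<close>)

lemma functor_fid: "category C \<Longrightarrow> functor_between (fid C) C C"
  by (auto simp: functor_between_def is_functor_def fid_def Hom_def category.cmp_simps
      category.idn_simps category.Dom_Obj category.Cod_Obj)

lemma functor_fcomp:
  assumes F: "functor_between F C D" and G: "functor_between G D E"
  shows "functor_between (G \<odot> F) C E"
proof -
  interpret C: category C by (rule functor_betweenD[OF F])
  note [simp] = functor_simps[OF F] functor_simps[OF G]
  show ?thesis
    using functor_betweenD[OF F] functor_betweenD[OF G]
    by (auto simp: functor_between_def is_functor_def fcomp_def Hom_def)
qed

lemma fcomp_sel [simp]:
  "Src (G \<odot> F) = Src F" "Tgt (G \<odot> F) = Tgt G"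
  "x \<in> Obj (Src F) \<Longrightarrow> FO (G \<odot> F) x = FO G (FO F x)"
  "f \<in> Arr (Src F) \<Longrightarrow> FA (G \<odot> F) f = FA G (FA F f)"
  by (simp_all add: fcomp_def)

lemma fid_sel [simp]:
  "Src (fid C) = C" "Tgt (fid C) = C" "x \<in> Obj C \<Longrightarrow> FO (fid C) x = x"
  "f \<in> Arr C \<Longrightarrow> FA (fid C) f = f"
  by (simp_all add: fid_def)

lemma fcomp_fid:
  assumes F: "functor_between F C D"
  shows "F \<odot> fid C = F" "fid D \<odot> F = F"
proof -
  note C = functor_fid[OF functor_betweenD(1)[OF F]] and D = functor_fid[OF functor_betweenD(2)[OF F]]
  show "F \<odot> fid C = F" by (rule functor_eqI[OF functor_fcomp[OF C F] F]) simp_all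
  show "fid D \<odot> F = F"
    by (rule functor_eqI[OF functor_fcomp[OF F D] F]) (simp_all add: functor_simps[OF F])
qed

lemma fcomp_assoc:
  assumes "functor_between F B C"
    and "functor_between G C D"
  shows "(H \<odot> G) \<odot> F = H \<odot> (G \<odot> F)"
  using functor_simps[OF assms(1)] functor_simps[OF assms(2)]
  by (auto simp: fcomp_def restrict_def fun_eq_iff)

lemma nt_between_simps:
  assumes "nt_between t F G" "functor_between F C D"
  shows "NSrc t = F" "NTgt t = G"
    and "functor_between G C D"
    and "x \<in> Obj C \<Longrightarrow> At t x \<in> Arr D"
    and "x \<in> Obj C \<Longrightarrow> Dom D (At t x) = FO F x"
    and "x \<in> Obj C \<Longrightarrow> Cod D (At t x) = FO G x"
proof -
  interpret is_nt t using assms by (simp add: nt_between_def)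
  have [simp]: "NSrc t = F" "NTgt t = G" using assms by (auto simp: nt_between_def)
  have [simp]: "Src F = C" "Tgt F = D" using functor_betweenD[OF assms(2)] by auto
  show "NSrc t = F" "NTgt t = G" by simp_all
  show "functor_between G C D"
    using NTgt_functor Src_eq Tgt_eq by (simp add: functor_between_def)
  show "x \<in> Obj C \<Longrightarrow> At t x \<in> Arr D" "x \<in> Obj C \<Longrightarrow> Dom D (At t x) = FO F x"
    "x \<in> Obj C \<Longrightarrow> Cod D (At t x) = FO G x"
    using At_Hom[of x] by (auto simp: Hom_def)
qed

lemma nt_naturality:
  assumes "nt_between t F G" "functor_between F C D" "f \<in> Hom C x y"
  shows "Cmp D (At t y) (FA F f) = Cmp D (FA G f) (At t x)"
  using assms is_nt.naturality[of t f x y] by (auto simp: nt_between_def functor_between_def)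

lemma nt_ext:
  fixes s t :: "('o, 'm, 'p, 'q) nt"
  assumes "NSrc s = NSrc t" "NTgt s = NTgt t"
    and "At s \<in> extensional (Obj (Src (NSrc t)))" "At t \<in> extensional (Obj (Src (NSrc t)))"
    and "\<And>x. x \<in> Obj (Src (NSrc t)) \<Longrightarrow> At s x = At t x"
  shows "s = t"
proof (rule nt.equality)
  show "At s = At t" using assms(3-5) by (rule extensionalityI)
qed (use assms in simp_all)

lemma nt_sel [simp]:
  "NSrc (t \<cdot> s) = NSrc s" "NTgt (t \<cdot> s) = NTgt t"
  "x \<in> Obj (Src (NSrc s)) \<Longrightarrow> At (t \<cdot> s) x = Cmp (Tgt (NSrc s)) (At t x) (At s x)"
  "NSrc (G \<triangleright> s) = G \<odot> NSrc s" "NTgt (G \<triangleright> s) = G \<odot> NTgt s"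
  "x \<in> Obj (Src (NSrc s)) \<Longrightarrow> At (G \<triangleright> s) x = FA G (At s x)"
  "NSrc (s \<triangleleft> F) = NSrc s \<odot> F" "NTgt (s \<triangleleft> F) = NTgt s \<odot> F"
  "y \<in> Obj (Src F) \<Longrightarrow> At (s \<triangleleft> F) y = At s (FO F y)"
  "NSrc (nid F) = F" "NTgt (nid F) = F"
  "y \<in> Obj (Src F) \<Longrightarrow> At (nid F) y = Idn (Tgt F) (FO F y)"
  "NSrc (nt_inv s) = NTgt s" "NTgt (nt_inv s) = NSrc s"
  "x \<in> Obj (Src (NSrc s)) \<Longrightarrow> At (nt_inv s) x = inv_arr (Tgt (NSrc s)) (At s x)"
  by (simp_all add: vcomp_def whisk_l_def whisk_r_def nid_def nt_inv_def inv_arr_def)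

section \<open>Universal arrows and adjunctions\<close>

text \<open>The arrows that could serve as the unit at \<open>x\<close> of some left adjoint of \<open>R\<close>.\<close>

definition univ_arr :: "('p, 'q, 'o, 'm) ftr \<Rightarrow> 'o \<Rightarrow> 'p \<Rightarrow> 'm \<Rightarrow> bool" where
  "univ_arr R x w e \<longleftrightarrow> w \<in> Obj (Src R) \<and> e \<in> Hom (Tgt R) x (FO R w) \<and>
    (\<forall>z \<in> Obj (Src R). \<forall>f \<in> Hom (Tgt R) x (FO R z).
      \<exists>!g. g \<in> Hom (Src R) w z \<and> Cmp (Tgt R) (FA R g) e = f)"

lemma univ_arrI:
  assumes "functor_between R D C" "w \<in> Obj D" "e \<in> Hom C x (FO R w)"
    and "\<And>z f. z \<in> Obj D \<Longrightarrow> f \<in> Hom C x (FO R z) \<Longrightarrow>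
      \<exists>g \<in> Hom D w z. Cmp C (FA R g) e = f"
    and "\<And>z g h. g \<in> Hom D w z \<Longrightarrow> h \<in> Hom D w z \<Longrightarrow>
      Cmp C (FA R g) e = Cmp C (FA R h) e \<Longrightarrow> g = h"
  shows "univ_arr R x w e"
proof -
  have "\<exists>!g. g \<in> Hom D w z \<and> Cmp C (FA R g) e = f"
    if z: "z \<in> Obj D" and f: "f \<in> Hom C x (FO R z)" for z f
  proof -
    obtain g where g: "g \<in> Hom D w z" "Cmp C (FA R g) e = f"
      using assms(4)[OF z f] by blast
    show ?thesis
    proof (rule ex1I[of _ g])
      show "h = g" if "h \<in> Hom D w z \<and> Cmp C (FA R h) e = f" for h
        by (rule assms(5)[of _ z]) (use that g in simp_all)
    qed (use g in simp)
  qed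
  then show ?thesis
    using assms(2,3) functor_betweenD(3,4)[OF assms(1)] unfolding univ_arr_def by simp
qed

lemma univ_arrD:
  assumes "functor_between R D C" "univ_arr R x w e"
  shows "w \<in> Obj D" "e \<in> Hom C x (FO R w)" "e \<in> Arr C" "Dom C e = x" "Cod C e = FO R w"
  using assms functor_betweenD(3,4)[OF assms(1)] by (auto simp: univ_arr_def Hom_def)

lemma univ_arr_ex:
  assumes "functor_between R D C" "univ_arr R x w e" "f \<in> Hom C x (FO R z)" "z \<in> Obj D"
  obtains g where "g \<in> Hom D w z" "Cmp C (FA R g) e = f"
  using assms functor_betweenD(3,4)[OF assms(1)] unfolding univ_arr_def by metis

lemma univ_arr_eq:
  assumes "functor_between R D C" "univ_arr R x w e" "g \<in> Hom D w z" "h \<in> Hom D w z"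
    "Cmp C (FA R g) e = Cmp C (FA R h) e"
  shows "g = h"
proof -
  have "z \<in> Obj D"
    using assms(3) category.hom_obj[OF functor_betweenD(1)[OF assms(1)]] by blast
  moreover have "Cmp C (FA R g) e \<in> Hom C x (FO R z)"
    using functor_hom[OF assms(1,3)] univ_arrD(2)[OF assms(1,2)]
      category.Cmp_Hom[OF functor_betweenD(2)[OF assms(1)]] by blast
  ultimately have "\<exists>!k. k \<in> Hom D w z \<and> Cmp C (FA R k) e = Cmp C (FA R g) e"
    using assms(2) functor_betweenD(3,4)[OF assms(1)] unfolding univ_arr_def by simp
  then show ?thesis
    using assms(3,4,5) by (auto dest: ex1_implies_ex elim: ex1E)
qed

text \<open>Two universal arrows out of the same object factor through each other, which makes the
  comparison \<open>t\<close> between their targets invertible.\<close>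

lemma univ_arr_post_iff:
  assumes R: "functor_between R D C" and u: "univ_arr R x w e" and t: "t \<in> Hom D w w'"
  shows "univ_arr R x w' (Cmp C (FA R t) e) \<longleftrightarrow> iso_arr D t"
proof -
  interpret C: category C by (rule functor_betweenD[OF R])
  interpret D: category D by (rule functor_betweenD[OF R])
  note [simp] = functor_simps[OF R] univ_arrD[OF R u]
  have t' [simp]: "t \<in> Arr D" "Dom D t = w" "Cod D t = w'" and w' [simp]: "w' \<in> Obj D"
    using t D.hom_obj[OF t] by (auto simp: Hom_def)
  let ?e = "Cmp C (FA R t) e"
  show ?thesis
  proof
    assume u': "univ_arr R x w' ?e"
    obtain s where s: "s \<in> Hom D w' w" "Cmp C (FA R s) ?e = e"
      using univ_arr_ex[OF R u' _ univ_arrD(1)[OF R u]] univ_arrD(2)[OF R u] by blast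
    have s' [simp]: "s \<in> Arr D" "Dom D s = w'" "Cod D s = w" using s by (auto simp: Hom_def)
    have "Cmp D s t = Idn D w"
      by (rule univ_arr_eq[OF R u, of _ w]) (use s(2) in \<open>simp_all add: Hom_def C.cmp_assoc\<close>)
    moreover have "Cmp D t s = Idn D w'"
      by (rule univ_arr_eq[OF R u', of _ w'])
        (use s(2) in \<open>simp_all add: Hom_def C.cmp_assoc\<close>)
    ultimately show "iso_arr D t" using D.isoI t s(1) by blast
  next
    assume i: "iso_arr D t"
    show "univ_arr R x w' ?e"
    proof (rule univ_arrI[OF R])
      fix z f assume z: "z \<in> Obj D" and f: "f \<in> Hom C x (FO R z)"
      obtain g where g: "g \<in> Hom D w z" "Cmp C (FA R g) e = f"
        using univ_arr_ex[OF R u f z] by blast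
      have gt: "Cmp D g (inv_arr D t) \<in> Hom D w' z" using g i by (auto simp: Hom_def)
      moreover have "Cmp C (FA R (Cmp D g (inv_arr D t))) ?e = Cmp C (FA R (Cmp D (Cmp D g (inv_arr D t)) t)) e"
        using gt by (simp add: Hom_def C.cmp_assoc)
      moreover have "Cmp D (Cmp D g (inv_arr D t)) t = g"
        using g i by (simp add: D.cmp_assoc Hom_def)
      ultimately show "\<exists>g \<in> Hom D w' z. Cmp C (FA R g) ?e = f" using g by auto
    next
      fix z g h assume gh: "g \<in> Hom D w' z" "h \<in> Hom D w' z"
        and eq: "Cmp C (FA R g) ?e = Cmp C (FA R h) ?e"
      have "Cmp D g t = Cmp D h t"
        by (rule univ_arr_eq[OF R u, of _ z]) (use gh eq in \<open>simp_all add: Hom_def C.cmp_assoc\<close>)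
      then have "Cmp D (Cmp D g t) (inv_arr D t) = Cmp D (Cmp D h t) (inv_arr D t)" by simp
      then show "g = h" using gh i by (simp add: Hom_def D.cmp_assoc)
    qed (simp_all add: Hom_def)
  qed
qed

lemma univ_arr_pre:
  assumes R: "functor_between R D C" and u: "univ_arr R x w e"
    and s: "iso_arr C s" "s \<in> Hom C y x"
  shows "univ_arr R y w (Cmp C e s)"
proof -
  interpret C: category C by (rule functor_betweenD[OF R])
  interpret D: category D by (rule functor_betweenD[OF R])
  note [simp] = functor_simps[OF R] univ_arrD[OF R u]
  have s' [simp]: "s \<in> Arr C" "Dom C s = y" "Cod C s = x"
    using s by (auto simp: Hom_def)
  show ?thesis
  proof (rule univ_arrI[OF R])
    fix z f assume z: "z \<in> Obj D" and f: "f \<in> Hom C y (FO R z)"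
    have "Cmp C f (inv_arr C s) \<in> Hom C x (FO R z)" using f s by (auto simp: Hom_def)
    then obtain g where g: "g \<in> Hom D w z" "Cmp C (FA R g) e = Cmp C f (inv_arr C s)"
      using univ_arr_ex[OF R u _ z] by blast
    have "Cmp C (FA R g) (Cmp C e s) = Cmp C (Cmp C (FA R g) e) s"
      using g(1) by (simp add: Hom_def C.cmp_assoc)
    also have "\<dots> = f" using f s unfolding g(2) by (simp add: Hom_def C.cmp_assoc)
    finally show "\<exists>g \<in> Hom D w z. Cmp C (FA R g) (Cmp C e s) = f" using g by blast
  next
    fix z g h assume gh: "g \<in> Hom D w z" "h \<in> Hom D w z"
      and eq: "Cmp C (FA R g) (Cmp C e s) = Cmp C (FA R h) (Cmp C e s)"
    have "Cmp C (Cmp C (Cmp C (FA R g) e) s) (inv_arr C s) =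
        Cmp C (Cmp C (Cmp C (FA R h) e) s) (inv_arr C s)"
      using gh eq by (simp add: Hom_def C.cmp_assoc)
    then have "Cmp C (FA R g) e = Cmp C (FA R h) e"
      using gh s by (simp add: Hom_def C.cmp_assoc)
    then show "g = h" using univ_arr_eq[OF R u gh] by blast
  qed (simp_all add: Hom_def)
qed

locale adjoint_pair =
  fixes C :: "('o, 'm) cat" and D :: "('p, 'q) cat" and L R \<eta> \<epsilon>
  assumes adj: "adjunction L R \<eta> \<epsilon>" and R: "functor_between R D C"
begin

sublocale C: category C by (rule functor_betweenD[OF R])
sublocale D: category D by (rule functor_betweenD[OF R])

lemma L: "functor_between L C D"
  using adj functor_betweenD[OF R] by (auto simp: adjunction_def functor_between_def)

lemmas [simp] = functor_simps[OF R] functor_simps[OF L]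

lemma unit: "nt_between \<eta> (fid C) (R \<odot> L)" and counit: "nt_between \<epsilon> (L \<odot> R) (fid D)"
  using adj by (auto simp: adjunction_def)

lemma fid_C: "functor_between (fid C) C C" and LR: "functor_between (L \<odot> R) D D"
  by (rule functor_fid[OF C.category_axioms] functor_fcomp[OF R L])+

lemma unit_simps [simp]:
  assumes "x \<in> Obj C"
  shows "At \<eta> x \<in> Arr C" "Dom C (At \<eta> x) = x" "Cod C (At \<eta> x) = FO R (FO L x)"
  using nt_between_simps[OF unit fid_C] assms by simp_all

lemma counit_simps [simp]:
  assumes "y \<in> Obj D"
  shows "At \<epsilon> y \<in> Arr D" "Dom D (At \<epsilon> y) = FO L (FO R y)" "Cod D (At \<epsilon> y) = y"
  using nt_between_simps[OF counit LR] assms by simp_all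

lemma unit_natural:
  "f \<in> Arr C \<Longrightarrow> Cmp C (At \<eta> (Cod C f)) f = Cmp C (FA R (FA L f)) (At \<eta> (Dom C f))"
  using nt_naturality[OF unit fid_C, of f "Dom C f" "Cod C f"] by (simp add: Hom_def)

lemma counit_natural:
  "f \<in> Arr D \<Longrightarrow> Cmp D (At \<epsilon> (Cod D f)) (FA L (FA R f)) = Cmp D f (At \<epsilon> (Dom D f))"
  using nt_naturality[OF counit LR, of f "Dom D f" "Cod D f"] by (simp add: Hom_def)

lemma triangle_left:
  assumes x: "x \<in> Obj C"
  shows "Cmp D (At \<epsilon> (FO L x)) (FA L (At \<eta> x)) = Idn D (FO L x)"
proof -
  have "At ((\<epsilon> \<triangleleft> L) \<cdot> (L \<triangleright> \<eta>)) x = At (nid L) x"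
    using adj by (simp add: adjunction_def)
  then show ?thesis
    using x nt_between_simps[OF unit fid_C] by simp
qed

lemma triangle_right:
  assumes y: "y \<in> Obj D"
  shows "Cmp C (FA R (At \<epsilon> y)) (At \<eta> (FO R y)) = Idn C (FO R y)"
proof -
  have "At ((R \<triangleright> \<epsilon>) \<cdot> (\<eta> \<triangleleft> R)) y = At (nid R) y"
    using adj by (simp add: adjunction_def)
  then show ?thesis
    using y nt_between_simps[OF unit fid_C] nt_between_simps[OF counit LR] by simp
qed

lemma transpose_unit:
  assumes "e \<in> Hom C x (FO R w)" "w \<in> Obj D"
  shows "Cmp C (FA R (Cmp D (At \<epsilon> w) (FA L e))) (At \<eta> x) = e"
proof -
  have [simp]: "e \<in> Arr C" "Dom C e = x" "Cod C e = FO R w" "x \<in> Obj C"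
    using assms C.hom_obj by (auto simp: Hom_def)
  have "Cmp C (FA R (Cmp D (At \<epsilon> w) (FA L e))) (At \<eta> x)
      = Cmp C (FA R (At \<epsilon> w)) (Cmp C (At \<eta> (FO R w)) e)"
    using assms(2) unit_natural[of e] by (simp add: C.cmp_assoc)
  also have "\<dots> = e"
    using assms(2) triangle_right[of w] by (simp add: C.cmp_assoc[symmetric])
  finally show ?thesis .
qed

lemma transpose_counit:
  assumes "e \<in> Hom D (FO L x) w" "x \<in> Obj C"
  shows "Cmp D (At \<epsilon> w) (FA L (Cmp C (FA R e) (At \<eta> x))) = e"
proof -
  have [simp]: "e \<in> Arr D" "Dom D e = FO L x" "Cod D e = w" "w \<in> Obj D"
    using assms D.hom_obj by (auto simp: Hom_def)
  have "Cmp D (At \<epsilon> w) (FA L (Cmp C (FA R e) (At \<eta> x)))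
      = Cmp D (Cmp D (At \<epsilon> w) (FA L (FA R e))) (FA L (At \<eta> x))"
    using assms(2) by (simp add: D.cmp_assoc)
  also have "\<dots> = e"
    using assms(2) triangle_left[of x] counit_natural[of e] by (simp add: D.cmp_assoc)
  finally show ?thesis .
qed

lemma left_eqI:
  assumes "g \<in> Hom D (FO L x) w" "h \<in> Hom D (FO L x) w" "x \<in> Obj C"
    "Cmp C (FA R g) (At \<eta> x) = Cmp C (FA R h) (At \<eta> x)"
  shows "g = h"
  by (rule trans[OF transpose_counit[OF assms(1,3), symmetric]], subst assms(4))
    (rule transpose_counit[OF assms(2,3)])

lemma right_eqI:
  assumes "g \<in> Hom C x (FO R w)" "h \<in> Hom C x (FO R w)" "w \<in> Obj D"
    "Cmp D (At \<epsilon> w) (FA L g) = Cmp D (At \<epsilon> w) (FA L h)"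
  shows "g = h"
  by (rule trans[OF transpose_unit[OF assms(1,3), symmetric]], subst assms(4))
    (rule transpose_unit[OF assms(2,3)])

lemma univ_unit:
  assumes x: "x \<in> Obj C"
  shows "univ_arr R x (FO L x) (At \<eta> x)"
proof (rule univ_arrI[OF R])
  fix z f assume "z \<in> Obj D" "f \<in> Hom C x (FO R z)"
  then show "\<exists>g \<in> Hom D (FO L x) z. Cmp C (FA R g) (At \<eta> x) = f"
    using transpose_unit[of f x z] by (intro bexI[of _ "Cmp D (At \<epsilon> z) (FA L f)"]) (auto simp: Hom_def)
qed (use x left_eqI in \<open>auto simp: Hom_def\<close>)

text \<open>The transpose of \<open>e\<close> is the comparison from the universal arrow \<open>\<eta> x\<close> to \<open>e\<close>.  This is how
  invertibility of a mate becomes a statement without \<open>L\<close>, \<open>\<eta>\<close> and \<open>\<epsilon>\<close>.\<close>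

lemma transpose_iso_iff:
  assumes e: "e \<in> Hom C x (FO R w)" and w: "w \<in> Obj D"
  shows "iso_arr D (Cmp D (At \<epsilon> w) (FA L e)) \<longleftrightarrow> univ_arr R x w e"
proof -
  have x: "x \<in> Obj C" using e C.hom_obj by blast
  have "Cmp D (At \<epsilon> w) (FA L e) \<in> Hom D (FO L x) w"
    using e w by (auto simp: Hom_def)
  from univ_arr_post_iff[OF R univ_unit[OF x] this] transpose_unit[OF e w] show ?thesis
    by simp
qed

end

section \<open>Restriction functors, Kan extensions and mates on objects\<close>

definition small_ftr :: "'u sftr \<Rightarrow> 'u scat \<Rightarrow> 'u scat \<Rightarrow> bool" where
  "small_ftr u A B \<longleftrightarrow> functor_between u A B \<and> small_cat A \<and> small_cat B"

lemma small_ftrD: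
  assumes "small_ftr u A B"
  shows "small_functor u" "Src u = A" "Tgt u = B" "functor_between u A B" "small_cat A" "small_cat B"
  using assms by (auto simp: small_ftr_def small_functor_def functor_between_def)

lemmas small_ftr_simps = functor_simps[OF small_ftrD(4)]

lemma small_ftrI:
  assumes A: "small_cat A" and B: "small_cat B" and sel: "Src F = A" "Tgt F = B"
    and ext: "FO F \<in> extensional (Obj A)" "FA F \<in> extensional (Arr A)"
    and obj: "\<And>x. x \<in> Obj A \<Longrightarrow> FO F x \<in> Obj B"
    and idn: "\<And>x. x \<in> Obj A \<Longrightarrow> FA F (Idn A x) = Idn B (FO F x)"
    and hom: "\<And>f x y. f \<in> Hom A x y \<Longrightarrow> FA F f \<in> Hom B (FO F x) (FO F y)"
    and cmp: "\<And>f g x y z. f \<in> Hom A x y \<Longrightarrow> g \<in> Hom A y z \<Longrightarrow>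
      FA F (Cmp A g f) = Cmp B (FA F g) (FA F f)"
  shows "small_ftr F A B"
proof -
  have "is_functor F"
    by (rule is_functor.intro; unfold sel)
      (use A B in \<open>simp_all add: small_cat_def ext obj idn hom cmp\<close>)
  then show ?thesis using A B sel by (simp add: small_ftr_def functor_between_def)
qed

lemma small_ftr_fcomp: "small_ftr u A B \<Longrightarrow> small_ftr v B C \<Longrightarrow> small_ftr (v \<odot> u) A C"
  by (auto simp: small_ftr_def intro: functor_fcomp)

lemma small_ftr_fid: "small_cat A \<Longrightarrow> small_ftr (fid A) A A"
  by (auto simp: small_ftr_def small_cat_def intro: functor_fid)

definition small_nt_between :: "'u snt \<Rightarrow> 'u sftr \<Rightarrow> 'u sftr \<Rightarrow> 'u scat \<Rightarrow> 'u scat \<Rightarrow> bool" where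
  "small_nt_between t u v A B \<longleftrightarrow> nt_between t u v \<and> small_ftr u A B"

lemma small_nt_betweenD:
  assumes "small_nt_between t u v A B"
  shows "nt_between t u v" "small_nt t" "NSrc t = u" "NTgt t = v" "small_ftr u A B" "small_ftr v A B"
proof -
  show t: "nt_between t u v" and u: "small_ftr u A B"
    using assms by (auto simp: small_nt_between_def)
  note n = nt_between_simps[OF t small_ftrD(4)[OF u]]
  show "NSrc t = u" "NTgt t = v" using n by auto
  show v: "small_ftr v A B" using n(3) u by (simp add: small_ftr_def)
  show "small_nt t"
    using small_ftrD(1)[OF u] small_ftrD(1)[OF v] t by (simp add: small_nt_def nt_between_def)
qed

lemma small_nt_simps:
  assumes "small_nt_between t u v A B"
  shows "x \<in> Obj A \<Longrightarrow> At t x \<in> Arr B"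
    and "x \<in> Obj A \<Longrightarrow> Dom B (At t x) = FO u x"
    and "x \<in> Obj A \<Longrightarrow> Cod B (At t x) = FO v x"
    and "f \<in> Arr A \<Longrightarrow> Cmp B (At t (Cod A f)) (FA u f) = Cmp B (FA v f) (At t (Dom A f))"
  using nt_between_simps[OF small_nt_betweenD(1)[OF assms] small_ftrD(4)[OF small_nt_betweenD(5)[OF assms]]]
    nt_naturality[OF small_nt_betweenD(1)[OF assms] small_ftrD(4)[OF small_nt_betweenD(5)[OF assms]],
      of f "Dom A f" "Cod A f"]
  by (simp_all add: Hom_def)

lemma small_nt_betweenI:
  assumes u: "small_ftr u A B" and v: "small_ftr v A B" and sel: "NSrc t = u" "NTgt t = v"
    and ext: "At t \<in> extensional (Obj A)"
    and hom: "\<And>x. x \<in> Obj A \<Longrightarrow> At t x \<in> Hom B (FO u x) (FO v x)"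
    and nat: "\<And>f x y. f \<in> Hom A x y \<Longrightarrow> Cmp B (At t y) (FA u f) = Cmp B (FA v f) (At t x)"
  shows "small_nt_between t u v A B"
proof -
  have "is_nt t"
    by (rule is_nt.intro)
      (use small_ftrD(2,3)[OF u] small_ftrD(2,3)[OF v] functor_betweenD(5)[OF small_ftrD(4)[OF u]]
        functor_betweenD(5)[OF small_ftrD(4)[OF v]] sel ext hom nat in simp_all)
  then show ?thesis using u sel by (simp add: small_nt_between_def nt_between_def)
qed

lemma small_nt_between_nid: "small_ftr u A B \<Longrightarrow> small_nt_between (nid u) u u A B"
proof -
  assume u: "small_ftr u A B"
  interpret A: category A using u functor_betweenD(1) by (auto simp: small_ftr_def)
  interpret B: category B using u functor_betweenD(2) by (auto simp: small_ftr_def)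
  note [simp] = small_ftr_simps[OF u]
  show ?thesis
    using u functor_betweenD(5)[OF small_ftrD(4)[OF u]]
    by (auto simp: small_nt_between_def nt_between_def is_nt_def nid_def Hom_def)
qed

text \<open>\<open>P\<close> is left adjoint to \<open>s\<close> with unit \<open>\<sigma>\<close> and identical counit; the last two conditions are the
  triangle identities.\<close>

definition reflection :: "'u sftr \<Rightarrow> 'u sftr \<Rightarrow> 'u snt \<Rightarrow> 'u scat \<Rightarrow> 'u scat \<Rightarrow> bool" where
  "reflection s P \<sigma> J K \<longleftrightarrow> small_ftr s J K \<and> small_ftr P K J \<and> P \<odot> s = fid J \<and>
    small_nt_between \<sigma> (fid K) (s \<odot> P) K K \<and> (\<forall>j \<in> Obj J. At \<sigma> (FO s j) = Idn K (FO s j)) \<and>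
    (\<forall>k \<in> Obj K. FA P (At \<sigma> k) = Idn J (FO P k))"

text \<open>\<open>P\<close> is right adjoint to \<open>s\<close> with counit \<open>\<sigma>\<close> and identical unit.\<close>

definition coreflection :: "'u sftr \<Rightarrow> 'u sftr \<Rightarrow> 'u snt \<Rightarrow> 'u scat \<Rightarrow> 'u scat \<Rightarrow> bool" where
  "coreflection s P \<sigma> J K \<longleftrightarrow> small_ftr s J K \<and> small_ftr P K J \<and> P \<odot> s = fid J \<and>
    small_nt_between \<sigma> (s \<odot> P) (fid K) K K \<and> (\<forall>j \<in> Obj J. At \<sigma> (FO s j) = Idn K (FO s j)) \<and>
    (\<forall>k \<in> Obj K. FA P (At \<sigma> k) = Idn J (FO P k))"

lemma whisk_r_nid:
  assumes s: "small_ftr s J K" and t: "NSrc t \<odot> s = s" "NTgt t \<odot> s = s"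
    and At: "\<forall>j \<in> Obj J. At t (FO s j) = Idn K (FO s j)"
  shows "t \<triangleleft> s = nid s"
  using t At small_ftrD(2,3)[OF s] by (intro nt_ext) (auto simp: whisk_r_def nid_def)

lemma section_fcomp:
  assumes s: "small_ftr s J K" and P: "small_ftr P K J" and Ps: "P \<odot> s = fid J"
  shows "(s \<odot> P) \<odot> s = s" "P \<odot> (s \<odot> P) = P" "fid K \<odot> s = s" "P \<odot> fid K = P"
proof -
  note s' = small_ftrD(4)[OF s] and P' = small_ftrD(4)[OF P]
  show "(s \<odot> P) \<odot> s = s" "P \<odot> (s \<odot> P) = P"
    using fcomp_assoc[OF s' P', of s] fcomp_assoc[OF P' s', of P] fcomp_fid[OF s'] fcomp_fid[OF P']
    by (simp_all add: Ps)
  show "fid K \<odot> s = s" "P \<odot> fid K = P" using fcomp_fid[OF s'] fcomp_fid[OF P'] by simp_all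
qed

lemma reflectionD:
  assumes "reflection s P \<sigma> J K"
  shows "small_ftr s J K" "small_ftr P K J" "P \<odot> s = fid J"
    and "small_nt_between \<sigma> (fid K) (s \<odot> P) K K" and "\<sigma> \<triangleleft> s = nid s" and "P \<triangleright> \<sigma> = nid P"
proof -
  show s: "small_ftr s J K" and P: "small_ftr P K J" and Ps: "P \<odot> s = fid J"
    and \<sigma>: "small_nt_between \<sigma> (fid K) (s \<odot> P) K K"
    using assms by (simp_all add: reflection_def)
  note sel = small_nt_betweenD(3,4)[OF \<sigma>] section_fcomp[OF s P Ps] small_ftrD(2,3)[OF P]
  show "\<sigma> \<triangleleft> s = nid s"
    using assms sel by (intro whisk_r_nid[OF s]) (simp_all add: reflection_def)
  show "P \<triangleright> \<sigma> = nid P"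
    using assms sel by (intro nt_ext) (auto simp: reflection_def whisk_l_def nid_def)
qed

lemma coreflectionD:
  assumes "coreflection s P \<sigma> J K"
  shows "small_ftr s J K" "small_ftr P K J" "P \<odot> s = fid J"
    and "small_nt_between \<sigma> (s \<odot> P) (fid K) K K" and "\<sigma> \<triangleleft> s = nid s"
proof -
  show s: "small_ftr s J K" and P: "small_ftr P K J" and Ps: "P \<odot> s = fid J"
    and \<sigma>: "small_nt_between \<sigma> (s \<odot> P) (fid K) K K"
    using assms by (simp_all add: coreflection_def)
  show "\<sigma> \<triangleleft> s = nid s"
    using assms small_nt_betweenD(3,4)[OF \<sigma>] section_fcomp[OF s P Ps]
    by (intro whisk_r_nid[OF s]) (simp_all add: coreflection_def)
qed

context prederivator
begin

lemma DCat: "small_cat A \<Longrightarrow> category (DCat D A)"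
  by (rule DCat_category)

lemma DFun: "small_ftr u A B \<Longrightarrow> functor_between (DFun D u) (DCat D B) (DCat D A)"
  using DFun_functor[of u] small_ftrD(1-3)[of u A B] by simp

lemmas DFun_simps = functor_simps[OF DFun]

lemma DFun_comp:
  assumes "small_ftr u A B" "small_ftr v B C"
  shows "Z \<in> Obj (DCat D C) \<Longrightarrow> FO (DFun D (v \<odot> u)) Z = FO (DFun D u) (FO (DFun D v) Z)"
    and "f \<in> Arr (DCat D C) \<Longrightarrow> FA (DFun D (v \<odot> u)) f = FA (DFun D u) (FA (DFun D v) f)"
  using DFun_fcomp[of u v] small_ftrD[OF assms(1)] small_ftrD[OF assms(2)]
    DFun_simps(1)[OF assms(2)] by auto

lemma DNat:
  "small_nt_between t u v A B \<Longrightarrow> nt_between (DNat D t) (DFun D u) (DFun D v)"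
  using DNat_nt[of t] small_nt_betweenD(2-4)[of t u v A B] by simp

lemma DNat_simps:
  assumes "small_nt_between t u v A B" "Z \<in> Obj (DCat D B)"
  shows "At (DNat D t) Z \<in> Arr (DCat D A)"
    and "Dom (DCat D A) (At (DNat D t) Z) = FO (DFun D u) Z"
    and "Cod (DCat D A) (At (DNat D t) Z) = FO (DFun D v) Z"
  using nt_between_simps[OF DNat[OF assms(1)] DFun[OF small_nt_betweenD(5)[OF assms(1)]]] assms(2)
  by auto

lemma DNat_natural:
  assumes "small_nt_between t u v A B" "f \<in> Arr (DCat D B)"
  shows "Cmp (DCat D A) (At (DNat D t) (Cod (DCat D B) f)) (FA (DFun D u) f)
    = Cmp (DCat D A) (FA (DFun D v) f) (At (DNat D t) (Dom (DCat D B) f))"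
  using nt_naturality[OF DNat[OF assms(1)] DFun[OF small_nt_betweenD(5)[OF assms(1)]],
      of f "Dom (DCat D B) f" "Cod (DCat D B) f"] assms(2)
  by (simp add: Hom_def)

lemma DNat_nid_At:
  assumes "small_ftr u A B" "Z \<in> Obj (DCat D B)"
  shows "At (DNat D (nid u)) Z = Idn (DCat D A) (FO (DFun D u) Z)"
  using DNat_nid[of u] small_ftrD(1)[OF assms(1)] DFun_simps[OF assms(1)] assms(2) by simp

text \<open>Whiskering is the horizontal composite with an identity, so the 2-functor \<open>D\<close> turns it into
  whiskering on the opposite side.\<close>

lemma DNat_whisk_r:
  assumes t: "small_nt_between t u v A B" and s: "small_ftr s J A" and Z: "Z \<in> Obj (DCat D B)"
  shows "At (DNat D (t \<triangleleft> s)) Z = FA (DFun D s) (At (DNat D t) Z)"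
proof -
  have u: "small_ftr u A B" and v: "small_ftr v A B"
    using small_nt_betweenD[OF t] by auto
  interpret B: category B using u functor_betweenD(2) by (auto simp: small_ftr_def)
  interpret DJ: category "DCat D J" by (rule DCat[OF small_ftrD(5)[OF s]])
  note [simp] = small_ftr_simps[OF s] small_ftr_simps[OF u]
    small_ftr_simps[OF v] small_nt_simps[OF t] small_nt_betweenD(3,4)[OF t]
    DFun_simps[OF s] DFun_simps[OF u] DNat_simps[OF t]
  have n: "NSrc (DNat D t) = DFun D u" "NTgt (DNat D t) = DFun D v"
    using DNat[OF t] by (auto simp: nt_between_def)
  have "hcomp t (nid s) = t \<triangleleft> s"
    by (rule nt_ext)
      (simp_all add: hcomp_def vcomp_def whisk_l_def whisk_r_def nid_def fcomp_def)
  moreover have "DNat D (hcomp t (nid s)) = hcomp (nid (DFun D s)) (DNat D t)"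
    using DNat_hcomp[of "nid s" t] DNat_nid small_nt_betweenD(2)[OF t]
      small_nt_betweenD(2)[OF small_nt_between_nid[OF s]] small_ftrD[OF s] by simp
  moreover have "At (hcomp (nid (DFun D s)) (DNat D t)) Z = FA (DFun D s) (At (DNat D t) Z)"
    using Z DFun_simps[OF v] by (simp add: hcomp_def n)
  ultimately show ?thesis by simp
qed

lemma DNat_whisk_l:
  assumes t: "small_nt_between t u v A B" and w: "small_ftr w B C" and Z: "Z \<in> Obj (DCat D C)"
  shows "At (DNat D (w \<triangleright> t)) Z = At (DNat D t) (FO (DFun D w) Z)"
proof -
  have u: "small_ftr u A B" and v: "small_ftr v A B"
    using small_nt_betweenD[OF t] by auto
  interpret C: category C using w functor_betweenD(2) by (auto simp: small_ftr_def)
  interpret DA: category "DCat D A" by (rule DCat[OF small_ftrD(5)[OF u]])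
  interpret DB: category "DCat D B" by (rule DCat[OF small_ftrD(5)[OF w]])
  note [simp] = small_ftr_simps[OF w] small_ftr_simps[OF u]
    small_ftr_simps[OF v] small_nt_simps[OF t] small_nt_betweenD(3,4)[OF t]
    DFun_simps[OF w] DFun_simps[OF u] DNat_simps[OF t]
  have n: "NSrc (DNat D t) = DFun D u" "NTgt (DNat D t) = DFun D v"
    using DNat[OF t] by (auto simp: nt_between_def)
  have "hcomp (nid w) t = w \<triangleright> t"
    by (rule nt_ext)
      (simp_all add: hcomp_def vcomp_def whisk_l_def whisk_r_def nid_def fcomp_def)
  moreover have "DNat D (hcomp (nid w) t) = hcomp (DNat D t) (nid (DFun D w))"
    using DNat_hcomp[of t "nid w"] DNat_nid small_nt_betweenD(2)[OF t]
      small_nt_betweenD(2)[OF small_nt_between_nid[OF w]] small_ftrD[OF w] by simp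
  moreover have "At (hcomp (DNat D t) (nid (DFun D w))) Z = At (DNat D t) (FO (DFun D w) Z)"
    using Z by (simp add: hcomp_def n)
  ultimately show ?thesis by simp
qed

end

context derivator
begin

lemma lan_adjoint:
  assumes u: "small_ftr u A B"
  shows "adjoint_pair (DCat D A) (DCat D B) (lan D u) (DFun D u) (lan_unit D u) (lan_counit D u)"
proof
  obtain L \<eta> \<epsilon> where "adjunction L (DFun D u) \<eta> \<epsilon>"
    using der3_left[OF small_ftrD(1)[OF u]] by blast
  then have "\<exists>p. (\<lambda>(L, \<eta>, \<epsilon>). adjunction L (DFun D u) \<eta> \<epsilon>) p" by auto
  from someI_ex[OF this] show "adjunction (lan D u) (DFun D u) (lan_unit D u) (lan_counit D u)"
    unfolding lan_def lan_unit_def lan_counit_def chosen_left_adjoint_def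
    by (simp add: case_prod_unfold)
qed (rule DFun[OF u])

lemma ran_adjoint:
  assumes u: "small_ftr u A B"
  shows "adjoint_pair (DCat D B) (DCat D A) (DFun D u) (ran D u) (ran_unit D u) (ran_counit D u)"
proof
  obtain R \<eta> \<epsilon> where "adjunction (DFun D u) R \<eta> \<epsilon>"
    using der3_right[OF small_ftrD(1)[OF u]] by blast
  then have "\<exists>p. (\<lambda>(R, \<eta>, \<epsilon>). adjunction (DFun D u) R \<eta> \<epsilon>) p" by auto
  from someI_ex[OF this] show a: "adjunction (DFun D u) (ran D u) (ran_unit D u) (ran_counit D u)"
    unfolding ran_def ran_unit_def ran_counit_def chosen_right_adjoint_def
    by (simp add: case_prod_unfold)
  show "functor_between (ran D u) (DCat D A) (DCat D B)"
    using a functor_betweenD(3,4)[OF DFun[OF u]] by (auto simp: adjunction_def functor_between_def)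
qed

end

locale lan_pair = derivator D for D :: "('u::universe, 'o, 'm) pder" +
  fixes u :: "'u sftr" and A B :: "'u scat"
  assumes u: "small_ftr u A B"

sublocale lan_pair \<subseteq>
  adjoint_pair "DCat D A" "DCat D B" "lan D u" "DFun D u" "lan_unit D u" "lan_counit D u"
  by (rule lan_adjoint[OF u])

locale ran_pair = derivator D for D :: "('u::universe, 'o, 'm) pder" +
  fixes u :: "'u sftr" and A B :: "'u scat"
  assumes u: "small_ftr u A B"

sublocale ran_pair \<subseteq>
  adjoint_pair "DCat D B" "DCat D A" "DFun D u" "ran D u" "ran_unit D u" "ran_counit D u"
  by (rule ran_adjoint[OF u])

lemma (in derivator) lan_pair: "small_ftr u A B \<Longrightarrow> lan_pair D u A B"
  and ran_pair: "small_ftr u A B \<Longrightarrow> ran_pair D u A B"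
  by (simp_all add: lan_pair_def ran_pair_def lan_pair_axioms_def ran_pair_axioms_def derivator_axioms)

locale derivator_morphism = D: derivator D + E: derivator E + morphism D E F
  for D :: "('u::universe, 'o, 'm) pder" and E :: "('u, 'p, 'q) pder"
    and F :: "('u, 'o, 'm, 'p, 'q) pmor"
begin

lemma MFun: "small_cat A \<Longrightarrow> functor_between (MFun F A) (DCat D A) (DCat E A)"
  by (rule MFun_functor)

lemmas MFun_simps = functor_simps[OF MFun]

lemma MIso:
  assumes u: "small_ftr u A B" and Y: "Y \<in> Obj (DCat D B)"
  shows "iso_arr (DCat E A) (At (MIso F u) Y)"
    and "At (MIso F u) Y \<in> Arr (DCat E A)"
    and "Dom (DCat E A) (At (MIso F u) Y) = FO (DFun E u) (FO (MFun F B) Y)"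
    and "Cod (DCat E A) (At (MIso F u) Y) = FO (MFun F A) (FO (DFun D u) Y)"
proof -
  note fu = functor_fcomp[OF MFun[OF small_ftrD(6)[OF u]] E.DFun[OF u]]
  have b: "nt_between (MIso F u) (DFun E u \<odot> MFun F B) (MFun F A \<odot> DFun D u)"
    using MIso_between[OF small_ftrD(1)[OF u]] small_ftrD[OF u] by simp
  note [simp] = MFun_simps[OF small_ftrD(6)[OF u]] E.DFun_simps[OF u]
    D.DFun_simps[OF u]
  show "At (MIso F u) Y \<in> Arr (DCat E A)"
    "Dom (DCat E A) (At (MIso F u) Y) = FO (DFun E u) (FO (MFun F B) Y)"
    "Cod (DCat E A) (At (MIso F u) Y) = FO (MFun F A) (FO (DFun D u) Y)"
    using nt_between_simps[OF b fu] Y by auto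
  show "iso_arr (DCat E A) (At (MIso F u) Y)"
    using MIso_iso[OF small_ftrD(1)[OF u]] nt_between_simps(1)[OF b fu] Y by (simp add: nat_iso_def)
qed

lemma MIso_sel:
  assumes u: "small_ftr u A B"
  shows "NSrc (MIso F u) = DFun E u \<odot> MFun F B" "NTgt (MIso F u) = MFun F A \<odot> DFun D u"
  using MIso_between[OF small_ftrD(1)[OF u]] small_ftrD[OF u] by (auto simp: nt_between_def)

lemma MIso_naturality:
  assumes u: "small_ftr u A B" and f: "f \<in> Arr (DCat D B)"
  shows "Cmp (DCat E A) (At (MIso F u) (Cod (DCat D B) f)) (FA (DFun E u) (FA (MFun F B) f))
    = Cmp (DCat E A) (FA (MFun F A) (FA (DFun D u) f)) (At (MIso F u) (Dom (DCat D B) f))"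
proof -
  note fu = functor_fcomp[OF MFun[OF small_ftrD(6)[OF u]] E.DFun[OF u]]
  have b: "nt_between (MIso F u) (DFun E u \<odot> MFun F B) (MFun F A \<odot> DFun D u)"
    using MIso_sel[OF u] MIso_between[OF small_ftrD(1)[OF u]] by (simp add: nt_between_def)
  note [simp] = MFun_simps[OF small_ftrD(6)[OF u]] E.DFun_simps[OF u]
    D.DFun_simps[OF u]
  show ?thesis
    using nt_naturality[OF b fu, of f "Dom (DCat D B) f" "Cod (DCat D B) f"] f
    by (simp add: Hom_def)
qed

lemma MIso_comp:
  assumes u: "small_ftr u A B" and v: "small_ftr v B C" and Z: "Z \<in> Obj (DCat D C)"
  shows "At (MIso F (v \<odot> u)) Z
    = Cmp (DCat E A) (At (MIso F u) (FO (DFun D v) Z)) (FA (DFun E u) (At (MIso F v) Z))"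
  using MIso_fcomp[of u v] small_ftrD[OF u] small_ftrD[OF v] Z MIso_sel[OF v]
    MFun_simps[OF small_ftrD(6)[OF v]] E.DFun_simps[OF v]
    D.DFun_simps[OF v] E.DFun_simps[OF u]
  by simp

lemma MIso_nt:
  assumes t: "small_nt_between t u v A B" and Z: "Z \<in> Obj (DCat D B)"
  shows "Cmp (DCat E A) (FA (MFun F A) (At (DNat D t) Z)) (At (MIso F u) Z)
    = Cmp (DCat E A) (At (MIso F v) Z) (At (DNat E t) (FO (MFun F B) Z))"
proof -
  have u: "small_ftr u A B" using small_nt_betweenD[OF t] by auto
  have n: "NSrc (DNat D t) = DFun D u" "NSrc (DNat E t) = DFun E u"
    using D.DNat[OF t] E.DNat[OF t] by (auto simp: nt_between_def)
  have "At ((MFun F A \<triangleright> DNat D t) \<cdot> MIso F u) Z = At (MIso F v \<cdot> (DNat E t \<triangleleft> MFun F B)) Z"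
    using MIso_natural[OF small_nt_betweenD(2)[OF t]] small_nt_betweenD(3,4)[OF t] small_ftrD[OF u]
    by simp
  then show ?thesis
    using Z n MIso_sel[OF u] MFun_simps[OF small_ftrD(6)[OF u]]
      E.DFun_simps[OF u] D.DFun_simps[OF u] by simp
qed

lemma left_mate_sel:
  assumes u: "small_ftr u A B"
  shows "Src (NSrc (left_mate D E F u)) = DCat D A" "Tgt (NSrc (left_mate D E F u)) = DCat E B"
proof -
  interpret l: lan_pair D u A B by (rule D.lan_pair[OF u])
  interpret l': lan_pair E u A B by (rule E.lan_pair[OF u])
  show "Src (NSrc (left_mate D E F u)) = DCat D A" "Tgt (NSrc (left_mate D E F u)) = DCat E B"
    using l.unit by (simp_all add: left_mate_def nt_between_def)
qed

text \<open>The mate is the transpose of \<open>F X \<rightarrow> F u\<^sup>* u\<^sub>! X \<cong> u\<^sup>* F u\<^sub>! X\<close>.\<close>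

definition left_mate_arr :: "'u sftr \<Rightarrow> 'o \<Rightarrow> 'q" where
  "left_mate_arr u X = Cmp (DCat E (Src u)) (inv_arr (DCat E (Src u)) (At (MIso F u) (FO (lan D u) X)))
    (FA (MFun F (Src u)) (At (lan_unit D u) X))"

lemma left_mate:
  assumes u: "small_ftr u A B" and X: "X \<in> Obj (DCat D A)"
  shows "At (left_mate D E F u) X = Cmp (DCat E B)
      (At (lan_counit E u) (FO (MFun F B) (FO (lan D u) X))) (FA (lan E u) (left_mate_arr u X))"
    and "left_mate_arr u X
      \<in> Hom (DCat E A) (FO (MFun F A) X) (FO (DFun E u) (FO (MFun F B) (FO (lan D u) X)))"
    and "At (left_mate D E F u) X
      \<in> Hom (DCat E B) (FO (lan E u) (FO (MFun F A) X)) (FO (MFun F B) (FO (lan D u) X))"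
    and "Cmp (DCat E A) (FA (DFun E u) (At (left_mate D E F u) X))
      (At (lan_unit E u) (FO (MFun F A) X)) = left_mate_arr u X"
proof -
  interpret l: lan_pair D u A B by (rule D.lan_pair[OF u])
  interpret l': lan_pair E u A B by (rule E.lan_pair[OF u])
  note [simp] = MFun_simps[OF small_ftrD(6)[OF u]] MFun_simps[OF small_ftrD(5)[OF u]]
    small_ftrD(2,3)[OF u] MIso[OF u] MIso_sel[OF u] X
  have n: "NSrc (lan_unit D u) = fid (DCat D A)" using l.unit by (simp add: nt_between_def)
  have i [simp]: "iso_arr (DCat E A) (At (MIso F u) (FO (lan D u) X))" by simp
  show h: "left_mate_arr u X
      \<in> Hom (DCat E A) (FO (MFun F A) X) (FO (DFun E u) (FO (MFun F B) (FO (lan D u) X)))"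
    by (simp add: left_mate_arr_def Hom_def)
  show a: "At (left_mate D E F u) X = Cmp (DCat E B)
      (At (lan_counit E u) (FO (MFun F B) (FO (lan D u) X))) (FA (lan E u) (left_mate_arr u X))"
    by (simp add: left_mate_def left_mate_arr_def n)
  show "At (left_mate D E F u) X
      \<in> Hom (DCat E B) (FO (lan E u) (FO (MFun F A) X)) (FO (MFun F B) (FO (lan D u) X))"
    using h unfolding a by (simp add: Hom_def)
  show "Cmp (DCat E A) (FA (DFun E u) (At (left_mate D E F u) X))
      (At (lan_unit E u) (FO (MFun F A) X)) = left_mate_arr u X"
    unfolding a by (rule l'.transpose_unit[OF h]) simp
qed

lemma right_mate_sel:
  assumes u: "small_ftr u A B"
  shows "Src (NSrc (right_mate D E F u)) = DCat D A" "Tgt (NSrc (right_mate D E F u)) = DCat E B"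
proof -
  interpret r: ran_pair D u A B by (rule D.ran_pair[OF u])
  interpret r': ran_pair E u A B by (rule E.ran_pair[OF u])
  show "Src (NSrc (right_mate D E F u)) = DCat D A" "Tgt (NSrc (right_mate D E F u)) = DCat E B"
    using r'.unit by (simp_all add: right_mate_def nt_between_def)
qed

text \<open>The mate \<open>F u\<^sub>* X \<rightarrow> u\<^sub>* F X\<close> is the transpose of \<open>u\<^sup>* F u\<^sub>* X \<cong> F u\<^sup>* u\<^sub>* X \<rightarrow> F X\<close>.\<close>

definition right_mate_arr :: "'u sftr \<Rightarrow> 'o \<Rightarrow> 'q" where
  "right_mate_arr u X = Cmp (DCat E (Src u)) (FA (MFun F (Src u)) (At (ran_counit D u) X))
    (At (MIso F u) (FO (ran D u) X))"

lemma right_mate: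
  assumes u: "small_ftr u A B" and X: "X \<in> Obj (DCat D A)"
  shows "right_mate_arr u X
      \<in> Hom (DCat E A) (FO (DFun E u) (FO (MFun F B) (FO (ran D u) X))) (FO (MFun F A) X)"
    and "At (right_mate D E F u) X
      \<in> Hom (DCat E B) (FO (MFun F B) (FO (ran D u) X)) (FO (ran E u) (FO (MFun F A) X))"
    and "Cmp (DCat E A) (At (ran_counit E u) (FO (MFun F A) X))
      (FA (DFun E u) (At (right_mate D E F u) X)) = right_mate_arr u X"
proof -
  interpret r: ran_pair D u A B by (rule D.ran_pair[OF u])
  interpret r': ran_pair E u A B by (rule E.ran_pair[OF u])
  note [simp] = MFun_simps[OF small_ftrD(6)[OF u]] MFun_simps[OF small_ftrD(5)[OF u]]
    small_ftrD(2,3)[OF u] MIso[OF u] MIso_sel[OF u] X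
  have n: "NSrc (ran_unit E u) = fid (DCat E B)" "NSrc (ran_counit D u) = DFun D u \<odot> ran D u"
    using r.counit r'.unit by (simp_all add: nt_between_def)
  show h: "right_mate_arr u X
      \<in> Hom (DCat E A) (FO (DFun E u) (FO (MFun F B) (FO (ran D u) X))) (FO (MFun F A) X)"
    by (simp add: right_mate_arr_def Hom_def)
  have a: "At (right_mate D E F u) X = Cmp (DCat E B) (FA (ran E u) (right_mate_arr u X))
      (At (ran_unit E u) (FO (MFun F B) (FO (ran D u) X)))"
    by (simp add: right_mate_def right_mate_arr_def n r'.C.cmp_assoc)
  show "At (right_mate D E F u) X
      \<in> Hom (DCat E B) (FO (MFun F B) (FO (ran D u) X)) (FO (ran E u) (FO (MFun F A) X))"
    using h unfolding a by (simp add: Hom_def)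
  show "Cmp (DCat E A) (At (ran_counit E u) (FO (MFun F A) X))
      (FA (DFun E u) (At (right_mate D E F u) X)) = right_mate_arr u X"
    unfolding a by (rule r'.transpose_counit[OF h]) simp
qed

end

section \<open>Exact squares\<close>

context derivator
begin

text \<open>For \<open>\<phi> : u p \<rightarrow> v q\<close>, the arrow \<open>p\<^sup>* X \<rightarrow> p\<^sup>* u\<^sup>* u\<^sub>! X \<rightarrow> q\<^sup>* v\<^sup>* u\<^sub>! X\<close>, whose transpose under \<open>q\<^sub>!\<close> is the
  mate of the square.\<close>

definition square_arr :: "'u sftr \<Rightarrow> 'u sftr \<Rightarrow> 'u snt \<Rightarrow> 'o \<Rightarrow> 'm" where
  "square_arr p u \<phi> X = Cmp (DCat D (Src p)) (At (DNat D \<phi>) (FO (lan D u) X))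
    (FA (DFun D p) (At (lan_unit D u) X))"

text \<open>Invertibility of the mate \<open>q\<^sub>! p\<^sup>* \<rightarrow> v\<^sup>* u\<^sub>!\<close>, phrased without \<open>q\<^sub>!\<close>.  In this form the functor \<open>q\<close> can
  be changed without comparing chosen Kan extensions.\<close>

definition exact_square :: "'u sftr \<Rightarrow> 'u sftr \<Rightarrow> 'u sftr \<Rightarrow> 'u sftr \<Rightarrow> 'u snt \<Rightarrow> bool" where
  "exact_square p q u v \<phi> \<longleftrightarrow> (\<forall>X \<in> Obj (DCat D (Src u)).
    univ_arr (DFun D q) (FO (DFun D p) X) (FO (DFun D v) (FO (lan D u) X)) (square_arr p u \<phi> X))"

lemma square_arr_hom:
  assumes p: "small_ftr p J A" and q: "small_ftr q J B" and u: "small_ftr u A C"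
    and v: "small_ftr v B C" and \<phi>: "small_nt_between \<phi> (u \<odot> p) (v \<odot> q) J C"
    and X: "X \<in> Obj (DCat D A)"
  shows "square_arr p u \<phi> X
    \<in> Hom (DCat D J) (FO (DFun D p) X) (FO (DFun D q) (FO (DFun D v) (FO (lan D u) X)))"
proof -
  interpret l: lan_pair D u A C by (rule lan_pair[OF u])
  interpret J: category "DCat D J" by (rule DCat[OF small_ftrD(5)[OF p]])
  note [simp] = DFun_simps[OF p] DFun_simps[OF q] DFun_simps[OF v]
    DNat_simps[OF \<phi>] DFun_comp[OF p u] DFun_comp[OF q v] X small_ftrD(2)[OF p]
  show ?thesis by (simp add: square_arr_def Hom_def)
qed

lemma exact_square_if_mate:
  assumes p: "small_ftr p J A" and q: "small_ftr q J B" and u: "small_ftr u A C"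
    and v: "small_ftr v B C" and \<phi>: "small_nt_between \<phi> (u \<odot> p) (v \<odot> q) J C"
    and iso: "nat_iso (left_square_mate D p q u v \<phi>)"
  shows "exact_square p q u v \<phi>"
  unfolding exact_square_def
proof
  fix X assume "X \<in> Obj (DCat D (Src u))"
  then have X: "X \<in> Obj (DCat D A)" using small_ftrD(2)[OF u] by simp
  interpret l: lan_pair D u A C by (rule lan_pair[OF u])
  interpret r: lan_pair D q J B by (rule lan_pair[OF q])
  note [simp] = DFun_simps[OF p] DFun_simps[OF q] DFun_simps[OF v]
    DNat_simps[OF \<phi>] DFun_comp[OF p u] DFun_comp[OF q v] X small_ftrD(2)[OF p]
  have n: "NSrc (lan_unit D u) = fid (DCat D A)" "NSrc (DNat D \<phi>) = DFun D (u \<odot> p)"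
    using l.unit DNat[OF \<phi>] by (simp_all add: nt_between_def)
  let ?m = "left_square_mate D p q u v \<phi>"
  have "iso_arr (DCat D B) (At ?m X)"
    using iso by (simp add: nat_iso_def left_square_mate_def n)
  moreover have "At ?m X = Cmp (DCat D B) (At (lan_counit D q) (FO (DFun D v) (FO (lan D u) X)))
      (FA (lan D q) (square_arr p u \<phi> X))"
    using functor_simps[OF DFun[OF small_ftr_fcomp[OF p u]]]
    by (simp add: left_square_mate_def n square_arr_def)
  ultimately show "univ_arr (DFun D q) (FO (DFun D p) X) (FO (DFun D v) (FO (lan D u) X))
      (square_arr p u \<phi> X)"
    using r.transpose_iso_iff[OF square_arr_hom[OF p q u v \<phi> X]] by simp
qed

text \<open>For \<open>P\<close> left adjoint to \<open>s\<close> with unit \<open>\<sigma>\<close> and identical counit, the 2-functor, which reverses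
  the direction of functors, yields an adjunction \<open>s\<^sup>* \<stileturn> P\<^sup>*\<close> with \<open>s\<^sup>* P\<^sup>* = id\<close>.  So transposition is
  simply application of \<open>s\<^sup>*\<close>, with inverse \<open>f \<mapsto> P\<^sup>* f \<cdot> \<sigma>\<^sup>*\<close>.\<close>

lemma restrict_reflection:
  assumes refl: "reflection s P \<sigma> J K" and Y: "Y \<in> Obj (DCat D K)" and V: "V \<in> Obj (DCat D J)"
  shows "f \<in> Hom (DCat D J) (FO (DFun D s) Y) V \<Longrightarrow>
      \<exists>g \<in> Hom (DCat D K) Y (FO (DFun D P) V). FA (DFun D s) g = f"
    and "g \<in> Hom (DCat D K) Y (FO (DFun D P) V) \<Longrightarrow> h \<in> Hom (DCat D K) Y (FO (DFun D P) V) \<Longrightarrow>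
      FA (DFun D s) g = FA (DFun D s) h \<Longrightarrow> g = h"
proof -
  note refl' = reflectionD[OF refl]
  note s = refl'(1) and P = refl'(2) and Ps = refl'(3) and \<sigma> = refl'(4) and \<sigma>s = refl'(5) and P\<sigma> = refl'(6)
  interpret J: category "DCat D J" by (rule DCat[OF small_ftrD(5)[OF s]])
  interpret K: category "DCat D K" by (rule DCat[OF small_ftrD(6)[OF s]])
  note [simp] = DFun_simps[OF s] DFun_simps[OF P]
    DNat_simps[OF \<sigma>] DFun_comp[OF P s] Y V
  have fidK: "DFun D (fid K) = fid (DCat D K)" by (rule DFun_fid[OF small_ftrD(6)[OF s]])
  have sP: "FA (DFun D s) (FA (DFun D P) k) = k"
    if "k \<in> Arr (DCat D J)" for k
    using DFun_comp(2)[OF s P that] DFun_fid[OF small_ftrD(5)[OF s]] Ps that by auto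
  have sP' [simp]: "FO (DFun D s) (FO (DFun D P) V) = V"
    using DFun_comp(1)[OF s P V] DFun_fid[OF small_ftrD(5)[OF s]] Ps by simp
  have \<sigma>s': "FA (DFun D s) (At (DNat D \<sigma>) Y) = Idn (DCat D J) (FO (DFun D s) Y)"
    using DNat_whisk_r[OF \<sigma> s Y] DNat_nid_At[OF s Y] \<sigma>s by simp
  have P\<sigma>': "At (DNat D \<sigma>) (FO (DFun D P) V) = Idn (DCat D K) (FO (DFun D P) V)"
    using DNat_whisk_l[OF \<sigma> P V] DNat_nid_At[OF P V] P\<sigma> by simp
  show "\<exists>g \<in> Hom (DCat D K) Y (FO (DFun D P) V). FA (DFun D s) g = f"
    if f: "f \<in> Hom (DCat D J) (FO (DFun D s) Y) V"
  proof
    have [simp]: "f \<in> Arr (DCat D J)" "Dom (DCat D J) f = FO (DFun D s) Y" "Cod (DCat D J) f = V"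
      using f by (auto simp: Hom_def)
    let ?g = "Cmp (DCat D K) (FA (DFun D P) f) (At (DNat D \<sigma>) Y)"
    show "FA (DFun D s) ?g = f" by (simp add: fidK \<sigma>s' sP)
    show "?g \<in> Hom (DCat D K) Y (FO (DFun D P) V)" by (simp add: Hom_def fidK)
  qed
  have recover: "Cmp (DCat D K) (FA (DFun D P) (FA (DFun D s) g)) (At (DNat D \<sigma>) Y) = g"
    if g: "g \<in> Hom (DCat D K) Y (FO (DFun D P) V)" for g
    using DNat_natural[OF \<sigma>, of g] g by (simp add: fidK P\<sigma>' Hom_def)
  show "g = h"
    if "g \<in> Hom (DCat D K) Y (FO (DFun D P) V)" "h \<in> Hom (DCat D K) Y (FO (DFun D P) V)"
      "FA (DFun D s) g = FA (DFun D s) h"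
    using recover[OF that(1), symmetric] recover[OF that(2)] unfolding that(3) by simp
qed

text \<open>Dually, \<open>P\<^sup>*\<close> is left adjoint to \<open>s\<^sup>*\<close>, and \<open>\<sigma>\<^sup>* \<cdot> P\<^sup>* f\<close> corresponds to \<open>f\<close>.\<close>

lemma restrict_coreflection:
  assumes refl: "coreflection s P \<sigma> J K" and Y: "Y \<in> Obj (DCat D K)" and V: "V \<in> Obj (DCat D J)"
  shows "f \<in> Hom (DCat D J) V (FO (DFun D s) Y) \<Longrightarrow>
      \<exists>g \<in> Hom (DCat D K) (FO (DFun D P) V) Y. FA (DFun D s) g = f"
proof -
  note refl' = coreflectionD[OF refl]
  note s = refl'(1) and P = refl'(2) and Ps = refl'(3) and \<sigma> = refl'(4) and \<sigma>s = refl'(5)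
  interpret J: category "DCat D J" by (rule DCat[OF small_ftrD(5)[OF s]])
  interpret K: category "DCat D K" by (rule DCat[OF small_ftrD(6)[OF s]])
  note [simp] = DFun_simps[OF s] DFun_simps[OF P]
    DNat_simps[OF \<sigma>] DFun_comp[OF P s] Y V
  have fidK: "DFun D (fid K) = fid (DCat D K)" by (rule DFun_fid[OF small_ftrD(6)[OF s]])
  have sP: "FA (DFun D s) (FA (DFun D P) k) = k"
    if "k \<in> Arr (DCat D J)" for k
    using DFun_comp(2)[OF s P that] DFun_fid[OF small_ftrD(5)[OF s]] Ps that by auto
  have sP' [simp]: "FO (DFun D s) (FO (DFun D P) V) = V"
    using DFun_comp(1)[OF s P V] DFun_fid[OF small_ftrD(5)[OF s]] Ps by simp
  have \<sigma>s': "FA (DFun D s) (At (DNat D \<sigma>) Y) = Idn (DCat D J) (FO (DFun D s) Y)"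
    using DNat_whisk_r[OF \<sigma> s Y] DNat_nid_At[OF s Y] \<sigma>s by simp
  show "\<exists>g \<in> Hom (DCat D K) (FO (DFun D P) V) Y. FA (DFun D s) g = f"
    if f: "f \<in> Hom (DCat D J) V (FO (DFun D s) Y)"
  proof
    have [simp]: "f \<in> Arr (DCat D J)" "Dom (DCat D J) f = V" "Cod (DCat D J) f = FO (DFun D s) Y"
      using f by (auto simp: Hom_def)
    let ?g = "Cmp (DCat D K) (At (DNat D \<sigma>) Y) (FA (DFun D P) f)"
    show "FA (DFun D s) ?g = f" by (simp add: fidK \<sigma>s' sP)
    show "?g \<in> Hom (DCat D K) (FO (DFun D P) V) Y" by (simp add: Hom_def fidK)
  qed
qed

text \<open>By the adjunctions \<open>P\<^sup>* \<stileturn> s\<^sup>* \<stileturn> s\<^sub>*\<close>, arrows \<open>Z \<rightarrow> s\<^sup>* s\<^sub>* X\<close> correspond to arrows \<open>s\<^sup>* P\<^sup>* Z = Z \<rightarrow> X\<close>.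
  The correspondence is composition with the counit, which is therefore invertible.\<close>

lemma ran_counit_iso:
  assumes refl: "coreflection s P \<sigma> J K" and X: "X \<in> Obj (DCat D J)"
  shows "iso_arr (DCat D J) (At (ran_counit D s) X)"
proof -
  note s = coreflectionD(1)[OF refl] and P = coreflectionD(2)[OF refl] and Ps = coreflectionD(3)[OF refl]
  interpret r: ran_pair D s J K by (rule ran_pair[OF s])
  note [simp] = DFun_simps[OF P] X
  have sP: "FO (DFun D s) (FO (DFun D P) Z) = Z"
    if "Z \<in> Obj (DCat D J)" for Z
    using DFun_comp(1)[OF s P that] DFun_fid[OF small_ftrD(5)[OF s]] Ps that by simp
  let ?\<epsilon> = "At (ran_counit D s) X" and ?R = "FO (DFun D s) (FO (ran D s) X)"
  have lift: "\<exists>g \<in> Hom (DCat D J) Z ?R. Cmp (DCat D J) ?\<epsilon> g = f"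
    if f: "f \<in> Hom (DCat D J) Z X" for f Z
  proof -
    have Z: "Z \<in> Obj (DCat D J)" using f r.D.hom_obj by blast
    let ?h = "Cmp (DCat D K) (FA (ran D s) f) (At (ran_unit D s) (FO (DFun D P) Z))"
    have "Cmp (DCat D J) ?\<epsilon> (FA (DFun D s) ?h) = f"
      by (rule r.transpose_counit) (use f Z sP[OF Z] in simp_all)
    moreover have "FA (DFun D s) ?h \<in> Hom (DCat D J) Z ?R"
      using f Z sP[OF Z] by (simp add: Hom_def)
    ultimately show ?thesis by blast
  qed
  have unique: "g = g'"
    if g: "g \<in> Hom (DCat D J) Z ?R" and g': "g' \<in> Hom (DCat D J) Z ?R"
      and eq: "Cmp (DCat D J) ?\<epsilon> g = Cmp (DCat D J) ?\<epsilon> g'" for g g' Z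
  proof -
    have Z: "Z \<in> Obj (DCat D J)" using g r.D.hom_obj by blast
    have R: "FO (ran D s) X \<in> Obj (DCat D K)" by simp
    note ex = restrict_coreflection[OF refl R Z]
    obtain h h' where h: "h \<in> Hom (DCat D K) (FO (DFun D P) Z) (FO (ran D s) X)" "FA (DFun D s) h = g"
      and h': "h' \<in> Hom (DCat D K) (FO (DFun D P) Z) (FO (ran D s) X)" "FA (DFun D s) h' = g'"
      using ex[OF g] ex[OF g'] by blast
    have "h = h'"
      by (rule r.right_eqI[OF h(1) h'(1) X]) (use h h' eq in simp)
    then show ?thesis using h h' by simp
  qed
  obtain g where g: "g \<in> Hom (DCat D J) X ?R" "Cmp (DCat D J) ?\<epsilon> g = Idn (DCat D J) X"
    using lift[of "Idn (DCat D J) X" X] by (auto simp: Hom_def)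
  have "Cmp (DCat D J) g ?\<epsilon> = Idn (DCat D J) ?R"
  proof (rule unique[of _ ?R])
    have "Cmp (DCat D J) ?\<epsilon> (Cmp (DCat D J) g ?\<epsilon>) = Cmp (DCat D J) (Cmp (DCat D J) ?\<epsilon> g) ?\<epsilon>"
      using g(1) by (simp add: Hom_def r.D.cmp_assoc)
    then show "Cmp (DCat D J) ?\<epsilon> (Cmp (DCat D J) g ?\<epsilon>) = Cmp (DCat D J) ?\<epsilon> (Idn (DCat D J) ?R)"
      using g(2) by simp
  qed (use g(1) in \<open>simp_all add: Hom_def\<close>)
  then show ?thesis
    using g r.D.isoI[of ?\<epsilon> ?R X g] by (simp add: Hom_def)
qed

text \<open>The inclusion \<open>s\<close> of a reflective subcategory is final: colimits over \<open>K\<close> may be computed over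
  \<open>J\<close>.  Indeed arrows \<open>s\<^sup>* Y \<rightarrow> q\<^sup>* Z\<close> correspond to arrows \<open>Y \<rightarrow> P\<^sup>* q\<^sup>* Z\<close>, so that \<open>s\<^sup>*\<close> takes universal
  arrows for \<open>(q P)\<^sup>*\<close> to universal arrows for \<open>q\<^sup>*\<close>.\<close>

lemma exact_square_restrict:
  assumes refl: "reflection s P \<sigma> J K" and p: "small_ftr p K A" and q: "small_ftr q J B" and u: "small_ftr u A C"
    and v: "small_ftr v B C" and \<phi>: "small_nt_between \<phi> (u \<odot> p) (v \<odot> (q \<odot> P)) K C"
    and ex: "exact_square p (q \<odot> P) u v \<phi>"
  shows "exact_square (p \<odot> s) q u v (\<phi> \<triangleleft> s)"
  unfolding exact_square_def
proof
  note s = reflectionD(1)[OF refl] and P = reflectionD(2)[OF refl] and Ps = reflectionD(3)[OF refl]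
  fix X assume "X \<in> Obj (DCat D (Src u))"
  then have X [simp]: "X \<in> Obj (DCat D A)" using small_ftrD(2)[OF u] by simp
  interpret l: lan_pair D u A C by (rule lan_pair[OF u])
  interpret J: category "DCat D J" by (rule DCat[OF small_ftrD(5)[OF s]])
  interpret K: category "DCat D K" by (rule DCat[OF small_ftrD(6)[OF s]])
  note qP = small_ftr_fcomp[OF P q]
  note [simp] = DFun_simps[OF s] DFun_simps[OF p] DFun_simps[OF P]
    DFun_simps[OF q] DFun_simps[OF v]
    DFun_comp[OF s p] DFun_comp[OF P q] DFun_comp[OF p u] DFun_comp[OF qP v]
    DNat_simps[OF \<phi>] small_ftrD(2)[OF p] small_ftrD(2)[OF s]
  have sP: "FO (DFun D s) (FO (DFun D P) Z) = Z" if "Z \<in> Obj (DCat D J)" for Z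
    using DFun_comp(1)[OF s P that] DFun_fid[OF small_ftrD(5)[OF s]] Ps that by simp
  have sP': "FA (DFun D s) (FA (DFun D P) k) = k" if "k \<in> Arr (DCat D J)" for k
    using DFun_comp(2)[OF s P that] DFun_fid[OF small_ftrD(5)[OF s]] Ps that by simp
  let ?Y = "FO (DFun D p) X" and ?W = "FO (DFun D v) (FO (lan D u) X)" and ?y = "square_arr p u \<phi> X"
  have y: "univ_arr (DFun D (q \<odot> P)) ?Y ?W ?y"
    using ex small_ftrD(2)[OF u] by (simp add: exact_square_def)
  have [simp]: "?y \<in> Arr (DCat D K)" "Dom (DCat D K) ?y = ?Y"
    "Cod (DCat D K) ?y = FO (DFun D P) (FO (DFun D q) ?W)"
    using square_arr_hom[OF p qP u v \<phi> X] by (simp_all add: Hom_def)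
  have sy: "square_arr (p \<odot> s) u (\<phi> \<triangleleft> s) X = FA (DFun D s) ?y"
    using DNat_whisk_r[OF \<phi> s] by (simp add: square_arr_def)
  note bij = restrict_reflection[OF refl]
  have "univ_arr (DFun D q) (FO (DFun D s) ?Y) ?W (FA (DFun D s) ?y)"
  proof (rule univ_arrI[OF DFun[OF q]])
    fix z f assume z [simp]: "z \<in> Obj (DCat D B)"
      and f: "f \<in> Hom (DCat D J) (FO (DFun D s) ?Y) (FO (DFun D q) z)"
    obtain f' where f': "f' \<in> Hom (DCat D K) ?Y (FO (DFun D P) (FO (DFun D q) z))"
        "FA (DFun D s) f' = f"
      using bij(1)[OF _ _ f] by auto
    then obtain g where g: "g \<in> Hom (DCat D B) ?W z" "Cmp (DCat D K) (FA (DFun D (q \<odot> P)) g) ?y = f'"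
      using univ_arr_ex[OF DFun[OF qP] y, of f' z] by auto
    have "FA (DFun D s) (Cmp (DCat D K) (FA (DFun D (q \<odot> P)) g) ?y)
        = Cmp (DCat D J) (FA (DFun D q) g) (FA (DFun D s) ?y)"
      using g(1) by (simp add: Hom_def sP')
    then show "\<exists>g \<in> Hom (DCat D B) ?W z. Cmp (DCat D J) (FA (DFun D q) g) (FA (DFun D s) ?y) = f"
      using g f' by auto
  next
    fix z g h assume g: "g \<in> Hom (DCat D B) ?W z" and h: "h \<in> Hom (DCat D B) ?W z"
      and eq: "Cmp (DCat D J) (FA (DFun D q) g) (FA (DFun D s) ?y)
        = Cmp (DCat D J) (FA (DFun D q) h) (FA (DFun D s) ?y)"
    interpret B: category "DCat D B" by (rule DCat[OF small_ftrD(6)[OF q]])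
    have z [simp]: "z \<in> Obj (DCat D B)" using B.hom_obj g by blast
    have "Cmp (DCat D K) (FA (DFun D (q \<odot> P)) g) ?y = Cmp (DCat D K) (FA (DFun D (q \<odot> P)) h) ?y"
      by (rule bij(2)[of _ "FO (DFun D q) z"]) (use g h eq in \<open>auto simp: Hom_def sP'\<close>)
    then show "g = h" using univ_arr_eq[OF DFun[OF qP] y g h] by simp
  qed (simp_all add: Hom_def sP)
  then show "univ_arr (DFun D q) (FO (DFun D (p \<odot> s)) X) ?W (square_arr (p \<odot> s) u (\<phi> \<triangleleft> s) X)"
    by (simp add: sy)
qed

end

context derivator_morphism
begin

text \<open>For the chosen unit in place of \<open>e\<close> this is the definition of preservation; an arbitrary \<open>e\<close>
  differs from the unit by an isomorphism, and \<open>F\<close> preserves isomorphisms.\<close>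

lemma preserves_univ_arr:
  assumes q: "small_ftr q J B" and pres: "preserves_lan D E F q"
    and e: "univ_arr (DFun D q) Y W e" and Y: "Y \<in> Obj (DCat D J)"
  shows "univ_arr (DFun E q) (FO (MFun F J) Y) (FO (MFun F B) W)
    (Cmp (DCat E J) (inv_arr (DCat E J) (At (MIso F q) W)) (FA (MFun F J) e))"
proof -
  interpret l: lan_pair D q J B by (rule D.lan_pair[OF q])
  interpret l': lan_pair E q J B by (rule E.lan_pair[OF q])
  note FJ = MFun[OF small_ftrD(5)[OF q]] and FB = MFun[OF small_ftrD(6)[OF q]]
  note [simp] = functor_simps[OF FJ] functor_simps[OF FB] small_ftrD(2,3)[OF q] MIso[OF q] Y
    univ_arrD[OF D.DFun[OF q] e]
  let ?W0 = "FO (lan D q) Y"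
  have "iso_arr (DCat E B) (At (left_mate D E F q) Y)"
    using pres left_mate_sel[OF q] by (simp add: preserves_lan_def nat_iso_def)
  then have m: "univ_arr (DFun E q) (FO (MFun F J) Y) (FO (MFun F B) ?W0) (left_mate_arr q Y)"
    using left_mate(1)[OF q Y] l'.transpose_iso_iff[OF left_mate(2)[OF q Y]] by simp
  obtain t where t: "t \<in> Hom (DCat D B) ?W0 W"
      "Cmp (DCat D J) (FA (DFun D q) t) (At (lan_unit D q) Y) = e"
    using univ_arr_ex[OF D.DFun[OF q] l.univ_unit[OF Y], of e W] by (auto simp: Hom_def)
  have [simp]: "t \<in> Arr (DCat D B)" "Dom (DCat D B) t = ?W0" "Cod (DCat D B) t = W"
    using t by (auto simp: Hom_def)
  have "iso_arr (DCat D B) t"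
    using univ_arr_post_iff[OF D.DFun[OF q] l.univ_unit[OF Y] t(1)] e unfolding t(2) by simp
  then have "iso_arr (DCat E B) (FA (MFun F B) t)" by (rule functor_iso[OF FB])
  moreover have "FA (MFun F B) t \<in> Hom (DCat E B) (FO (MFun F B) ?W0) (FO (MFun F B) W)"
    by (simp add: Hom_def)
  ultimately have u: "univ_arr (DFun E q) (FO (MFun F J) Y) (FO (MFun F B) W)
      (Cmp (DCat E J) (FA (DFun E q) (FA (MFun F B) t)) (left_mate_arr q Y))"
    using univ_arr_post_iff[OF E.DFun[OF q] m] by simp
  let ?\<gamma> = "\<lambda>Z. At (MIso F q) Z"
  have i [simp]: "iso_arr (DCat E J) (?\<gamma> W)" "iso_arr (DCat E J) (?\<gamma> ?W0)" by simp_all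
  have "Cmp (DCat E J) (FA (DFun E q) (FA (MFun F B) t)) (inv_arr (DCat E J) (?\<gamma> ?W0))
      = Cmp (DCat E J) (inv_arr (DCat E J) (?\<gamma> W)) (FA (MFun F J) (FA (DFun D q) t))"
    by (rule l'.C.inv_square) (use MIso_naturality[OF q, of t] in \<open>simp_all add: Hom_def\<close>)
  then have "Cmp (DCat E J) (FA (DFun E q) (FA (MFun F B) t)) (left_mate_arr q Y)
      = Cmp (DCat E J) (inv_arr (DCat E J) (?\<gamma> W))
        (Cmp (DCat E J) (FA (MFun F J) (FA (DFun D q) t)) (FA (MFun F J) (At (lan_unit D q) Y)))"
    by (simp add: left_mate_arr_def l'.C.cmp_assoc[symmetric])
  also have "\<dots> = Cmp (DCat E J) (inv_arr (DCat E J) (?\<gamma> W)) (FA (MFun F J) e)"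
    unfolding t(2)[symmetric] by simp
  finally show ?thesis using u by simp
qed

text \<open>In both derivators \<open>v\<^sup>* u\<^sub>!\<close> is computed by \<open>q\<^sub>! p\<^sup>*\<close>, so that \<open>v\<^sup>*\<close> of the mate along \<open>u\<close> compares two
  arrows that are universal for \<open>q\<^sup>*\<close>: the one of \<open>E\<close> at \<open>F X\<close>, and the image under \<open>F\<close> of the one of
  \<open>D\<close> at \<open>X\<close>.\<close>

lemma left_mate_iso_along:
  assumes p: "small_ftr p J A" and q: "small_ftr q J B" and u: "small_ftr u A C"
    and v: "small_ftr v B C" and \<phi>: "small_nt_between \<phi> (u \<odot> p) (v \<odot> q) J C"
    and exD: "D.exact_square p q u v \<phi>" and exE: "E.exact_square p q u v \<phi>"
    and pres: "preserves_lan D E F q" and X: "X \<in> Obj (DCat D A)"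
  shows "iso_arr (DCat E B) (FA (DFun E v) (At (left_mate D E F u) X))"
proof -
  interpret l: lan_pair D u A C by (rule D.lan_pair[OF u])
  interpret l': lan_pair E u A C by (rule E.lan_pair[OF u])
  interpret EJ: category "DCat E J" by (rule E.DCat[OF small_ftrD(5)[OF p]])
  interpret EB: category "DCat E B" by (rule E.DCat[OF small_ftrD(6)[OF q]])
  interpret DJ: category "DCat D J" by (rule D.DCat[OF small_ftrD(5)[OF p]])
  note FJ = MFun[OF small_ftrD(5)[OF q]] and FB = MFun[OF small_ftrD(6)[OF q]]
    and FA = MFun[OF small_ftrD(5)[OF u]] and FC = MFun[OF small_ftrD(6)[OF u]]
  note [simp] = functor_simps[OF FJ] functor_simps[OF FB] functor_simps[OF FA] functor_simps[OF FC]
    D.DFun_simps[OF p] D.DFun_simps[OF q] D.DFun_simps[OF v]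
    E.DFun_simps[OF p] E.DFun_simps[OF q] E.DFun_simps[OF v]
    MIso[OF p] MIso[OF q] MIso[OF u] MIso[OF v] X
    D.DNat_simps[OF \<phi>] E.DNat_simps[OF \<phi>] D.DFun_comp[OF p u] D.DFun_comp[OF q v]
    E.DFun_comp[OF p u] E.DFun_comp[OF q v]
    small_ftrD(2,3)[OF p] small_ftrD(2,3)[OF q] small_ftrD(2,3)[OF u] small_ftrD(2,3)[OF v]
  let ?W = "FO (lan D u) X" and ?m = "At (left_mate D E F u) X" and ?c = "Cmp (DCat E J)"
  let ?FX = "FO (MFun F A) X"
  have m [simp]: "?m \<in> Arr (DCat E C)" "Dom (DCat E C) ?m = FO (lan E u) ?FX"
    "Cod (DCat E C) ?m = FO (MFun F C) ?W"
    using left_mate(3)[OF u X] by (simp_all add: Hom_def)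
  have a [simp]: "left_mate_arr u X \<in> Arr (DCat E A)" "Dom (DCat E A) (left_mate_arr u X) = ?FX"
    "Cod (DCat E A) (left_mate_arr u X) = FO (DFun E u) (FO (MFun F C) ?W)"
    using left_mate(2)[OF u X] by (simp_all add: Hom_def)
  define e where "e = E.square_arr p u \<phi> ?FX"
  have e: "univ_arr (DFun E q) (FO (DFun E p) ?FX) (FO (DFun E v) (FO (lan E u) ?FX)) e"
    using exE unfolding e_def by (simp add: E.exact_square_def)
  define d where "d = D.square_arr p u \<phi> X"
  have d: "univ_arr (DFun D q) (FO (DFun D p) X) (FO (DFun D v) ?W) d"
    using exD unfolding d_def by (simp add: D.exact_square_def)
  note [simp] = univ_arrD[OF D.DFun[OF q] d]
  let ?\<gamma>q = "At (MIso F q) (FO (DFun D v) ?W)" and ?\<gamma>v = "At (MIso F v) ?W"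
    and ?\<gamma>p = "At (MIso F p) X" and ?\<phi> = "At (DNat E \<phi>) (FO (MFun F C) ?W)"
    and ?\<gamma>u = "At (MIso F u) ?W"
  have iso [simp]: "iso_arr (DCat E J) ?\<gamma>q" "iso_arr (DCat E B) ?\<gamma>v" "iso_arr (DCat E J) ?\<gamma>p"
    "iso_arr (DCat E A) ?\<gamma>u"
    by simp_all
  define f where "f = ?c ?\<phi> (FA (DFun E p) (left_mate_arr u X))"
  have f [simp]: "f \<in> Arr (DCat E J)" "Dom (DCat E J) f = FO (DFun E p) ?FX"
    "Cod (DCat E J) f = FO (DFun E q) (FO (DFun E v) (FO (MFun F C) ?W))"
    by (simp_all add: f_def)
  \<comment> \<open>The mate carries the universal arrow \<open>e\<close> of \<open>E\<close> to \<open>f\<close> \<dots>\<close>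
  have em: "?c (FA (DFun E q) (FA (DFun E v) ?m)) e = f"
  proof -
    have "?c (FA (DFun E q) (FA (DFun E v) ?m)) e
        = ?c (?c (FA (DFun E (v \<odot> q)) ?m) (At (DNat E \<phi>) (FO (lan E u) ?FX)))
            (FA (DFun E p) (At (lan_unit E u) ?FX))"
      by (simp add: e_def E.square_arr_def EJ.cmp_assoc)
    also have "?c (FA (DFun E (v \<odot> q)) ?m) (At (DNat E \<phi>) (FO (lan E u) ?FX))
        = ?c ?\<phi> (FA (DFun E (u \<odot> p)) ?m)"
      using E.DNat_natural[OF \<phi> m(1)] by simp
    also have "?c (?c ?\<phi> (FA (DFun E (u \<odot> p)) ?m)) (FA (DFun E p) (At (lan_unit E u) ?FX))
        = ?c ?\<phi> (FA (DFun E p) (Cmp (DCat E A) (FA (DFun E u) ?m) (At (lan_unit E u) ?FX)))"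
      by (simp add: EJ.cmp_assoc)
    also have "\<dots> = f"
      unfolding f_def left_mate(4)[OF u X] by simp
    finally show ?thesis .
  qed
  \<comment> \<open>\<dots> which is the image of the universal arrow \<open>d\<close> of \<open>D\<close> up to structure isomorphisms.\<close>
  have key: "?c ?\<gamma>q (?c (FA (DFun E q) ?\<gamma>v) f) = ?c (FA (MFun F J) d) ?\<gamma>p"
  proof -
    let ?F\<phi> = "FA (MFun F J) (At (DNat D \<phi>) ?W)" and ?\<gamma>p' = "At (MIso F p) (FO (DFun D u) ?W)"
      and ?\<eta> = "At (lan_unit D u) X"
    have "?c ?\<gamma>q (?c (FA (DFun E q) ?\<gamma>v) f)
        = ?c (?c (At (MIso F (v \<odot> q)) ?W) ?\<phi>) (FA (DFun E p) (left_mate_arr u X))"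
      using MIso_comp[OF q v, of ?W] by (simp add: f_def EJ.cmp_assoc)
    also have "?c (At (MIso F (v \<odot> q)) ?W) ?\<phi> = ?c ?F\<phi> (?c ?\<gamma>p' (FA (DFun E p) ?\<gamma>u))"
      using MIso_nt[OF \<phi>, of ?W] MIso_comp[OF p u, of ?W] by simp
    also have "?c \<dots> (FA (DFun E p) (left_mate_arr u X))
        = ?c ?F\<phi> (?c ?\<gamma>p' (FA (DFun E p) (Cmp (DCat E A) ?\<gamma>u (left_mate_arr u X))))"
      by (simp add: EJ.cmp_assoc)
    also have "Cmp (DCat E A) ?\<gamma>u (left_mate_arr u X) = FA (MFun F A) ?\<eta>"
      by (simp add: left_mate_arr_def)
    also have "?c ?\<gamma>p' (FA (DFun E p) (FA (MFun F A) ?\<eta>))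
        = ?c (FA (MFun F J) (FA (DFun D p) ?\<eta>)) ?\<gamma>p"
      using MIso_naturality[OF p, of ?\<eta>] by simp
    also have "?c ?F\<phi> \<dots> = ?c (FA (MFun F J) d) ?\<gamma>p"
      by (simp add: d_def D.square_arr_def EJ.cmp_assoc)
    finally show ?thesis .
  qed
  let ?d' = "?c (inv_arr (DCat E J) ?\<gamma>q) (FA (MFun F J) d)"
  have "univ_arr (DFun E q) (FO (MFun F J) (FO (DFun D p) X)) (FO (MFun F B) (FO (DFun D v) ?W)) ?d'"
    by (rule preserves_univ_arr[OF q pres d]) simp
  then have "univ_arr (DFun E q) (FO (DFun E p) ?FX) (FO (MFun F B) (FO (DFun D v) ?W)) (?c ?d' ?\<gamma>p)"
    by (rule univ_arr_pre[OF E.DFun[OF q] _ iso(3)]) (simp add: Hom_def)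
  moreover have "?c ?d' ?\<gamma>p = ?c (FA (DFun E q) ?\<gamma>v) f"
  proof -
    have "?c ?d' ?\<gamma>p = ?c (inv_arr (DCat E J) ?\<gamma>q) (?c (FA (MFun F J) d) ?\<gamma>p)"
      by (simp add: EJ.cmp_assoc)
    also have "\<dots> = ?c (FA (DFun E q) ?\<gamma>v) f"
      unfolding key[symmetric] by simp
    finally show ?thesis .
  qed
  ultimately have "univ_arr (DFun E q) (FO (DFun E p) ?FX) (FO (MFun F B) (FO (DFun D v) ?W))
      (?c (FA (DFun E q) (Cmp (DCat E B) ?\<gamma>v (FA (DFun E v) ?m))) e)"
    using univ_arrD[OF E.DFun[OF q] e] by (simp add: em[symmetric] EJ.cmp_assoc)
  then have "iso_arr (DCat E B) (Cmp (DCat E B) ?\<gamma>v (FA (DFun E v) ?m))"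
    using univ_arr_post_iff[OF E.DFun[OF q] e,
        of "Cmp (DCat E B) ?\<gamma>v (FA (DFun E v) ?m)" "FO (MFun F B) (FO (DFun D v) ?W)"]
    by (simp add: Hom_def)
  then show ?thesis
    by (rule EB.iso_cancel_left) simp_all
qed

end

unbundle cardinal_syntax

section \<open>Small categories\<close>

lemma small_set_finite: "finite S \<Longrightarrow> small_set (S :: 'u::universe set)"
  unfolding small_set_def
  by (rule finite_ordLess_infinite) (simp_all add: card_of_well_order_on Field_card_of infinite_universe)

lemma small_set_subset: "small_set S \<Longrightarrow> T \<subseteq> S \<Longrightarrow> small_set T"
  unfolding small_set_def using card_of_mono1 ordLeq_ordLess_trans by blast

text \<open>A product of two sets is finite or no larger than the larger factor.\<close>

lemma small_set_upair:
  assumes S: "small_set (S :: 'u::universe set)" and T: "small_set (T :: 'u set)"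
  shows "small_set {upair x y | x y. x \<in> S \<and> y \<in> T}"
proof -
  have *: "|A \<times> B| <o |UNIV :: 'u set|"
    if "|A| <o |UNIV :: 'u set|" "|B| <o |UNIV :: 'u set|" "|A| \<le>o |B|" for A B :: "'u set"
  proof (cases "finite B \<or> A = {}")
    case True
    then have "finite (A \<times> B)"
      using that(3) card_of_ordLeq_finite by auto
    then show ?thesis
      by (intro finite_ordLess_infinite)
        (simp_all add: card_of_well_order_on Field_card_of infinite_universe)
  next
    case False
    then have "|A \<times> B| =o |B|" using card_of_Times_infinite[of B A] that(3) by blast
    then show ?thesis using that(2) ordIso_ordLess_trans by blast
  qed
  have "|S \<times> T| <o |UNIV :: 'u set|"
  proof (cases "|S| \<le>o |T|")
    case True
    then show ?thesis using * S T unfolding small_set_def by blast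
  next
    case False
    then have "|T| \<le>o |S|" using ordLeq_total card_of_Well_order by blast
    then have "|T \<times> S| <o |UNIV :: 'u set|" using * S T unfolding small_set_def by blast
    then show ?thesis using card_of_Times_commute ordIso_ordLess_trans by blast
  qed
  moreover have "{upair x y | x y. x \<in> S \<and> y \<in> T} = (\<lambda>(x, y). upair x y) ` (S \<times> T)" by auto
  ultimately show ?thesis
    unfolding small_set_def by (simp add: ordLeq_ordLess_trans[OF card_of_image])
qed

lemma category_small: "small_cat A \<Longrightarrow> category A"
  by (simp add: small_cat_def)

lemma prod_simps [simp]:
  "upair a b \<in> Obj (A \<otimes> B) \<longleftrightarrow> a \<in> Obj A \<and> b \<in> Obj B"
  "upair f g \<in> Arr (A \<otimes> B) \<longleftrightarrow> f \<in> Arr A \<and> g \<in> Arr B"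
  "f \<in> Arr A \<Longrightarrow> g \<in> Arr B \<Longrightarrow> Dom (A \<otimes> B) (upair f g) = upair (Dom A f) (Dom B g)"
  "f \<in> Arr A \<Longrightarrow> g \<in> Arr B \<Longrightarrow> Cod (A \<otimes> B) (upair f g) = upair (Cod A f) (Cod B g)"
  "a \<in> Obj A \<Longrightarrow> b \<in> Obj B \<Longrightarrow> Idn (A \<otimes> B) (upair a b) = upair (Idn A a) (Idn B b)"
  "f \<in> Arr A \<Longrightarrow> g \<in> Arr B \<Longrightarrow> f' \<in> Arr A \<Longrightarrow> g' \<in> Arr B \<Longrightarrow> Cod A f = Dom A f' \<Longrightarrow>
    Cod B g = Dom B g' \<Longrightarrow> Cmp (A \<otimes> B) (upair f' g') (upair f g) = upair (Cmp A f' f) (Cmp B g' g)"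
  by (auto simp: cat_prod_def Let_def composable_def)

lemma prod_cases:
  "x \<in> Obj (A \<otimes> B) \<longleftrightarrow> (\<exists>a b. x = upair a b \<and> a \<in> Obj A \<and> b \<in> Obj B)"
  "h \<in> Arr (A \<otimes> B) \<longleftrightarrow> (\<exists>f g. h = upair f g \<and> f \<in> Arr A \<and> g \<in> Arr B)"
  by (auto simp: cat_prod_def Let_def)

lemma prod_hom_cases:
  assumes "h \<in> Hom (A \<otimes> B) x y"
  obtains f g where "h = upair f g" "f \<in> Arr A" "g \<in> Arr B"
    "x = upair (Dom A f) (Dom B g)" "y = upair (Cod A f) (Cod B g)"
proof -
  have "h \<in> Arr (A \<otimes> B)" using assms by (simp add: Hom_def)
  then obtain f g where h: "h = upair f g" "f \<in> Arr A" "g \<in> Arr B"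
    unfolding prod_cases by blast
  then show thesis
    using assms that unfolding h(1) by (auto simp: Hom_def)
qed

lemma category_prod:
  assumes "category A" "category B"
  shows "category (A \<otimes> B)"
proof -
  interpret A: category A by fact
  interpret B: category B by fact
  show ?thesis
  proof
    show "Dom (A \<otimes> B) \<in> extensional (Arr (A \<otimes> B))" "Cod (A \<otimes> B) \<in> extensional (Arr (A \<otimes> B))"
      "Idn (A \<otimes> B) \<in> extensional (Obj (A \<otimes> B))"
      by (simp_all add: cat_prod_def Let_def)
    show "Cmp (A \<otimes> B) k h = undefined" if "\<not> composable (A \<otimes> B) k h" for k h
    proof (rule ccontr)
      assume "Cmp (A \<otimes> B) k h \<noteq> undefined"
      then have "h \<in> Arr (A \<otimes> B)" "k \<in> Arr (A \<otimes> B)"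
        "composable A (ufst k) (ufst h) \<and> composable B (usnd k) (usnd h)"
        by (auto simp: cat_prod_def Let_def split: if_splits)
      then have "composable (A \<otimes> B) k h"
        by (auto simp: prod_cases composable_def)
      then show False using that by simp
    qed
  qed (auto simp: prod_cases Hom_def A.cmp_assoc B.cmp_assoc)
qed

lemma small_cat_prod:
  assumes "small_cat A" "small_cat B"
  shows "small_cat (A \<otimes> B)"
proof -
  have "small_set (Obj (A \<otimes> B))" "small_set (Arr (A \<otimes> B))"
    using small_set_upair[of "Obj A" "Obj B"] small_set_upair[of "Arr A" "Arr B"] assms
    by (auto simp: small_cat_def cat_prod_def Let_def)
  then show ?thesis using category_prod assms by (auto simp: small_cat_def)
qed

lemma unat_eq_iff [simp]: "unat i = unat j \<longleftrightarrow> i = j"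
  using inj_unat by (auto dest: injD)

lemma simplex_simps [simp]:
  "unat i \<in> Obj (simplex n) \<longleftrightarrow> i \<le> n"
  "upair (unat i) (unat j) \<in> Arr (simplex n) \<longleftrightarrow> i \<le> j \<and> j \<le> n"
  "i \<le> j \<Longrightarrow> j \<le> n \<Longrightarrow> Dom (simplex n) (upair (unat i) (unat j)) = unat i"
  "i \<le> j \<Longrightarrow> j \<le> n \<Longrightarrow> Cod (simplex n) (upair (unat i) (unat j)) = unat j"
  "i \<le> n \<Longrightarrow> Idn (simplex n) (unat i) = upair (unat i) (unat i)"
  "i \<le> j \<Longrightarrow> j \<le> k \<Longrightarrow> k \<le> n \<Longrightarrow>
    Cmp (simplex n) (upair (unat j) (unat k)) (upair (unat i) (unat j)) = upair (unat i) (unat k)"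
  by (auto simp: simplex_def Let_def)

lemma simplex_cases:
  "x \<in> Obj (simplex n) \<longleftrightarrow> (\<exists>i. x = unat i \<and> i \<le> n)"
  "h \<in> Arr (simplex n) \<longleftrightarrow> (\<exists>i j. h = upair (unat i) (unat j) \<and> i \<le> j \<and> j \<le> n)"
  by (auto simp: simplex_def Let_def)

lemma small_cat_simplex: "small_cat (simplex n)"
proof -
  have "category (simplex n :: 'a scat)"
  proof
    show "Cmp (simplex n) g f = undefined" if "\<not> composable (simplex n) g f" for g f :: 'a
    proof (rule ccontr)
      assume "Cmp (simplex n) g f \<noteq> undefined"
      then have "f \<in> Arr (simplex n)" "g \<in> Arr (simplex n)" "usnd f = ufst g"
        by (auto simp: simplex_def Let_def split: if_splits)
      then have "composable (simplex n) g f"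
        by (auto simp: simplex_cases composable_def)
      then show False using that by simp
    qed
    show "Dom (simplex n) \<in> extensional (Arr (simplex n :: 'a scat))"
      "Cod (simplex n) \<in> extensional (Arr (simplex n :: 'a scat))"
      "Idn (simplex n) \<in> extensional (Obj (simplex n :: 'a scat))"
      by (simp_all add: simplex_def Let_def)
  qed (auto simp: simplex_cases Hom_def)
  moreover have "finite (Obj (simplex n :: 'a scat))" by (simp add: simplex_def Let_def)
  moreover have "Arr (simplex n :: 'a scat) \<subseteq> (\<lambda>(i, j). upair (unat i) (unat j)) ` ({..n} \<times> {..n})"
    by (auto simp: simplex_cases image_iff)
  ultimately show ?thesis
    using small_set_finite finite_subset[of "Arr (simplex n :: 'a scat)"]
    by (auto simp: small_cat_def)
qed

lemma small_cat_one: "small_cat one" and small_cat_square: "small_cat square"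
  by (simp_all add: one_def square_def small_cat_simplex small_cat_prod)

lemma one_simps [simp]:
  "Obj one = {unat 0}" "Arr one = {upair (unat 0) (unat 0)}"
  "Dom one (upair (unat 0) (unat 0)) = unat 0" "Cod one (upair (unat 0) (unat 0)) = unat 0"
  "Idn one (unat 0) = upair (unat 0) (unat 0)"
  "Cmp one (upair (unat 0) (unat 0)) (upair (unat 0) (unat 0)) = upair (unat 0) (unat 0)"
  using category.idn_simps[OF category_small[OF small_cat_one]]
  by (auto simp: one_def simplex_cases)

lemma small_cat_full_subcat:
  assumes "small_cat C"
  shows "small_cat (full_subcat C S)"
proof -
  interpret category C using assms by (rule category_small)
  have "category (full_subcat C S)"
    by unfold_locales (auto simp: full_subcat_def Let_def Hom_def composable_def cmp_assoc)
  moreover have "small_set (Obj C)" "small_set (Arr C)"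
    using assms by (auto simp: small_cat_def)
  then have "small_set (Obj (full_subcat C S))" "small_set (Arr (full_subcat C S))"
    by (elim small_set_subset, force simp: full_subcat_def Let_def)+
  ultimately show ?thesis
    by (simp add: small_cat_def)
qed

lemma small_ftr_full_subcat_incl:
  assumes "small_cat C"
  shows "small_ftr (full_subcat_incl C S) (full_subcat C S) C"
proof -
  interpret category C using assms by (rule category_small)
  show ?thesis
    using assms small_cat_full_subcat[OF assms, of S]
    by (auto simp: small_ftr_def small_cat_def functor_between_def is_functor_def full_subcat_incl_def
        full_subcat_def Let_def Hom_def composable_def)
qed

lemma small_cat_ulcorner: "small_cat ulcorner"
  by (simp add: ulcorner_def small_cat_full_subcat small_cat_square)

lemma small_ftr_ulcorner_incl: "small_ftr ulcorner_incl ulcorner square"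
  unfolding ulcorner_def ulcorner_incl_def by (rule small_ftr_full_subcat_incl[OF small_cat_square])

lemma small_cat_empty: "small_cat (empty_cat :: 'u::universe scat)"
  by (auto simp: small_cat_def category_def empty_cat_def small_set_finite composable_def Hom_def)

lemma small_ftr_to_one:
  assumes "small_cat A"
  shows "small_ftr (to_one A) A one"
proof -
  interpret category A using assms by (rule category_small)
  show ?thesis
    using assms small_cat_one
    by (auto simp: small_ftr_def small_cat_def functor_between_def is_functor_def to_one_def Hom_def)
qed

lemma small_ftr_point:
  assumes "small_cat A" "a \<in> Obj A"
  shows "small_ftr (point A a) one A"
proof -
  interpret category A using assms(1) by (rule category_small)
  show ?thesis
    using assms small_cat_one
    by (auto simp: small_ftr_def small_cat_def functor_between_def is_functor_def point_def Hom_def)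
qed

text \<open>A functor on a product need only be examined on pairs.\<close>

lemma small_ftr_from_prodI:
  assumes A: "small_cat A" and B: "small_cat B" and E: "small_cat E"
    and sel: "Src F = A \<otimes> B" "Tgt F = E"
    and ext: "FO F \<in> extensional (Obj (A \<otimes> B))" "FA F \<in> extensional (Arr (A \<otimes> B))"
    and obj: "\<And>a b. a \<in> Obj A \<Longrightarrow> b \<in> Obj B \<Longrightarrow> FO F (upair a b) \<in> Obj E"
    and idn: "\<And>a b. a \<in> Obj A \<Longrightarrow> b \<in> Obj B \<Longrightarrow>
      FA F (upair (Idn A a) (Idn B b)) = Idn E (FO F (upair a b))"
    and hom: "\<And>f g. f \<in> Arr A \<Longrightarrow> g \<in> Arr B \<Longrightarrow> FA F (upair f g)
      \<in> Hom E (FO F (upair (Dom A f) (Dom B g))) (FO F (upair (Cod A f) (Cod B g)))"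
    and cmp: "\<And>f g f' g'. f \<in> Arr A \<Longrightarrow> f' \<in> Arr A \<Longrightarrow> Cod A f = Dom A f' \<Longrightarrow>
      g \<in> Arr B \<Longrightarrow> g' \<in> Arr B \<Longrightarrow> Cod B g = Dom B g' \<Longrightarrow>
      FA F (upair (Cmp A f' f) (Cmp B g' g)) = Cmp E (FA F (upair f' g')) (FA F (upair f g))"
  shows "small_ftr F (A \<otimes> B) E"
proof (rule small_ftrI[OF small_cat_prod[OF A B] E sel ext])
  fix x assume "x \<in> Obj (A \<otimes> B)"
  then show "FO F x \<in> Obj E" "FA F (Idn (A \<otimes> B) x) = Idn E (FO F x)"
    using obj idn by (auto simp: prod_cases(1))
next
  fix f x y assume f: "f \<in> Hom (A \<otimes> B) x y"
  obtain f1 f2 where f': "f = upair f1 f2" "f1 \<in> Arr A" "f2 \<in> Arr B"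
    "x = upair (Dom A f1) (Dom B f2)" "y = upair (Cod A f1) (Cod B f2)"
    by (rule prod_hom_cases[OF f])
  show "FA F f \<in> Hom E (FO F x) (FO F y)"
    unfolding f'(1,4,5) using hom f'(2,3) by simp
  fix g z assume g: "g \<in> Hom (A \<otimes> B) y z"
  obtain g1 g2 where g': "g = upair g1 g2" "g1 \<in> Arr A" "g2 \<in> Arr B"
    "y = upair (Dom A g1) (Dom B g2)" "z = upair (Cod A g1) (Cod B g2)"
    by (rule prod_hom_cases[OF g])
  have c: "Cod A f1 = Dom A g1" "Cod B f2 = Dom B g2" using f'(5) g'(4) by simp_all
  show "FA F (Cmp (A \<otimes> B) g f) = Cmp E (FA F g) (FA F f)"
    unfolding f'(1) g'(1) using cmp[OF f'(2) g'(2) c(1) f'(3) g'(3) c(2)] f' g' c by simp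
qed

lemma small_ftr_prod:
  assumes u: "small_ftr u A B" and v: "small_ftr v C D"
  shows "small_ftr (ftr_prod u v) (A \<otimes> C) (B \<otimes> D)"
proof -
  note [simp] = small_ftr_simps[OF u] small_ftr_simps[OF v]
  interpret A: category A using u by (simp add: small_ftr_def category_small)
  interpret C: category C using v by (simp add: small_ftr_def category_small)
  show ?thesis
  proof (rule small_ftr_from_prodI)
    show "small_cat A" "small_cat C" "small_cat (B \<otimes> D)"
      using u v by (simp_all add: small_ftr_def small_cat_prod)
  qed (simp_all add: ftr_prod_def Hom_def)
qed

lemma ftr_prod_sel [simp]:
  "x \<in> Obj (Src u) \<Longrightarrow> y \<in> Obj (Src v) \<Longrightarrow> FO (ftr_prod u v) (upair x y) = upair (FO u x) (FO v y)"
  "f \<in> Arr (Src u) \<Longrightarrow> g \<in> Arr (Src v) \<Longrightarrow> FA (ftr_prod u v) (upair f g) = upair (FA u f) (FA v g)"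
  by (auto simp: ftr_prod_def)

lemma point_sel [simp]:
  "FO (point A a) (unat 0) = a" "FA (point A a) (upair (unat 0) (unat 0)) = Idn A a"
  "Src (point A a) = one" "Tgt (point A a) = A"
  by (auto simp: point_def)

lemma to_one_sel [simp]:
  "x \<in> Obj A \<Longrightarrow> FO (to_one A) x = unat 0" "f \<in> Arr A \<Longrightarrow> FA (to_one A) f = upair (unat 0) (unat 0)"
  "Src (to_one A) = A" "Tgt (to_one A) = one"
  by (auto simp: to_one_def)

lemma small_ftr_prod_fst:
  assumes "small_cat A" "small_cat B"
  shows "small_ftr (prod_fst A B) (A \<otimes> B) A"
proof -
  interpret A: category A using assms by (simp add: category_small)
  interpret B: category B using assms by (simp add: category_small)
  show ?thesis
    using assms by (intro small_ftr_from_prodI) (simp_all add: prod_fst_def Hom_def)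
qed

lemma small_ftr_slice_at:
  assumes "small_cat A" "small_cat B" "b \<in> Obj B"
  shows "small_ftr (slice_at A B b) A (A \<otimes> B)"
proof -
  interpret A: category A using assms by (simp add: category_small)
  interpret B: category B using assms by (simp add: category_small)
  show ?thesis
    using assms small_cat_prod[OF assms(1,2)]
    by (auto simp: small_ftr_def functor_between_def is_functor_def slice_at_def Hom_def prod_cases
        category_small)
qed

definition prod_snd :: "'u::universe scat \<Rightarrow> 'u scat \<Rightarrow> 'u sftr" where
  "prod_snd A B = \<lparr>Src = A \<otimes> B, Tgt = B,
    FO = (\<lambda>x \<in> Obj (A \<otimes> B). usnd x), FA = (\<lambda>h \<in> Arr (A \<otimes> B). usnd h)\<rparr>"

definition slice_snd :: "'u::universe scat \<Rightarrow> 'u scat \<Rightarrow> 'u \<Rightarrow> 'u sftr" where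
  "slice_snd A B a = \<lparr>Src = B, Tgt = A \<otimes> B,
    FO = (\<lambda>b \<in> Obj B. upair a b), FA = (\<lambda>g \<in> Arr B. upair (Idn A a) g)\<rparr>"

lemma prod_snd_sel [simp]:
  "a \<in> Obj A \<Longrightarrow> b \<in> Obj B \<Longrightarrow> FO (prod_snd A B) (upair a b) = b"
  "f \<in> Arr A \<Longrightarrow> g \<in> Arr B \<Longrightarrow> FA (prod_snd A B) (upair f g) = g"
  "b \<in> Obj B \<Longrightarrow> FO (slice_snd A B a) b = upair a b"
  "g \<in> Arr B \<Longrightarrow> FA (slice_snd A B a) g = upair (Idn A a) g"
  by (auto simp: prod_snd_def slice_snd_def)

lemma small_ftr_prod_snd:
  assumes "small_cat A" "small_cat B"
  shows "small_ftr (prod_snd A B) (A \<otimes> B) B"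
proof -
  interpret A: category A using assms by (simp add: category_small)
  interpret B: category B using assms by (simp add: category_small)
  show ?thesis
    using assms by (intro small_ftr_from_prodI) (simp_all add: prod_snd_def Hom_def)
qed

lemma small_ftr_slice_snd:
  assumes "small_cat A" "small_cat B" "a \<in> Obj A"
  shows "small_ftr (slice_snd A B a) B (A \<otimes> B)"
proof -
  interpret A: category A using assms by (simp add: category_small)
  interpret B: category B using assms by (simp add: category_small)
  show ?thesis
    using assms small_cat_prod[OF assms(1,2)]
    by (auto simp: small_ftr_def functor_between_def is_functor_def slice_snd_def Hom_def prod_cases
        category_small)
qed

section \<open>Comma categories\<close>

lemma comma_objs_iff:
  "upair a (upair b f) \<in> comma_objs u v \<longleftrightarrow>
    a \<in> Obj (Src u) \<and> b \<in> Obj (Src v) \<and> f \<in> Hom (Tgt u) (FO u a) (FO v b)"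
  by (auto simp: comma_objs_def)

lemma comma_arrs_iff:
  "upair (upair (upair a (upair b f)) (upair a' (upair b' f'))) (upair h k) \<in> comma_arrs u v \<longleftrightarrow>
    upair a (upair b f) \<in> comma_objs u v \<and> upair a' (upair b' f') \<in> comma_objs u v \<and>
    h \<in> Hom (Src u) a a' \<and> k \<in> Hom (Src v) b b' \<and>
    Cmp (Tgt u) f' (FA u h) = Cmp (Tgt u) (FA v k) f"
  by (auto simp: comma_arrs_def)

lemma comma_arrs_cases:
  "w \<in> comma_arrs u v \<longleftrightarrow> (\<exists>a b f a' b' f' h k.
    w = upair (upair (upair a (upair b f)) (upair a' (upair b' f'))) (upair h k) \<and>
    upair a (upair b f) \<in> comma_objs u v \<and> upair a' (upair b' f') \<in> comma_objs u v \<and>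
    h \<in> Hom (Src u) a a' \<and> k \<in> Hom (Src v) b b' \<and>
    Cmp (Tgt u) f' (FA u h) = Cmp (Tgt u) (FA v k) f)"
  by (auto simp: comma_arrs_def)

lemma comma_objs_cases:
  "x \<in> comma_objs u v \<longleftrightarrow> (\<exists>a b f. x = upair a (upair b f) \<and>
    a \<in> Obj (Src u) \<and> b \<in> Obj (Src v) \<and> f \<in> Hom (Tgt u) (FO u a) (FO v b))"
  by (auto simp: comma_objs_def)

lemma comma_simps [simp]:
  "Obj (comma u v) = comma_objs u v" "Arr (comma u v) = comma_arrs u v"
  "upair (upair x y) (upair h k) \<in> comma_arrs u v \<Longrightarrow>
    Dom (comma u v) (upair (upair x y) (upair h k)) = x"
  "upair (upair x y) (upair h k) \<in> comma_arrs u v \<Longrightarrow>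
    Cod (comma u v) (upair (upair x y) (upair h k)) = y"
  "upair a (upair b f) \<in> comma_objs u v \<Longrightarrow> Idn (comma u v) (upair a (upair b f)) =
    upair (upair (upair a (upair b f)) (upair a (upair b f))) (upair (Idn (Src u) a) (Idn (Src v) b))"
  "upair (upair x y) (upair h k) \<in> comma_arrs u v \<Longrightarrow>
    upair (upair y z) (upair h' k') \<in> comma_arrs u v \<Longrightarrow>
    Cmp (comma u v) (upair (upair y z) (upair h' k')) (upair (upair x y) (upair h k)) =
    upair (upair x z) (upair (Cmp (Src u) h' h) (Cmp (Src v) k' k))"
  by (auto simp: comma_def Let_def)

context
  fixes u v :: "'u::universe sftr" and A B C :: "'u scat"
  assumes u: "small_ftr u A C" and v: "small_ftr v B C"
begin

interpretation A: category A using u by (simp add: small_ftr_def category_small)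
interpretation B: category B using v by (simp add: small_ftr_def category_small)
interpretation C: category C using u by (simp add: small_ftr_def category_small)

lemma comma_hom_form:
  assumes "f \<in> Hom (comma u v) x y"
  shows "\<exists>h k. f = upair (upair x y) (upair h k) \<and> h \<in> Hom A (ufst x) (ufst y)
    \<and> k \<in> Hom B (ufst (usnd x)) (ufst (usnd y)) \<and> upair (upair x y) (upair h k) \<in> comma_arrs u v"
  using assms small_ftr_simps(1,2)[OF u] small_ftr_simps(1,2)[OF v]
  by (auto simp: Hom_def comma_def Let_def comma_arrs_cases)

lemma comma_idn_arr:
  assumes "upair a (upair b f) \<in> comma_objs u v"
  shows "upair (upair (upair a (upair b f)) (upair a (upair b f)))
    (upair (Idn A a) (Idn B b)) \<in> comma_arrs u v"
  using assms small_ftr_simps[OF u] small_ftr_simps[OF v]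
  by (simp add: comma_arrs_iff comma_objs_iff Hom_def)

lemma comma_cmp_arr:
  assumes w: "upair (upair x y) (upair h k) \<in> comma_arrs u v"
    and z: "upair (upair y z) (upair h' k') \<in> comma_arrs u v"
  shows "upair (upair x z) (upair (Cmp A h' h) (Cmp B k' k)) \<in> comma_arrs u v"
proof -
  note [simp] = small_ftr_simps[OF u] small_ftr_simps[OF v]
  obtain a b f a' b' f' where xy: "x = upair a (upair b f)" "y = upair a' (upair b' f')"
    and 1: "upair a (upair b f) \<in> comma_objs u v" "upair a' (upair b' f') \<in> comma_objs u v"
      "h \<in> Hom A a a'" "k \<in> Hom B b b'" "Cmp C f' (FA u h) = Cmp C (FA v k) f"
    using w by (auto simp: comma_arrs_cases)
  obtain a'' b'' f'' where z': "z = upair a'' (upair b'' f'')"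
    and 2: "upair a'' (upair b'' f'') \<in> comma_objs u v"
      "h' \<in> Hom A a' a''" "k' \<in> Hom B b' b''" "Cmp C f'' (FA u h') = Cmp C (FA v k') f'"
    using z xy by (auto simp: comma_arrs_cases)
  have [simp]: "f \<in> Arr C" "Dom C f = FO u a" "Cod C f = FO v b"
    "f' \<in> Arr C" "Dom C f' = FO u a'" "Cod C f' = FO v b'"
    "f'' \<in> Arr C" "Dom C f'' = FO u a''" "Cod C f'' = FO v b''"
    "h \<in> Arr A" "Dom A h = a" "Cod A h = a'" "h' \<in> Arr A" "Dom A h' = a'" "Cod A h' = a''"
    "k \<in> Arr B" "Dom B k = b" "Cod B k = b'" "k' \<in> Arr B" "Dom B k' = b'" "Cod B k' = b''"
    using 1 2 by (auto simp: comma_objs_iff Hom_def)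
  have "Cmp C f'' (Cmp C (FA u h') (FA u h)) = Cmp C (Cmp C f'' (FA u h')) (FA u h)"
    by (simp add: C.cmp_assoc)
  also have "\<dots> = Cmp C (FA v k') (Cmp C f' (FA u h))"
    unfolding 2(4) by (simp add: C.cmp_assoc)
  also have "\<dots> = Cmp C (Cmp C (FA v k') (FA v k)) f"
    unfolding 1(5) by (simp add: C.cmp_assoc)
  finally show ?thesis
    unfolding xy z' using 1 2 by (simp add: comma_arrs_iff Hom_def)
qed

lemma category_comma: "category (comma u v)"
proof
  note [simp] = small_ftr_simps[OF u] small_ftr_simps[OF v]
  show "Cmp (comma u v) g f = undefined" if "\<not> composable (comma u v) g f" for g f
    using that by (auto simp: comma_def Let_def composable_def)
  show "Dom (comma u v) \<in> extensional (Arr (comma u v))" "Cod (comma u v) \<in> extensional (Arr (comma u v))"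
    "Idn (comma u v) \<in> extensional (Obj (comma u v))"
    by (simp_all add: comma_def Let_def)
  show "Dom (comma u v) f \<in> Obj (comma u v)" "Cod (comma u v) f \<in> Obj (comma u v)"
    if "f \<in> Arr (comma u v)" for f
    using that by (auto simp: comma_def Let_def comma_arrs_cases)
  show "Idn (comma u v) x \<in> Hom (comma u v) x x" if "x \<in> Obj (comma u v)" for x
    using that comma_idn_arr by (auto simp: Hom_def comma_objs_cases comma_objs_iff)
next
  note [simp] = small_ftr_simps(1,2)[OF u] small_ftr_simps(1,2)[OF v]
  have obj: "x \<in> comma_objs u v" "y \<in> comma_objs u v" if "f \<in> Hom (comma u v) x y" for f x y
    using that by (auto simp: Hom_def comma_def Let_def comma_arrs_cases)
  fix f w x assume f: "f \<in> Hom (comma u v) w x"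
  obtain h k where f': "f = upair (upair w x) (upair h k)" "h \<in> Hom A (ufst w) (ufst x)"
      "k \<in> Hom B (ufst (usnd w)) (ufst (usnd x))" "upair (upair w x) (upair h k) \<in> comma_arrs u v"
    using comma_hom_form[OF f] by blast
  show "Cmp (comma u v) f (Idn (comma u v) w) = f" "Cmp (comma u v) (Idn (comma u v) x) f = f"
    using obj[OF f] f' comma_idn_arr by (auto simp: comma_objs_cases comma_objs_iff Hom_def)
  fix g y assume g: "g \<in> Hom (comma u v) x y"
  obtain h' k' where g': "g = upair (upair x y) (upair h' k')" "h' \<in> Hom A (ufst x) (ufst y)"
      "k' \<in> Hom B (ufst (usnd x)) (ufst (usnd y))" "upair (upair x y) (upair h' k') \<in> comma_arrs u v"
    using comma_hom_form[OF g] by blast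
  note gf = comma_cmp_arr[OF f'(4) g'(4)]
  show "Cmp (comma u v) g f \<in> Hom (comma u v) w y"
    using f' g' gf by (simp add: Hom_def)
  fix e z assume e: "e \<in> Hom (comma u v) y z"
  obtain h'' k'' where e': "e = upair (upair y z) (upair h'' k'')" "h'' \<in> Hom A (ufst y) (ufst z)"
      "k'' \<in> Hom B (ufst (usnd y)) (ufst (usnd z))" "upair (upair y z) (upair h'' k'') \<in> comma_arrs u v"
    using comma_hom_form[OF e] by blast
  note eg = comma_cmp_arr[OF g'(4) e'(4)]
  show "Cmp (comma u v) e (Cmp (comma u v) g f) = Cmp (comma u v) (Cmp (comma u v) e g) f"
    using f' g' e' gf eg by (simp add: Hom_def A.cmp_assoc B.cmp_assoc)
qed

lemma small_cat_comma: "small_cat (comma u v)"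
proof -
  have s: "small_set (Obj A)" "small_set (Arr A)" "small_set (Obj B)" "small_set (Arr B)" "small_set (Arr C)"
    using u v by (auto simp: small_ftr_def small_cat_def)
  let ?P = "\<lambda>S T. {upair x y | x y. x \<in> S \<and> y \<in> T}"
  have o: "small_set (comma_objs u v)"
    by (rule small_set_subset[OF small_set_upair[OF s(1) small_set_upair[OF s(3,5)]]])
      (use small_ftrD(2,3)[OF u] small_ftrD(2)[OF v] in \<open>auto simp: comma_objs_cases Hom_def\<close>)
  have "small_set (comma_arrs u v)"
    by (rule small_set_subset[OF small_set_upair[OF small_set_upair[OF o o] small_set_upair[OF s(2,4)]]])
      (use small_ftrD(2,3)[OF u] small_ftrD(2)[OF v] in \<open>auto simp: comma_arrs_cases Hom_def\<close>)
  then show ?thesis using o category_comma by (simp add: small_cat_def)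
qed

lemma small_ftr_comma: "small_ftr (comma_fst u v) (comma u v) A" "small_ftr (comma_snd u v) (comma u v) B"
proof -
  note [simp] = small_ftr_simps(1,2)[OF u] small_ftr_simps(1,2)[OF v]
  have cmp: "Cmp (comma u v) g f \<in> comma_arrs u v"
      "usnd (Cmp (comma u v) g f) = upair (Cmp A (ufst (usnd g)) (ufst (usnd f))) (Cmp B (usnd (usnd g)) (usnd (usnd f)))"
    if "f \<in> Hom (comma u v) x y" "g \<in> Hom (comma u v) y z" for f g x y z
    using comma_hom_form[OF that(1)] comma_hom_form[OF that(2)] comma_cmp_arr by (auto simp: Hom_def)
  show "small_ftr (comma_fst u v) (comma u v) A"
  proof (rule small_ftrI[OF small_cat_comma small_ftrD(5)[OF u]])
    show "FA (comma_fst u v) f \<in> Hom A (FO (comma_fst u v) a) (FO (comma_fst u v) b)"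
      if "f \<in> Hom (comma u v) a b" for f a b
      using comma_hom_form[OF that] that by (auto simp: comma_fst_def comma_arrs_cases)
    show "FA (comma_fst u v) (Cmp (comma u v) g f)
      = Cmp A (FA (comma_fst u v) g) (FA (comma_fst u v) f)"
      if "f \<in> Hom (comma u v) a b" "g \<in> Hom (comma u v) b c" for f g a b c
      using cmp[OF that] that by (simp add: comma_fst_def Hom_def)
  qed (auto simp: comma_fst_def comma_objs_cases comma_objs_iff comma_idn_arr)
  show "small_ftr (comma_snd u v) (comma u v) B"
  proof (rule small_ftrI[OF small_cat_comma small_ftrD(5)[OF v]])
    show "FA (comma_snd u v) f \<in> Hom B (FO (comma_snd u v) a) (FO (comma_snd u v) b)"
      if "f \<in> Hom (comma u v) a b" for f a b
      using comma_hom_form[OF that] that by (auto simp: comma_snd_def comma_arrs_cases)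
    show "FA (comma_snd u v) (Cmp (comma u v) g f)
      = Cmp B (FA (comma_snd u v) g) (FA (comma_snd u v) f)"
      if "f \<in> Hom (comma u v) a b" "g \<in> Hom (comma u v) b c" for f g a b c
      using cmp[OF that] that by (simp add: comma_snd_def Hom_def)
  qed (auto simp: comma_snd_def comma_objs_cases comma_objs_iff comma_idn_arr)
qed

lemma small_nt_comma:
  "small_nt_between (comma_nt u v) (u \<odot> comma_fst u v) (v \<odot> comma_snd u v) (comma u v) C"
proof (rule small_nt_betweenI)
  note [simp] = small_ftr_simps(1,2)[OF u] small_ftr_simps(1,2)[OF v]
  show "small_ftr (u \<odot> comma_fst u v) (comma u v) C" "small_ftr (v \<odot> comma_snd u v) (comma u v) C"
    using small_ftr_fcomp small_ftr_comma u v by blast+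
  show "At (comma_nt u v) x \<in> Hom C (FO (u \<odot> comma_fst u v) x) (FO (v \<odot> comma_snd u v) x)"
    if "x \<in> Obj (comma u v)" for x
    using that by (auto simp: comma_nt_def comma_objs_cases comma_fst_def comma_snd_def)
  fix f x y assume f: "f \<in> Hom (comma u v) x y"
  then have "f \<in> comma_arrs u v" by (simp add: Hom_def)
  then obtain a b g a' b' g' h k where
    w: "f = upair (upair (upair a (upair b g)) (upair a' (upair b' g'))) (upair h k)"
    "upair a (upair b g) \<in> comma_objs u v" "upair a' (upair b' g') \<in> comma_objs u v"
    "Cmp C g' (FA u h) = Cmp C (FA v k) g"
    by (auto simp: comma_arrs_cases)
  have fw: "f \<in> comma_arrs u v" and xy: "x = upair a (upair b g)" "y = upair a' (upair b' g')"
    using f unfolding w(1) by (auto simp: Hom_def)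
  show "Cmp C (At (comma_nt u v) y) (FA (u \<odot> comma_fst u v) f)
    = Cmp C (FA (v \<odot> comma_snd u v) f) (At (comma_nt u v) x)"
    using fw w xy by (simp add: comma_nt_def comma_fst_def comma_snd_def)
qed (simp_all add: comma_nt_def)

end

section \<open>Left Kan extensions computed over reflective subcategories of slices\<close>

lemma functor_to_one_unique:
  assumes F: "functor_between F A one" and G: "functor_between G A one"
  shows "F = G"
proof (rule functor_eqI[OF F G])
  show "FO F x = FO G x" if "x \<in> Obj A" for x
    using functor_simps(3)[OF F that] functor_simps(3)[OF G that] by simp
  show "FA F f = FA G f" if "f \<in> Arr A" for f
    using functor_simps(4)[OF F that] functor_simps(4)[OF G that] by simp
qed

text \<open>A criterion for computing a left Kan extension along \<open>u\<close> at \<open>c\<close> by a colimit over \<open>J\<close>: the functor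
  \<open>j \<mapsto> (p j, \<phi> j)\<close> embeds \<open>J\<close> into the slice \<open>u/c\<close> as a reflective subcategory, with reflector
  \<open>(x, f) \<mapsto> P x\<close> and unit \<open>\<theta> x f : x \<rightarrow> p (P x)\<close>.  The conditions are stated in \<open>B\<close> and \<open>C\<close>, without
  reference to the encoding of the slice.\<close>

locale slice_retract =
  fixes u p P :: "'u::universe sftr" and \<phi> :: "'u snt" and c :: 'u and J B C :: "'u scat"
    and \<theta> :: "'u \<Rightarrow> 'u \<Rightarrow> 'u"
  assumes u: "small_ftr u B C" and c: "c \<in> Obj C" and p: "small_ftr p J B"
    and P: "small_ftr P B J" and Pp: "P \<odot> p = fid J"
    and \<phi>: "small_nt_between \<phi> (u \<odot> p) (point C c \<odot> to_one J) J C"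
    and \<theta>: "x \<in> Obj B \<Longrightarrow> f \<in> Hom C (FO u x) c \<Longrightarrow> \<theta> x f \<in> Hom B x (FO p (FO P x))"
    and \<phi>\<theta>: "x \<in> Obj B \<Longrightarrow> f \<in> Hom C (FO u x) c \<Longrightarrow> Cmp C (At \<phi> (FO P x)) (FA u (\<theta> x f)) = f"
    and P\<theta>: "x \<in> Obj B \<Longrightarrow> f \<in> Hom C (FO u x) c \<Longrightarrow> FA P (\<theta> x f) = Idn J (FO P x)"
    and \<theta>p: "j \<in> Obj J \<Longrightarrow> \<theta> (FO p j) (At \<phi> j) = Idn B (FO p j)"
    and \<theta>_nat: "h \<in> Hom B x x' \<Longrightarrow> f' \<in> Hom C (FO u x') c \<Longrightarrow>
      Cmp B (\<theta> x' f') h = Cmp B (FA p (FA P h)) (\<theta> x (Cmp C f' (FA u h)))"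
begin

interpretation B: category B using u by (simp add: small_ftr_def category_small)
interpretation C: category C using u by (simp add: small_ftr_def category_small)
interpretation J: category J using p by (simp add: small_ftr_def category_small)

abbreviation "v \<equiv> point C c"
abbreviation "K \<equiv> comma u v"

lemma v: "small_ftr v one C"
  by (rule small_ftr_point[OF small_ftrD(6)[OF u] c])

lemma to_one: "small_ftr (to_one J) J one"
  by (rule small_ftr_to_one[OF small_ftrD(5)[OF p]])

lemmas [simp] = small_ftr_simps[OF u] small_ftr_simps[OF p]
  small_ftr_simps[OF P] c

lemma \<phi>_simps [simp]:
  assumes "j \<in> Obj J"
  shows "At \<phi> j \<in> Arr C" "Dom C (At \<phi> j) = FO u (FO p j)" "Cod C (At \<phi> j) = c"
  using small_nt_simps[OF \<phi>] assms by simp_all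

lemma \<phi>_nat: "k \<in> Arr J \<Longrightarrow> Cmp C (At \<phi> (Cod J k)) (FA u (FA p k)) = At \<phi> (Dom J k)"
  using small_nt_simps(4)[OF \<phi>, of k] by simp

lemma PpO [simp]: "j \<in> Obj J \<Longrightarrow> FO P (FO p j) = j" and PpA [simp]: "k \<in> Arr J \<Longrightarrow> FA P (FA p k) = k"
proof -
  have "FO (P \<odot> p) j = j" if "j \<in> Obj J" using that by (simp add: Pp)
  then show "j \<in> Obj J \<Longrightarrow> FO P (FO p j) = j" by simp
  have "FA (P \<odot> p) k = k" if "k \<in> Arr J" using that by (simp add: Pp)
  then show "k \<in> Arr J \<Longrightarrow> FA P (FA p k) = k" by simp
qed

lemma K_obj: "x \<in> Obj K \<longleftrightarrow> (\<exists>a f. x = upair a (upair (unat 0) f) \<and> a \<in> Obj B \<and> f \<in> Hom C (FO u a) c)"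
  using small_ftrD(2)[OF v] by (auto simp: comma_objs_cases)

lemma K_hom: "w \<in> Hom K (upair a (upair (unat 0) f)) (upair a' (upair (unat 0) f')) \<longleftrightarrow>
    (\<exists>h. w = upair (upair (upair a (upair (unat 0) f)) (upair a' (upair (unat 0) f')))
        (upair h (upair (unat 0) (unat 0))) \<and> h \<in> Hom B a a' \<and>
      f \<in> Hom C (FO u a) c \<and> f' \<in> Hom C (FO u a') c \<and> Cmp C f' (FA u h) = f)"
  (is "?l \<longleftrightarrow> ?r")
proof
  assume w: ?l
  then have "w \<in> comma_arrs u v" by (simp add: Hom_def)
  then show ?r
    using w by (auto simp: comma_arrs_cases comma_arrs_iff comma_objs_iff Hom_def)
next
  assume ?r
  then obtain h where h: "w = upair (upair (upair a (upair (unat 0) f)) (upair a' (upair (unat 0) f')))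
        (upair h (upair (unat 0) (unat 0)))" "h \<in> Hom B a a'"
      "f \<in> Hom C (FO u a) c" "f' \<in> Hom C (FO u a') c" "Cmp C f' (FA u h) = f" by blast
  have "w \<in> comma_arrs u v"
    unfolding h(1) using h(2-5) B.hom_obj[OF h(2)] by (simp add: comma_arrs_iff comma_objs_iff Hom_def)
  then show ?l unfolding h(1) by (simp add: Hom_def)
qed

definition lift_obj :: "'u \<Rightarrow> 'u" where
  "lift_obj j = upair (FO p j) (upair (unat 0) (At \<phi> j))"

text \<open>The inclusion of \<open>J\<close> into the slice; its reflector is \<open>retract\<close> and the unit is \<open>unit\<close> below.\<close>

definition lift :: "'u sftr" where
  "lift = \<lparr>Src = J, Tgt = K, FO = (\<lambda>j \<in> Obj J. lift_obj j),
    FA = (\<lambda>k \<in> Arr J. upair (upair (lift_obj (Dom J k)) (lift_obj (Cod J k)))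
      (upair (FA p k) (upair (unat 0) (unat 0))))\<rparr>"

lemma lift_sel [simp]:
  "Src lift = J" "Tgt lift = K" "j \<in> Obj J \<Longrightarrow> FO lift j = lift_obj j"
  "k \<in> Arr J \<Longrightarrow> FA lift k = upair (upair (lift_obj (Dom J k)) (lift_obj (Cod J k)))
      (upair (FA p k) (upair (unat 0) (unat 0)))"
  by (simp_all add: lift_def)

lemma lift_hom: "k \<in> Arr J \<Longrightarrow> FA lift k \<in> Hom K (lift_obj (Dom J k)) (lift_obj (Cod J k))"
  unfolding lift_obj_def K_hom
  by (rule exI[of _ "FA p k"]) (simp add: lift_obj_def Hom_def \<phi>_nat)

lemma K_category: "category K"
  by (rule category_comma[OF u v])

lemma lift_obj_K: "j \<in> Obj J \<Longrightarrow> lift_obj j \<in> Obj K"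
  unfolding K_obj lift_obj_def by (simp add: Hom_def)

lemma K_idn: "upair a (upair (unat 0) f) \<in> Obj K \<Longrightarrow> Idn K (upair a (upair (unat 0) f)) =
    upair (upair (upair a (upair (unat 0) f)) (upair a (upair (unat 0) f)))
      (upair (Idn B a) (upair (unat 0) (unat 0)))"
  by simp

lemma K_cmp:
  "upair (upair x y) (upair h (upair (unat 0) (unat 0))) \<in> Arr K \<Longrightarrow>
    upair (upair y z) (upair h' (upair (unat 0) (unat 0))) \<in> Arr K \<Longrightarrow>
    Cmp K (upair (upair y z) (upair h' (upair (unat 0) (unat 0))))
      (upair (upair x y) (upair h (upair (unat 0) (unat 0)))) =
    upair (upair x z) (upair (Cmp B h' h) (upair (unat 0) (unat 0)))"
  by simp

lemma lift_arr: "k \<in> Arr J \<Longrightarrow> FA lift k \<in> Arr K"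
  using lift_hom[of k] unfolding Hom_def by blast

lemma small_ftr_lift: "small_ftr lift J K"
proof (rule small_ftrI[OF small_ftrD(5)[OF p] small_cat_comma[OF u v]])
  show "FA lift (Idn J j) = Idn K (FO lift j)" if "j \<in> Obj J" for j
    using that lift_obj_K[OF that] K_idn[of "FO p j" "At \<phi> j"] by (simp add: lift_obj_def)
  fix k i j assume k: "k \<in> Hom J i j"
  then have k': "k \<in> Arr J" "Dom J k = i" "Cod J k = j" "i \<in> Obj J" "j \<in> Obj J"
    using J.hom_obj by (auto simp: Hom_def)
  then show "FA lift k \<in> Hom K (FO lift i) (FO lift j)"
    using lift_hom[of k] by simp
  fix k2 l assume k2: "k2 \<in> Hom J j l"
  then have k2': "k2 \<in> Arr J" "Dom J k2 = j" "Cod J k2 = l" by (auto simp: Hom_def)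
  show "FA lift (Cmp J k2 k) = Cmp K (FA lift k2) (FA lift k)"
    using k' k2' lift_arr[of k] lift_arr[of k2] by simp
qed (use lift_obj_K in \<open>simp_all add: lift_def\<close>)

lemma comma_fst_sel [simp]:
  "Src (comma_fst u v) = K" "Tgt (comma_fst u v) = B"
  "x \<in> Obj K \<Longrightarrow> FO (comma_fst u v) x = ufst x" "w \<in> Arr K \<Longrightarrow> FA (comma_fst u v) w = ufst (usnd w)"
  by (simp_all add: comma_fst_def)

lemma fst_lift: "comma_fst u v \<odot> lift = p"
proof (rule functor_eqI)
  show "functor_between (comma_fst u v \<odot> lift) J B"
    using functor_fcomp small_ftrD(4) small_ftr_lift small_ftr_comma(1)[OF u v] by blast
  show "functor_between p J B" by (rule small_ftrD(4)[OF p])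
  show "FO (comma_fst u v \<odot> lift) x = FO p x" if "x \<in> Obj J" for x
    using that lift_obj_K[OF that] by (simp add: lift_obj_def)
  show "FA (comma_fst u v \<odot> lift) k = FA p k" if "k \<in> Arr J" for k
    using that lift_arr[OF that] by simp
qed

definition retract :: "'u sftr" where
  "retract = P \<odot> comma_fst u v"

lemma small_ftr_retract: "small_ftr retract K J"
  unfolding retract_def using small_ftr_fcomp small_ftr_comma(1)[OF u v] P by blast

lemma retract_sel [simp]:
  "Src retract = K" "Tgt retract = J" "upair a (upair b f) \<in> Obj K \<Longrightarrow> FO retract (upair a (upair b f)) = FO P a"
  "w \<in> Arr K \<Longrightarrow> FA retract w = FA P (ufst (usnd w))"
  by (simp_all add: retract_def)

lemma retract_lift: "retract \<odot> lift = fid J"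
proof -
  have "retract \<odot> lift = P \<odot> (comma_fst u v \<odot> lift)"
    unfolding retract_def
    by (rule fcomp_assoc) (rule small_ftrD(4)[OF small_ftr_lift] small_ftrD(4)[OF small_ftr_comma(1)[OF u v]])+
  then show ?thesis by (simp add: fst_lift Pp)
qed

definition unit_arr :: "'u \<Rightarrow> 'u \<Rightarrow> 'u" where
  "unit_arr a f = upair (upair (upair a (upair (unat 0) f)) (lift_obj (FO P a)))
    (upair (\<theta> a f) (upair (unat 0) (unat 0)))"

definition unit :: "'u snt" where
  "unit = \<lparr>NSrc = fid K, NTgt = lift \<odot> retract,
    At = (\<lambda>x \<in> Obj K. unit_arr (ufst x) (usnd (usnd x)))\<rparr>"

lemma unit_sel [simp]: "NSrc unit = fid K" "NTgt unit = lift \<odot> retract"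
  "upair a (upair b f) \<in> Obj K \<Longrightarrow> At unit (upair a (upair b f)) = unit_arr a f"
  by (simp_all add: unit_def)

lemma unit_hom:
  assumes "a \<in> Obj B" "f \<in> Hom C (FO u a) c"
  shows "unit_arr a f \<in> Hom K (upair a (upair (unat 0) f)) (lift_obj (FO P a))"
  unfolding unit_arr_def lift_obj_def K_hom
  by (rule exI[of _ "\<theta> a f"]) (use assms \<theta> \<phi>\<theta> in \<open>simp add: Hom_def\<close>)

lemma small_nt_unit: "small_nt_between unit (fid K) (lift \<odot> retract) K K"
proof (rule small_nt_betweenI)
  show "small_ftr (fid K) K K" by (rule small_ftr_fid[OF small_cat_comma[OF u v]])
  show "small_ftr (lift \<odot> retract) K K"
    using small_ftr_fcomp small_ftr_lift small_ftr_retract by blast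
  show "At unit \<in> extensional (Obj K)" by (simp add: unit_def)
  show "At unit x \<in> Hom K (FO (fid K) x) (FO (lift \<odot> retract) x)" if xK: "x \<in> Obj K" for x
  proof -
    obtain a f where x: "x = upair a (upair (unat 0) f)" "a \<in> Obj B" "f \<in> Hom C (FO u a) c"
      using xK unfolding K_obj by blast
    show ?thesis
      using unit_hom[OF x(2,3)] xK x(2) unfolding x(1) by (simp del: comma_simps)
  qed
  fix w x y assume w: "w \<in> Hom K x y"
  have xy: "x \<in> Obj K" "y \<in> Obj K" by (rule category.hom_obj[OF K_category w])+
  obtain a f where x: "x = upair a (upair (unat 0) f)" "a \<in> Obj B" "f \<in> Hom C (FO u a) c"
    using xy(1) unfolding K_obj by blast
  obtain a' f' where y: "y = upair a' (upair (unat 0) f')" "a' \<in> Obj B" "f' \<in> Hom C (FO u a') c"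
    using xy(2) unfolding K_obj by blast
  obtain h where h: "w = upair (upair x y) (upair h (upair (unat 0) (unat 0)))" "h \<in> Hom B a a'"
    "Cmp C f' (FA u h) = f"
    using w unfolding x(1) y(1) K_hom by blast
  have h' [simp]: "h \<in> Arr B" "Dom B h = a" "Cod B h = a'" using h(2) by (auto simp: Hom_def)
  have wK: "w \<in> Arr K" using w unfolding Hom_def by blast
  have Pw: "FA P h \<in> Arr J" "Dom J (FA P h) = FO P a" "Cod J (FA P h) = FO P a'" by simp_all
  have ua: "unit_arr a f \<in> Arr K" "unit_arr a' f' \<in> Arr K"
    using unit_hom[OF x(2,3)] unit_hom[OF y(2,3)] unfolding Hom_def by blast+
  have lP: "FA lift (FA P h) \<in> Arr K" by (rule lift_arr[OF Pw(1)])
  have "Cmp K (unit_arr a' f') w = upair (upair x (lift_obj (FO P a')))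
      (upair (Cmp B (\<theta> a' f') h) (upair (unat 0) (unat 0)))"
    using wK ua(2) unfolding h(1) unit_arr_def y(1)[symmetric] by (rule K_cmp)
  also have "Cmp B (\<theta> a' f') h = Cmp B (FA p (FA P h)) (\<theta> a f)"
    using \<theta>_nat[OF h(2) y(3)] h(3) by simp
  also have "upair (upair x (lift_obj (FO P a')))
      (upair (Cmp B (FA p (FA P h)) (\<theta> a f)) (upair (unat 0) (unat 0)))
    = Cmp K (FA lift (FA P h)) (unit_arr a f)"
    unfolding unit_arr_def x(1)[symmetric] lift_sel(4)[OF Pw(1)] Pw
    by (rule K_cmp[symmetric])
      (use ua(1) lP in \<open>simp_all only: unit_arr_def x(1)[symmetric] lift_sel(4)[OF Pw(1)] Pw\<close>)
  finally have eq: "Cmp K (unit_arr a' f') w = Cmp K (FA lift (FA P h)) (unit_arr a f)" .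
  have "At unit y = unit_arr a' f'" "At unit x = unit_arr a f"
    using xy unfolding x(1) y(1) by simp_all
  moreover have "FA (lift \<odot> retract) w = FA lift (FA P h)"
    using wK by (simp add: h(1))
  ultimately show "Cmp K (At unit y) (FA (fid K) w) = Cmp K (FA (lift \<odot> retract) w) (At unit x)"
    using eq wK by (simp del: comma_simps)
qed simp_all

lemma slice_reflection: "reflection lift retract unit J K"
  unfolding reflection_def
proof (intro conjI ballI small_ftr_lift small_ftr_retract retract_lift small_nt_unit)
  fix j assume j: "j \<in> Obj J"
  have "Idn K (lift_obj j) = unit_arr (FO p j) (At \<phi> j)"
    using K_idn[of "FO p j" "At \<phi> j"] lift_obj_K[OF j] \<theta>p[OF j] j
    by (simp add: lift_obj_def unit_arr_def)
  then show "At unit (FO lift j) = Idn K (FO lift j)"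
    using j lift_obj_K[OF j] unit_sel(3)[of "FO p j" "unat 0" "At \<phi> j"]
    by (simp add: lift_obj_def[symmetric])
next
  fix x assume xK: "x \<in> Obj K"
  then obtain a f where x: "x = upair a (upair (unat 0) f)" "a \<in> Obj B" "f \<in> Hom C (FO u a) c"
    unfolding K_obj by blast
  have "unit_arr a f \<in> Arr K" using unit_hom[OF x(2,3)] unfolding Hom_def by blast
  then have "FA retract (unit_arr a f) = Idn J (FO P a)"
    using P\<theta>[OF x(2,3)] by (simp add: unit_arr_def)
  then show "FA retract (At unit x) = Idn J (FO retract x)"
    using xK unfolding x(1) by (simp del: comma_simps)
qed

lemma comma_nt_lift: "comma_nt u v \<triangleleft> lift = \<phi>"
proof (rule nt_ext)
  have l: "functor_between lift J K" by (rule small_ftrD(4)[OF small_ftr_lift])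
  have f: "functor_between (comma_fst u v) K B" and s: "functor_between (comma_snd u v) K one"
    using small_ftrD(4) small_ftr_comma[OF u v] by blast+
  have n: "NSrc (comma_nt u v) = u \<odot> comma_fst u v" "NTgt (comma_nt u v) = v \<odot> comma_snd u v"
    by (simp_all add: comma_nt_def)
  show "NSrc (comma_nt u v \<triangleleft> lift) = NSrc \<phi>"
    using fcomp_assoc[OF l f, of u] small_nt_betweenD(3)[OF \<phi>] by (simp add: n fst_lift)
  have "comma_snd u v \<odot> lift = to_one J"
    by (rule functor_to_one_unique[OF functor_fcomp[OF l s] small_ftrD(4)[OF to_one]])
  then show "NTgt (comma_nt u v \<triangleleft> lift) = NTgt \<phi>"
    using fcomp_assoc[OF l s, of v] small_nt_betweenD(4)[OF \<phi>] by (simp add: n)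
  have "is_nt \<phi>" using \<phi> by (simp add: small_nt_between_def nt_between_def)
  from is_nt.At_ext[OF this] show "At \<phi> \<in> extensional (Obj (Src (NSrc \<phi>)))" .
  have J: "Src (NSrc \<phi>) = J" using small_nt_betweenD(3)[OF \<phi>] by simp
  show "At (comma_nt u v \<triangleleft> lift) \<in> extensional (Obj (Src (NSrc \<phi>)))"
    by (simp add: whisk_r_def J)
  show "At (comma_nt u v \<triangleleft> lift) x = At \<phi> x" if "x \<in> Obj (Src (NSrc \<phi>))" for x
  proof -
    have x: "x \<in> Obj J" using that J by simp
    then show ?thesis using lift_obj_K[OF x] by (simp add: comma_nt_def lift_obj_def)
  qed
qed

text \<open>Der4 provides the exact square of the slice, and \<open>J\<close> is final in the slice.\<close>

lemma exact:
  assumes "derivator D"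
  shows "derivator.exact_square D p (to_one J) u v \<phi>"
proof -
  interpret derivator D by fact
  have s: "comma_snd u v = to_one J \<odot> retract"
    by (rule functor_to_one_unique[of _ K])
      (use small_ftrD(4)[OF small_ftr_comma(2)[OF u v]]
        small_ftrD(4)[OF small_ftr_fcomp[OF small_ftr_retract to_one]] in simp_all)
  have "nat_iso (left_square_mate D (comma_fst u v) (comma_snd u v) u v (comma_nt u v))"
    using der4_left[OF small_ftrD(1)[OF u], of c] by (simp add: Let_def)
  then have "exact_square (comma_fst u v) (comma_snd u v) u v (comma_nt u v)"
    by (rule exact_square_if_mate[OF small_ftr_comma[OF u v] u v small_nt_comma[OF u v]])
  then have "exact_square (comma_fst u v) (to_one J \<odot> retract) u v (comma_nt u v)"
    by (simp add: s)
  from exact_square_restrict[OF slice_reflection small_ftr_comma(1)[OF u v] to_one u v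
      small_nt_comma[OF u v, unfolded s] this]
  show ?thesis by (simp add: fst_lift comma_nt_lift)
qed

end

section \<open>The two Kan extensions in the suspension\<close>

text \<open>Meaningful if there is exactly one arrow from \<open>x\<close> to \<open>y\<close>.\<close>

definition the_arr :: "('o, 'm) cat \<Rightarrow> 'o \<Rightarrow> 'o \<Rightarrow> 'm" where
  "the_arr C x y = (THE f. f \<in> Hom C x y)"

lemma the_arr_terminal:
  assumes "terminal_obj C e" "x \<in> Obj C"
  shows "the_arr C x e \<in> Hom C x e" "f \<in> Hom C x e \<Longrightarrow> f = the_arr C x e"
proof -
  have ex: "\<exists>!f. f \<in> Hom C x e" using assms by (simp add: terminal_obj_def)
  from theI'[OF ex] show h: "the_arr C x e \<in> Hom C x e" by (simp add: the_arr_def)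
  show "f \<in> Hom C x e \<Longrightarrow> f = the_arr C x e" using ex h by blast
qed

lemma the_arr_initial:
  assumes "initial_obj C o'" "x \<in> Obj C"
  shows "the_arr C o' x \<in> Hom C o' x" "f \<in> Hom C o' x \<Longrightarrow> f = the_arr C o' x"
proof -
  have ex: "\<exists>!f. f \<in> Hom C o' x" using assms by (simp add: initial_obj_def)
  from theI'[OF ex] show h: "the_arr C o' x \<in> Hom C o' x" by (simp add: the_arr_def)
  show "f \<in> Hom C o' x \<Longrightarrow> f = the_arr C o' x" using ex h by blast
qed

text \<open>For \<open>j : U \<rightarrow> S\<close> and \<open>e\<close> terminal in \<open>S\<close>, the cocone with vertex \<open>(a, e)\<close> under the diagram
  \<open>x \<mapsto> (a, j x)\<close>.\<close>

definition terminal_cocone :: "'u::universe scat \<Rightarrow> 'u sftr \<Rightarrow> 'u \<Rightarrow> 'u \<Rightarrow> 'u snt" where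
  "terminal_cocone A j e a = \<lparr>NSrc = ftr_prod (fid A) j \<odot> slice_snd A (Src j) a,
    NTgt = point (A \<otimes> Tgt j) (upair a e) \<odot> to_one (Src j),
    At = (\<lambda>x \<in> Obj (Src j). upair (Idn A a) (the_arr (Tgt j) (FO j x) e))\<rparr>"

text \<open>An object of the slice over \<open>(a, e)\<close> is an object \<open>(a', x)\<close> with an arrow \<open>g : a' \<rightarrow> a\<close>, since the
  arrow to \<open>e\<close> is no additional datum.  Its reflection into \<open>{a} \<times> U\<close> is \<open>(a, x)\<close>, along \<open>(g, id)\<close>.\<close>

lemma slice_retract_prod:
  assumes A: "small_cat A" and a: "a \<in> Obj A" and j: "small_ftr j U S" and e: "terminal_obj S e"
  shows "slice_retract (ftr_prod (fid A) j) (slice_snd A U a) (prod_snd A U) (terminal_cocone A j e a)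
    (upair a e) U (A \<otimes> U) (A \<otimes> S) (\<lambda>x f. upair (ufst f) (Idn U (usnd x)))"
proof -
  have US: "small_cat U" "small_cat S" using j by (simp_all add: small_ftr_def)
  interpret A: category A using A by (rule category_small)
  interpret U: category U using US by (simp add: category_small)
  interpret S: category S using US by (simp add: category_small)
  note [simp] = small_ftr_simps[OF j] a
  have eS [simp]: "e \<in> Obj S" using e by (simp add: terminal_obj_def)
  let ?u = "ftr_prod (fid A) j" and ?p = "slice_snd A U a" and ?P = "prod_snd A U"
    and ?\<phi> = "terminal_cocone A j e a" and ?c = "upair a e"
  have u: "small_ftr ?u (A \<otimes> U) (A \<otimes> S)" by (rule small_ftr_prod[OF small_ftr_fid[OF A] j])
  have p: "small_ftr ?p U (A \<otimes> U)" by (rule small_ftr_slice_snd[OF A US(1) a])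
  have P: "small_ftr ?P (A \<otimes> U) U" by (rule small_ftr_prod_snd[OF A US(1)])
  have c: "?c \<in> Obj (A \<otimes> S)" by simp
  have t [simp]: "the_arr S s e \<in> Arr S" "Dom S (the_arr S s e) = s" "Cod S (the_arr S s e) = e"
    if "s \<in> Obj S" for s
    using the_arr_terminal(1)[OF e that] by (simp_all add: Hom_def)
  have t_cmp: "Cmp S (the_arr S (Cod S k) e) k = the_arr S (Dom S k) e" if "k \<in> Arr S" for k
    by (rule the_arr_terminal(2)[OF e]) (use that in \<open>simp_all add: Hom_def\<close>)
  note sel [simp] = small_ftrD(2,3)[OF u] small_ftrD(2,3)[OF p]
  have \<phi>_At [simp]: "x \<in> Obj U \<Longrightarrow> At ?\<phi> x = upair (Idn A a) (the_arr S (FO j x) e)" for x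
    by (simp add: terminal_cocone_def)
  have \<phi>: "small_nt_between ?\<phi> (?u \<odot> ?p) (point (A \<otimes> S) ?c \<odot> to_one U) U (A \<otimes> S)"
  proof (rule small_nt_betweenI)
    show "small_ftr (?u \<odot> ?p) U (A \<otimes> S)" by (rule small_ftr_fcomp[OF p u])
    show "small_ftr (point (A \<otimes> S) ?c \<odot> to_one U) U (A \<otimes> S)"
      by (rule small_ftr_fcomp[OF small_ftr_to_one[OF US(1)]
            small_ftr_point[OF small_cat_prod[OF A US(2)] c]])
    fix k x y assume "k \<in> Hom U x y"
    then have k: "k \<in> Arr U" "Dom U k = x" "Cod U k = y" by (simp_all add: Hom_def)
    then have xy: "x \<in> Obj U" "y \<in> Obj U" by auto
    show "Cmp (A \<otimes> S) (At ?\<phi> y) (FA (?u \<odot> ?p) k)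
      = Cmp (A \<otimes> S) (FA (point (A \<otimes> S) ?c \<odot> to_one U) k) (At ?\<phi> x)"
      using k xy t_cmp[of "FA j k"] by simp
  qed (simp_all add: terminal_cocone_def Hom_def)
  have split: "\<exists>a' x'. x = upair a' x' \<and> a' \<in> Obj A \<and> x' \<in> Obj U" if "x \<in> Obj (A \<otimes> U)" for x
    using that by (auto simp: prod_cases)
  have split_arr: "\<exists>g. f = upair g (the_arr S (FO j x') e) \<and> g \<in> Hom A a' a"
    if f': "f \<in> Hom (A \<otimes> S) (FO ?u (upair a' x')) ?c" and "a' \<in> Obj A" "x' \<in> Obj U" for f a' x'
  proof -
    obtain g k where f: "f = upair g k" and gk: "g \<in> Arr A" "k \<in> Arr S"
      by (rule prod_hom_cases[OF f'])
    have h: "g \<in> Hom A a' a" "k \<in> Hom S (FO j x') e"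
      using that gk unfolding f by (auto simp: Hom_def)
    then have "k = the_arr S (FO j x') e"
      using the_arr_terminal(2)[OF e _ h(2)] that(3) by simp
    then show ?thesis using f h by blast
  qed
  have Pp: "?P \<odot> ?p = fid U"
    by (rule functor_eqI[OF small_ftrD(4)[OF small_ftr_fcomp[OF p P]] functor_fid[OF U.category_axioms]])
      simp_all
  show ?thesis
  proof (rule slice_retract.intro[OF u c p P Pp \<phi>])
    fix x f assume x: "x \<in> Obj (A \<otimes> U)" and f: "f \<in> Hom (A \<otimes> S) (FO ?u x) ?c"
    obtain a' x' where x': "x = upair a' x'" "a' \<in> Obj A" "x' \<in> Obj U" using split[OF x] by blast
    obtain g where g: "f = upair g (the_arr S (FO j x') e)" "g \<in> Hom A a' a"
      using split_arr[OF _ x'(2,3)] f unfolding x'(1) by blast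
    have g': "g \<in> Arr A" "Dom A g = a'" "Cod A g = a" using g(2) by (auto simp: Hom_def)
    show "upair (ufst f) (Idn U (usnd x)) \<in> Hom (A \<otimes> U) x (FO ?p (FO ?P x))"
      unfolding g(1) x'(1) using x' g' by (simp add: Hom_def)
    show "Cmp (A \<otimes> S) (At ?\<phi> (FO ?P x)) (FA ?u (upair (ufst f) (Idn U (usnd x)))) = f"
      unfolding g(1) x'(1) using x' g' by simp
    show "FA ?P (upair (ufst f) (Idn U (usnd x))) = Idn U (FO ?P x)"
      unfolding g(1) x'(1) using x' g' by simp
  next
    fix x assume "x \<in> Obj U"
    then show "upair (ufst (At ?\<phi> x)) (Idn U (usnd (FO ?p x))) = Idn (A \<otimes> U) (FO ?p x)"
      by simp
  next
    fix h x y f assume h: "h \<in> Hom (A \<otimes> U) x y" and f: "f \<in> Hom (A \<otimes> S) (FO ?u y) ?c"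
    obtain l k where h': "h = upair l k" and lk: "l \<in> Arr A" "k \<in> Arr U"
      and xy: "x = upair (Dom A l) (Dom U k)" "y = upair (Cod A l) (Cod U k)"
      by (rule prod_hom_cases[OF h])
    obtain g where g: "f = upair g (the_arr S (FO j (Cod U k)) e)" "g \<in> Hom A (Cod A l) a"
      using split_arr[of f "Cod A l" "Cod U k"] f lk unfolding xy by auto
    have g': "g \<in> Arr A" "Dom A g = Cod A l" "Cod A g = a" using g(2) by (auto simp: Hom_def)
    show "Cmp (A \<otimes> U) (upair (ufst f) (Idn U (usnd y))) h
      = Cmp (A \<otimes> U) (FA ?p (FA ?P h))
        (upair (ufst (Cmp (A \<otimes> S) f (FA ?u h))) (Idn U (usnd x)))"
      unfolding h' xy g(1) using lk g' by simp
  qed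
qed

text \<open>The inclusion of \<open>A \<times> {o'}\<close> is left adjoint to the projection, with counit \<open>(a, o') \<rightarrow> (a, c)\<close>.\<close>

lemma coreflection_initial:
  assumes A: "small_cat A" and U: "small_cat U" and o: "initial_obj U o'"
  shows "coreflection (ftr_prod (fid A) (point U o')) (ftr_prod (fid A) (to_one U))
    \<lparr>NSrc = ftr_prod (fid A) (point U o') \<odot> ftr_prod (fid A) (to_one U), NTgt = fid (A \<otimes> U),
      At = (\<lambda>x \<in> Obj (A \<otimes> U). upair (Idn A (ufst x)) (the_arr U o' (usnd x)))\<rparr> (A \<otimes> one) (A \<otimes> U)"
    (is "coreflection ?w ?P ?\<tau> _ _")
proof -
  interpret A: category A using A by (rule category_small)
  interpret U: category U using U by (rule category_small)
  have o'U [simp]: "o' \<in> Obj U" using o by (simp add: initial_obj_def)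
  have AU: "small_cat (A \<otimes> U)" and A1: "small_cat (A \<otimes> one)"
    using small_cat_prod A U small_cat_one by blast+
  have w: "small_ftr ?w (A \<otimes> one) (A \<otimes> U)"
    by (rule small_ftr_prod[OF small_ftr_fid[OF A] small_ftr_point[OF U o'U]])
  have P: "small_ftr ?P (A \<otimes> U) (A \<otimes> one)"
    by (rule small_ftr_prod[OF small_ftr_fid[OF A] small_ftr_to_one[OF U]])
  note [simp] = small_ftr_simps(1,2)[OF w] small_ftr_simps(1,2)[OF P]
  have Pw: "?P \<odot> ?w = fid (A \<otimes> one)"
    by (rule functor_eqI[OF small_ftrD(4)[OF small_ftr_fcomp[OF w P]]
          functor_fid[OF category_small[OF A1]]]) (auto simp: prod_cases)
  have t [simp]: "the_arr U o' c \<in> Arr U" "Dom U (the_arr U o' c) = o'" "Cod U (the_arr U o' c) = c"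
    if "c \<in> Obj U" for c
    using the_arr_initial(1)[OF o that] by (simp_all add: Hom_def)
  have t_cmp: "Cmp U k (the_arr U o' (Dom U k)) = the_arr U o' (Cod U k)" if "k \<in> Arr U" for k
    by (rule the_arr_initial(2)[OF o]) (use that in \<open>simp_all add: Hom_def\<close>)
  have t_idn: "the_arr U o' o' = Idn U o'"
    by (rule the_arr_initial(2)[OF o, symmetric]) (simp_all add: Hom_def)
  have "small_nt_between ?\<tau> (?w \<odot> ?P) (fid (A \<otimes> U)) (A \<otimes> U) (A \<otimes> U)"
  proof (rule small_nt_betweenI[OF small_ftr_fcomp[OF P w] small_ftr_fid[OF AU]])
    show "At ?\<tau> x \<in> Hom (A \<otimes> U) (FO (?w \<odot> ?P) x) (FO (fid (A \<otimes> U)) x)"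
      if "x \<in> Obj (A \<otimes> U)" for x
    proof -
      obtain a c where "x = upair a c" "a \<in> Obj A" "c \<in> Obj U"
        using \<open>x \<in> Obj (A \<otimes> U)\<close> unfolding prod_cases by blast
      then show ?thesis by (simp add: Hom_def)
    qed
    fix h x y assume h: "h \<in> Hom (A \<otimes> U) x y"
    obtain l k where h': "h = upair l k" and lk: "l \<in> Arr A" "k \<in> Arr U"
      and xy: "x = upair (Dom A l) (Dom U k)" "y = upair (Cod A l) (Cod U k)"
      by (rule prod_hom_cases[OF h])
    show "Cmp (A \<otimes> U) (At ?\<tau> y) (FA (?w \<odot> ?P) h) = Cmp (A \<otimes> U) (FA (fid (A \<otimes> U)) h) (At ?\<tau> x)"
      unfolding h' xy using lk t_cmp[OF lk(2)] by simp
  qed simp_all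
  moreover have "At ?\<tau> (FO ?w b) = Idn (A \<otimes> U) (FO ?w b)" if b: "b \<in> Obj (A \<otimes> one)" for b
  proof -
    obtain a where "b = upair a (unat 0)" "a \<in> Obj A" using b by (auto simp: prod_cases)
    then show ?thesis by (simp add: t_idn)
  qed
  moreover have "FA ?P (At ?\<tau> x) = Idn (A \<otimes> one) (FO ?P x)" if x: "x \<in> Obj (A \<otimes> U)" for x
  proof -
    obtain a c where "x = upair a c" "a \<in> Obj A" "c \<in> Obj U"
      using x unfolding prod_cases by blast
    then show ?thesis by simp
  qed
  ultimately show ?thesis
    using w P Pw unfolding coreflection_def by blast
qed

lemma point_prod:
  assumes A: "small_cat A" and a: "a \<in> Obj A" and S: "small_cat S" and e: "e \<in> Obj S"
  shows "ftr_prod (fid A) (point S e) \<odot> point (A \<otimes> one) (upair a (unat 0))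
    = point (A \<otimes> S) (upair a e)"
proof -
  interpret A: category A using A by (rule category_small)
  interpret S: category S using S by (rule category_small)
  have f: "small_ftr (ftr_prod (fid A) (point S e)) (A \<otimes> one) (A \<otimes> S)"
    by (rule small_ftr_prod[OF small_ftr_fid[OF A] small_ftr_point[OF S e]])
  have g: "small_ftr (point (A \<otimes> one) (upair a (unat 0))) one (A \<otimes> one)"
    by (rule small_ftr_point[OF small_cat_prod[OF A small_cat_one]]) (simp add: a)
  have h: "small_ftr (point (A \<otimes> S) (upair a e)) one (A \<otimes> S)"
    by (rule small_ftr_point[OF small_cat_prod[OF A S]]) (simp add: a e)
  show ?thesis
    by (rule functor_eqI[OF small_ftrD(4)[OF small_ftr_fcomp[OF g f]] small_ftrD(4)[OF h]])
      (use a e in simp_all)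
qed

context derivator
begin

text \<open>By Der1 for the empty family, \<open>D(\<emptyset>)\<close> is equivalent to a category with a single arrow.\<close>

lemma empty_hom:
  assumes X: "X \<in> Obj (DCat D empty_cat)" and Y: "Y \<in> Obj (DCat D empty_cat)"
  shows "\<exists>!f. f \<in> Hom (DCat D empty_cat) X Y"
proof -
  let ?D = "DCat D empty_cat"
  let ?F = "family_tuple ?D {} (\<lambda>i. DFun D (coprod_incl {} (\<lambda>_. empty_cat) i))"
  interpret D0: category "DCat D empty_cat" by (rule DCat[OF small_cat_empty])
  have "coprod {} (\<lambda>_. empty_cat) = (empty_cat :: 'u scat)"
    by (simp add: coprod_def empty_cat_def Let_def restrict_def)
  then have "equivalence_functor ?F"
    using der1[OF small_set_finite, of "{}" "\<lambda>_. empty_cat"] by simp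
  then obtain G s where F: "is_functor ?F" and G: "functor_between G (Tgt ?F) (Src ?F)"
    and s: "nat_iso s" "nt_between s (fid (Src ?F)) (G \<odot> ?F)"
    unfolding equivalence_functor_def by blast
  have [simp]: "Src ?F = ?D" by (simp add: family_tuple_def)
  have Fb: "functor_between ?F ?D (Tgt ?F)" using F by (simp add: functor_between_def)
  have fidb: "functor_between (fid ?D) ?D ?D"
    by (rule functor_fid[OF D0.category_axioms])
  have s': "nt_between s (fid ?D) (G \<odot> ?F)" using s(2) by simp
  note [simp] = nt_between_simps[OF s' fidb]
  have iso: "iso_arr ?D (At s Z)" if "Z \<in> Obj ?D" for Z
    using s(1) that by (simp add: nat_iso_def)
  \<comment> \<open>All arrows and all objects have the same image, namely the empty family.\<close>
  have same: "FA ?F f = FA ?F g" if "f \<in> Arr ?D" "g \<in> Arr ?D" for f g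
    using that by (simp add: family_tuple_def restrict_def)
  have same_obj: "FO ?F X = FO ?F Y" using X Y by (simp add: family_tuple_def restrict_def)
  show ?thesis
  proof (rule ex_ex1I)
    let ?f = "Cmp ?D (inv_arr ?D (At s Y)) (At s X)"
    have "?f \<in> Hom ?D X Y"
      using iso[OF X] iso[OF Y] X Y same_obj by (simp add: Hom_def)
    then show "\<exists>f. f \<in> Hom ?D X Y" by blast
  next
    fix f g assume f: "f \<in> Hom ?D X Y" and g: "g \<in> Hom ?D X Y"
    have fg: "f \<in> Arr ?D" "Dom ?D f = X" "Cod ?D f = Y"
      "g \<in> Arr ?D" "Dom ?D g = X" "Cod ?D g = Y"
      using f g by (auto simp: Hom_def)
    have "Cmp ?D (At s Y) f = Cmp ?D (At s Y) g"
      using nt_naturality[OF s' fidb f] nt_naturality[OF s' fidb g] fg same[of f g] by simp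
    then have "Cmp ?D (inv_arr ?D (At s Y)) (Cmp ?D (At s Y) f)
      = Cmp ?D (inv_arr ?D (At s Y)) (Cmp ?D (At s Y) g)"
      by simp
    then show "f = g" using D0.cmp_inv_cancel(1)[OF iso[OF Y]] fg Y by simp
  qed
qed

lemma ran_empty_terminal:
  assumes Y: "Y \<in> Obj (DCat D empty_cat)"
  shows "terminal_obj (DCat D one) (FO (ran D (to_one empty_cat)) Y)"
proof -
  have p: "small_ftr (to_one empty_cat) empty_cat (one :: 'u scat)"
    by (rule small_ftr_to_one[OF small_cat_empty])
  interpret r: ran_pair D "to_one empty_cat" "empty_cat" one by (rule ran_pair[OF p])
  let ?p = "to_one empty_cat :: 'u sftr"
  show ?thesis
    unfolding terminal_obj_def
  proof (intro conjI ballI ex_ex1I)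
    show "FO (ran D ?p) Y \<in> Obj (DCat D one)" using Y by simp
    fix Z assume Z: "Z \<in> Obj (DCat D one)"
    obtain e where e: "e \<in> Hom (DCat D empty_cat) (FO (DFun D ?p) Z) Y"
      using empty_hom[of "FO (DFun D ?p) Z" Y] Y Z by auto
    have "Cmp (DCat D one) (FA (ran D ?p) e) (At (ran_unit D ?p) Z)
        \<in> Hom (DCat D one) Z (FO (ran D ?p) Y)"
      using e Z by (simp add: Hom_def)
    then show "\<exists>f. f \<in> Hom (DCat D one) Z (FO (ran D ?p) Y)" by blast
    fix f g assume f: "f \<in> Hom (DCat D one) Z (FO (ran D ?p) Y)"
      and g: "g \<in> Hom (DCat D one) Z (FO (ran D ?p) Y)"
    have "Cmp (DCat D empty_cat) (At (ran_counit D ?p) Y) (FA (DFun D ?p) f)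
        \<in> Hom (DCat D empty_cat) (FO (DFun D ?p) Z) Y"
      "Cmp (DCat D empty_cat) (At (ran_counit D ?p) Y) (FA (DFun D ?p) g)
        \<in> Hom (DCat D empty_cat) (FO (DFun D ?p) Z) Y"
      using f g Y by (simp_all add: Hom_def)
    then show "f = g"
      using r.right_eqI[OF f g Y] empty_hom[of "FO (DFun D ?p) Z" Y] Y Z by auto
  qed
qed

text \<open>The slice \<open>(c/w)\<close> is empty, so by Der4 the value at \<open>c\<close> is a limit over the empty category.\<close>

lemma ran_terminal_outside:
  assumes w: "small_ftr w B C" and c: "c \<in> Obj C" and empty: "\<And>b. b \<in> Obj B \<Longrightarrow> Hom C c (FO w b) = {}"
    and X: "X \<in> Obj (DCat D B)"
  shows "terminal_obj (DCat D one) (FO (DFun D (point C c)) (FO (ran D w) X))"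
proof -
  let ?v = "point C c"
  have v: "small_ftr ?v one C" by (rule small_ftr_point[OF small_ftrD(6)[OF w] c])
  have objs: "comma_objs ?v w = {}"
    using empty small_ftrD(2)[OF w] by (auto simp: comma_objs_def)
  then have arrs: "comma_arrs ?v w = {}" by (auto simp: comma_arrs_def)
  have K: "comma ?v w = empty_cat"
    by (simp add: comma_def empty_cat_def Let_def objs arrs restrict_def)
  note small_ftr_comma[OF v w, unfolded K]
  note f = this(1) and q = this(2)
  have p: "comma_fst ?v w = to_one empty_cat"
    by (rule functor_to_one_unique[OF small_ftrD(4)[OF f]
          small_ftrD(4)[OF small_ftr_to_one[OF small_cat_empty]]])
  interpret r: ran_pair D "comma_fst ?v w" "empty_cat" one by (rule ran_pair[OF f])
  interpret r': ran_pair D w B C by (rule ran_pair[OF w])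
  note [simp] = DFun_simps[OF v] DFun_simps[OF q] X
  let ?m = "right_square_mate D (comma_fst ?v w) (comma_snd ?v w) ?v w (comma_nt ?v w)"
  let ?Y = "FO (DFun D (comma_snd ?v w)) X"
  have m: "nat_iso ?m"
    using der4_right[OF small_ftrD(1)[OF w], of c] c small_ftrD(3)[OF w] by (simp add: Let_def)
  have n: "NSrc (ran_unit D (comma_fst ?v w)) = fid (DCat D one)" "NTgt (ran_counit D w) = fid (DCat D B)"
    using r.unit r'.counit by (simp_all add: nt_between_def)
  have sel: "Src (NSrc ?m) = DCat D B" "Tgt (NSrc ?m) = DCat D one"
    "FO (NSrc ?m) X = FO (DFun D ?v) (FO (ran D w) X)" "FO (NTgt ?m) X = FO (ran D (comma_fst ?v w)) ?Y"
    by (simp_all add: right_square_mate_def n)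
  have "is_nt ?m" "iso_arr (DCat D one) (At ?m X)" using m sel by (simp_all add: nat_iso_def)
  moreover have "At ?m X
      \<in> Hom (DCat D one) (FO (DFun D ?v) (FO (ran D w) X)) (FO (ran D (comma_fst ?v w)) ?Y)"
    using is_nt.At_Hom[OF \<open>is_nt ?m\<close>, of X] by (simp add: sel)
  moreover have "terminal_obj (DCat D one) (FO (ran D (comma_fst ?v w)) ?Y)"
    unfolding p by (rule ran_empty_terminal) simp
  ultimately show ?thesis using r.C.terminal_obj_iso by blast
qed

end

context derivator_morphism
begin

text \<open>Isomorphisms are detected at the objects \<open>a\<close> of \<open>A\<close>, and at \<open>(a, e)\<close> both left Kan extensions are
  colimits over \<open>U\<close>.\<close>

lemma left_mate_iso_terminal:
  assumes A: "small_cat A" and j: "small_ftr j U S" and e: "terminal_obj S e"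
    and pres: "preserves_lan D E F (to_one U)" and X: "X \<in> Obj (DCat D (A \<otimes> U))"
  shows "iso_arr (DCat E (A \<otimes> one)) (FA (DFun E (ftr_prod (fid A) (point S e)))
    (At (left_mate D E F (ftr_prod (fid A) j)) X))"
proof -
  let ?u = "ftr_prod (fid A) j" and ?e = "ftr_prod (fid A) (point S e)"
  let ?m = "At (left_mate D E F ?u) X"
  have US: "small_cat U" "small_cat S" using j by (simp_all add: small_ftr_def)
  have eS: "e \<in> Obj S" using e by (simp add: terminal_obj_def)
  have u: "small_ftr ?u (A \<otimes> U) (A \<otimes> S)" by (rule small_ftr_prod[OF small_ftr_fid[OF A] j])
  have e': "small_ftr ?e (A \<otimes> one) (A \<otimes> S)"
    by (rule small_ftr_prod[OF small_ftr_fid[OF A] small_ftr_point[OF US(2) eS]])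
  have m: "?m \<in> Arr (DCat E (A \<otimes> S))" using left_mate(3)[OF u X] by (simp add: Hom_def)
  have "iso_arr (DCat E one) (FA (DFun E (point (A \<otimes> one) z)) (FA (DFun E ?e) ?m))"
    if z: "z \<in> Obj (A \<otimes> one)" for z
  proof -
    obtain a where z': "z = upair a (unat 0)" and a: "a \<in> Obj A" using z by (auto simp: prod_cases)
    have pt: "small_ftr (point (A \<otimes> one) z) one (A \<otimes> one)"
      by (rule small_ftr_point[OF small_cat_prod[OF A small_cat_one] z])
    interpret s: slice_retract ?u "slice_snd A U a" "prod_snd A U" "terminal_cocone A j e a" "upair a e"
        U "A \<otimes> U" "A \<otimes> S" "\<lambda>x f. upair (ufst f) (Idn U (usnd x))"
      by (rule slice_retract_prod[OF A a j e])
    have "iso_arr (DCat E one) (FA (DFun E (point (A \<otimes> S) (upair a e))) ?m)"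
      by (rule left_mate_iso_along[OF s.p s.to_one u s.v s.\<phi> s.exact[OF D.derivator_axioms]
            s.exact[OF E.derivator_axioms] pres X])
    moreover have "FA (DFun E (?e \<odot> point (A \<otimes> one) z)) ?m
        = FA (DFun E (point (A \<otimes> one) z)) (FA (DFun E ?e) ?m)"
      by (rule E.DFun_comp(2)[OF pt e' m])
    ultimately show ?thesis
      unfolding z' by (simp add: point_prod[OF A a US(2) eS])
  qed
  moreover have "FA (DFun E ?e) ?m \<in> Arr (DCat E (A \<otimes> one))"
    using E.DFun_simps(4)[OF e' m] .
  ultimately show ?thesis
    using E.der2[OF small_cat_prod[OF A small_cat_one]] by blast
qed

text \<open>Every terminal object is isomorphic to a limit over the empty category.\<close>

lemma preserves_terminal_obj:
  assumes pres: "preserves_ran D E F (to_one empty_cat)" and T: "terminal_obj (DCat D one) T"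
  shows "terminal_obj (DCat E one) (FO (MFun F one) T)"
proof -
  let ?p = "to_one empty_cat :: 'u sftr"
  have p: "small_ftr ?p empty_cat one" by (rule small_ftr_to_one[OF small_cat_empty])
  interpret D1: category "DCat D one" by (rule D.DCat[OF small_cat_one])
  interpret E1: category "DCat E one" by (rule E.DCat[OF small_cat_one])
  note F1 = MFun[OF small_cat_one] and F0 = MFun[OF small_cat_empty]
  define Y where "Y = FO (DFun D ?p) T"
  have Y: "Y \<in> Obj (DCat D empty_cat)"
    unfolding Y_def using T D.DFun_simps(3)[OF p] by (simp add: terminal_obj_def)
  have R: "terminal_obj (DCat D one) (FO (ran D ?p) Y)" by (rule D.ran_empty_terminal[OF Y])
  obtain t where t: "t \<in> Hom (DCat D one) T (FO (ran D ?p) Y)"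
    using R T unfolding terminal_obj_def by blast
  have "iso_arr (DCat D one) t" by (rule D1.terminal_iso[OF T R t])
  then have Ft: "iso_arr (DCat E one) (FA (MFun F one) t)" by (rule functor_iso[OF F1])
  have "iso_arr (DCat E one) (At (right_mate D E F ?p) Y)"
    using pres Y right_mate_sel[OF p] by (simp add: preserves_ran_def nat_iso_def)
  moreover have "terminal_obj (DCat E one) (FO (ran E ?p) (FO (MFun F empty_cat) Y))"
    by (rule E.ran_empty_terminal) (use functor_simps(3)[OF F0 Y] in simp)
  ultimately have "terminal_obj (DCat E one) (FO (MFun F one) (FO (ran D ?p) Y))"
    using E1.terminal_obj_iso[OF _ right_mate(2)[OF p Y]] by blast
  then show ?thesis
    using E1.terminal_obj_iso[OF _ functor_hom[OF F1 t] Ft] by blast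
qed

text \<open>The values of a right Kan extension along \<open>w : A \<times> {o'} \<rightarrow> A \<times> U\<close> are known at every object.  At
  \<open>(a, o')\<close> they are the original values, because \<open>w\<close> has a right adjoint; at \<open>(a, c)\<close> with \<open>c \<noteq> o'\<close>
  they are terminal, because there is no arrow from \<open>c\<close> to \<open>o'\<close>.\<close>

lemma right_mate_iso_sieve:
  assumes A: "small_cat A" and U: "small_cat U" and o: "initial_obj U o'"
    and sieve: "\<And>c. c \<in> Obj U \<Longrightarrow> c \<noteq> o' \<Longrightarrow> Hom U c o' = {}"
    and pres: "preserves_ran D E F (to_one empty_cat)" and X: "X \<in> Obj (DCat D (A \<otimes> one))"
  shows "iso_arr (DCat E (A \<otimes> U)) (At (right_mate D E F (ftr_prod (fid A) (point U o'))) X)"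
proof -
  let ?w = "ftr_prod (fid A) (point U o')"
  let ?m = "At (right_mate D E F ?w) X"
  interpret A: category A using A by (rule category_small)
  interpret U: category U using U by (rule category_small)
  have o'U [simp]: "o' \<in> Obj U" using o by (simp add: initial_obj_def)
  have AU: "small_cat (A \<otimes> U)" and A1: "small_cat (A \<otimes> one)"
    using small_cat_prod A U small_cat_one by blast+
  have w: "small_ftr ?w (A \<otimes> one) (A \<otimes> U)"
    by (rule small_ftr_prod[OF small_ftr_fid[OF A] small_ftr_point[OF U o'U]])
  interpret EU: category "DCat E (A \<otimes> U)" by (rule E.DCat[OF AU])
  interpret E1: category "DCat E one" by (rule E.DCat[OF small_cat_one])
  interpret EA1: category "DCat E (A \<otimes> one)" by (rule E.DCat[OF A1])
  interpret r: ran_pair D "?w" "A \<otimes> one" "A \<otimes> U" by (rule D.ran_pair[OF w])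
  interpret r': ran_pair E "?w" "A \<otimes> one" "A \<otimes> U" by (rule E.ran_pair[OF w])
  note FA1 = MFun[OF A1] and FU = MFun[OF AU]
  note [simp] = functor_simps[OF FA1] functor_simps[OF FU] X
  have m: "?m \<in> Arr (DCat E (A \<otimes> U))" "?m \<in> Hom (DCat E (A \<otimes> U)) (FO (MFun F (A \<otimes> U)) (FO (ran D ?w) X))
      (FO (ran E ?w) (FO (MFun F (A \<otimes> one)) X))"
    using right_mate(2)[OF w X] by (simp_all add: Hom_def)
  \<comment> \<open>As the counits of \<open>w\<^sup>* \<stileturn> w\<^sub>*\<close> are invertible in both derivators, so is \<open>w\<^sup>*\<close> of the mate.\<close>
  have FX: "FO (MFun F (A \<otimes> one)) X \<in> Obj (DCat E (A \<otimes> one))" by simp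
  note core = coreflection_initial[OF A U o]
  have "iso_arr (DCat D (A \<otimes> one)) (At (ran_counit D ?w) X)"
    by (rule D.ran_counit_iso[OF core X])
  then have "iso_arr (DCat E (A \<otimes> one)) (FA (MFun F (A \<otimes> one)) (At (ran_counit D ?w) X))"
    by (rule functor_iso[OF FA1])
  then have "iso_arr (DCat E (A \<otimes> one)) (right_mate_arr ?w X)"
    unfolding right_mate_arr_def using MIso[OF w, of "FO (ran D ?w) X"] small_ftrD(2)[OF w]
    by (simp add: EA1.iso_cmp)
  moreover have "iso_arr (DCat E (A \<otimes> one)) (At (ran_counit E ?w) (FO (MFun F (A \<otimes> one)) X))"
    by (rule E.ran_counit_iso[OF core FX])
  ultimately have iso_o: "iso_arr (DCat E (A \<otimes> one)) (FA (DFun E ?w) ?m)"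
    using EA1.iso_cancel_left[of "At (ran_counit E ?w) (FO (MFun F (A \<otimes> one)) X)" "FA (DFun E ?w) ?m"]
      right_mate(3)[OF w X] m FX by (simp add: Hom_def)
  have "iso_arr (DCat E one) (FA (DFun E (point (A \<otimes> U) z)) ?m)" if z: "z \<in> Obj (A \<otimes> U)" for z
  proof -
    obtain a c where z': "z = upair a c" and a: "a \<in> Obj A" and c: "c \<in> Obj U"
      using z by (auto simp: prod_cases)
    have pt: "small_ftr (point (A \<otimes> U) z) one (A \<otimes> U)" by (rule small_ftr_point[OF AU z])
    show ?thesis
    proof (cases "c = o'")
      case True
      have a1: "upair a (unat 0) \<in> Obj (A \<otimes> one)" using a by simp
      have pt1: "small_ftr (point (A \<otimes> one) (upair a (unat 0))) one (A \<otimes> one)"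
        by (rule small_ftr_point[OF A1 a1])
      have "FA (DFun E (point (A \<otimes> U) z)) ?m
          = FA (DFun E (point (A \<otimes> one) (upair a (unat 0)))) (FA (DFun E ?w) ?m)"
        using E.DFun_comp(2)[OF pt1 w m(1)] point_prod[OF A a U o'U] True by (simp add: z')
      then show ?thesis using functor_iso(1)[OF E.DFun[OF pt1] iso_o] by simp
    next
      case False
      have none: "Hom (A \<otimes> U) z (FO ?w b) = {}" if b: "b \<in> Obj (A \<otimes> one)" for b
      proof (rule equals0I)
        obtain a' where b': "b = upair a' (unat 0)" "a' \<in> Obj A" using b by (auto simp: prod_cases)
        fix h assume h: "h \<in> Hom (A \<otimes> U) z (FO ?w b)"
        obtain l k where h': "h = upair l k" and lk: "l \<in> Arr A" "k \<in> Arr U"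
          by (rule prod_hom_cases[OF h])
        have "k \<in> Hom U c o'" using h lk b' unfolding h' z' by (simp add: Hom_def)
        then show False using sieve[OF c False] by blast
      qed
      let ?pt = "point (A \<otimes> U) z"
      note t1 = D.ran_terminal_outside[OF w z none X]
      note t2 = E.ran_terminal_outside[OF w z none FX]
      note t3 = preserves_terminal_obj[OF pres t1]
      let ?\<gamma> = "At (MIso F ?pt) (FO (ran D ?w) X)"
      have g: "iso_arr (DCat E one) ?\<gamma>"
        "?\<gamma> \<in> Hom (DCat E one) (FO (DFun E ?pt) (FO (MFun F (A \<otimes> U)) (FO (ran D ?w) X)))
          (FO (MFun F one) (FO (DFun D ?pt) (FO (ran D ?w) X)))"
        using MIso[OF pt, of "FO (ran D ?w) X"] by (simp_all add: Hom_def)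
      note t4 = E1.terminal_obj_iso[OF t3 g(2,1)]
      show ?thesis
        by (rule E1.terminal_iso[OF t4 t2 functor_hom[OF E.DFun[OF pt] m(2)]])
    qed
  qed
  then show ?thesis using E.der2[OF AU m(1)] by blast
qed

end

lemma square_terminal: "terminal_obj square (corner 1 1)"
proof -
  have "\<exists>!f. f \<in> Hom square y (corner 1 1)" if y': "y \<in> Obj square" for y :: 'a
  proof -
    obtain i j where y: "y = upair (unat i) (unat j)" "i \<le> 1" "j \<le> 1"
      using y' unfolding square_def prod_cases simplex_cases by blast
    show ?thesis
      by (rule ex1I[of _ "upair (upair (unat i) (unat 1)) (upair (unat j) (unat 1))"])
        (use y in \<open>auto simp: square_def corner_def Hom_def prod_cases simplex_cases\<close>)
  qed
  moreover have "corner 1 1 \<in> Obj (square :: 'a scat)" by (simp add: square_def corner_def)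
  ultimately show ?thesis by (simp add: terminal_obj_def)
qed

lemma square_hom:
  assumes "i \<le> 1" "j \<le> 1" "k \<le> 1" "l \<le> 1"
  shows "f \<in> Hom square (corner i j) (corner k l) \<longleftrightarrow>
    i \<le> k \<and> j \<le> l \<and> f = upair (upair (unat i) (unat k)) (upair (unat j) (unat l))"
  using assms by (auto simp: square_def corner_def Hom_def prod_cases simplex_cases)

lemma ulcorner_hom:
  "Hom ulcorner x y = (if x \<noteq> corner 1 1 \<and> y \<noteq> corner 1 1 then Hom square x y else {})"
  by (auto simp: ulcorner_def full_subcat_def Let_def Hom_def)

lemma ulcorner_obj: "x \<in> Obj ulcorner \<longleftrightarrow> x \<in> Obj square \<and> x \<noteq> corner 1 1"
  by (auto simp: ulcorner_def full_subcat_def Let_def)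

lemma square_obj: "x \<in> Obj square \<longleftrightarrow> (\<exists>i j. x = corner i j \<and> i \<le> 1 \<and> j \<le> 1)"
  by (auto simp: square_def corner_def prod_cases simplex_cases)

lemma corner_eq_iff [simp]: "corner i j = corner k l \<longleftrightarrow> i = k \<and> j = l"
  by (simp add: corner_def)

lemma ulcorner_initial: "initial_obj ulcorner (corner 0 0)"
proof -
  have "\<exists>!f. f \<in> Hom ulcorner (corner 0 0) y" if y': "y \<in> Obj ulcorner" for y :: 'a
  proof -
    obtain i j where y: "y = corner i j" "i \<le> 1" "j \<le> 1" "corner i j \<noteq> (corner 1 1 :: 'a)"
      using y' unfolding ulcorner_obj square_obj by blast
    then show ?thesis by (simp add: ulcorner_hom square_hom)
  qed
  moreover have "corner 0 0 \<in> Obj (ulcorner :: 'a scat)" by (auto simp: ulcorner_obj square_obj)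
  ultimately show ?thesis by (simp add: initial_obj_def)
qed

lemma ulcorner_sieve:
  assumes "c \<in> Obj ulcorner" "c \<noteq> corner 0 0"
  shows "Hom ulcorner c (corner 0 0) = {}"
proof -
  obtain i j where c: "c = corner i j" "i \<le> 1" "j \<le> 1"
    using assms(1) unfolding ulcorner_obj square_obj by blast
  then show ?thesis using assms(2) by (auto simp: ulcorner_hom square_hom)
qed

section \<open>Compatibility of mates with modifications\<close>

context derivator_morphism
begin

text \<open>The comparison \<open>e\<^sup>* n\<^sub>! i\<^sub>* F \<rightarrow> F e\<^sup>* n\<^sub>! i\<^sub>*\<close>.  The suspensions of \<open>D\<close> and of its shifts are instances of
  \<open>e\<^sup>* n\<^sub>! i\<^sub>*\<close>.\<close>

definition comparison :: "'u sftr \<Rightarrow> 'u sftr \<Rightarrow> 'u sftr \<Rightarrow> ('o, 'm, 'p, 'q) nt" where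
  "comparison i n e = (MIso F e \<triangleleft> (lan D n \<odot> ran D i))
    \<cdot> (DFun E e \<triangleright> (left_mate D E F n \<triangleleft> ran D i))
    \<cdot> ((DFun E e \<odot> lan E n) \<triangleright> nt_inv (right_mate D E F i))"

lemma comparison:
  assumes i: "small_ftr i B U" and n: "small_ftr n U S" and e: "small_ftr e B S"
    and right: "\<forall>X \<in> Obj (DCat D B). iso_arr (DCat E U) (At (right_mate D E F i) X)"
    and left: "\<forall>Y \<in> Obj (DCat D U). iso_arr (DCat E B) (FA (DFun E e) (At (left_mate D E F n) Y))"
    and X: "X \<in> Obj (DCat D B)"
  shows "At (comparison i n e) X = Cmp (DCat E B) (At (MIso F e) (FO (lan D n) (FO (ran D i) X)))
      (FA (DFun E e) (Cmp (DCat E S) (At (left_mate D E F n) (FO (ran D i) X))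
        (FA (lan E n) (inv_arr (DCat E U) (At (right_mate D E F i) X)))))"
    and "iso_arr (DCat E B) (At (comparison i n e) X)"
    and "At (comparison i n e) X \<in> Hom (DCat E B)
      (FO (DFun E e) (FO (lan E n) (FO (ran E i) (FO (MFun F B) X))))
      (FO (MFun F B) (FO (DFun D e) (FO (lan D n) (FO (ran D i) X))))"
proof -
  interpret l: lan_pair D n U S by (rule D.lan_pair[OF n])
  interpret l': lan_pair E n U S by (rule E.lan_pair[OF n])
  interpret r: ran_pair D i B U by (rule D.ran_pair[OF i])
  interpret r': ran_pair E i B U by (rule E.ran_pair[OF i])
  note [simp] = MFun_simps[OF small_ftrD(5)[OF i]] MFun_simps[OF small_ftrD(6)[OF i]]
    MFun_simps[OF small_ftrD(6)[OF n]]
    D.DFun_simps[OF e] E.DFun_simps[OF e] X MIso[OF e] MIso_sel[OF e]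
    left_mate_sel[OF n] right_mate_sel[OF i]
  let ?R = "FO (ran D i) X" and ?r = "At (right_mate D E F i) X"
  have R [simp]: "?R \<in> Obj (DCat D U)" by simp
  have r [simp]: "iso_arr (DCat E U) ?r" "Dom (DCat E U) ?r = FO (MFun F U) ?R"
    "Cod (DCat E U) ?r = FO (ran E i) (FO (MFun F B) X)"
    using bspec[OF right X] right_mate(2)[OF i X] by (simp_all add: Hom_def)
  have l [simp]: "At (left_mate D E F n) ?R \<in> Arr (DCat E S)"
    "Dom (DCat E S) (At (left_mate D E F n) ?R) = FO (lan E n) (FO (MFun F U) ?R)"
    "Cod (DCat E S) (At (left_mate D E F n) ?R) = FO (MFun F S) (FO (lan D n) ?R)"
    using left_mate(3)[OF n R] by (simp_all add: Hom_def)
  have nt: "Src (NTgt (right_mate D E F i)) = DCat D B"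
    using r.counit by (simp add: right_mate_def nt_between_def)
  have inv_iso: "iso_arr (DCat E B) (FA (DFun E e) (FA (lan E n) (inv_arr (DCat E U) ?r)))"
    by (intro functor_iso(1)[OF E.DFun[OF e]] functor_iso(1)[OF l'.L] l'.C.iso_inv r)
  show eq: "At (comparison i n e) X = Cmp (DCat E B) (At (MIso F e) (FO (lan D n) ?R))
      (FA (DFun E e) (Cmp (DCat E S) (At (left_mate D E F n) ?R)
        (FA (lan E n) (inv_arr (DCat E U) ?r))))"
    by (simp add: comparison_def nt)
  show "iso_arr (DCat E B) (At (comparison i n e) X)"
    unfolding eq using inv_iso bspec[OF left R] by (simp add: r'.D.iso_cmp)
  show "At (comparison i n e) X \<in> Hom (DCat E B)
      (FO (DFun E e) (FO (lan E n) (FO (ran E i) (FO (MFun F B) X))))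
      (FO (MFun F B) (FO (DFun D e) (FO (lan D n) ?R)))"
    unfolding eq by (simp add: Hom_def)
qed

end

locale derivator_modification =
  F: derivator_morphism D E F + G: derivator_morphism D E G + modification D E F G \<alpha>
  for D :: "('u::universe, 'o, 'm) pder" and E :: "('u, 'p, 'q) pder"
    and F G :: "('u, 'o, 'm, 'p, 'q) pmor" and \<alpha> :: "'u scat \<Rightarrow> ('o, 'm, 'p, 'q) nt"
begin

lemma component_simps:
  assumes A: "small_cat A" and X: "X \<in> Obj (DCat D A)"
  shows "At (\<alpha> A) X \<in> Arr (DCat E A)" "Dom (DCat E A) (At (\<alpha> A) X) = FO (MFun F A) X"
    "Cod (DCat E A) (At (\<alpha> A) X) = FO (MFun G A) X"
  using nt_between_simps[OF component_nt[OF A] F.MFun[OF A]] X by simp_all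

lemma component_natural:
  assumes A: "small_cat A" and f: "f \<in> Arr (DCat D A)"
  shows "Cmp (DCat E A) (At (\<alpha> A) (Cod (DCat D A) f)) (FA (MFun F A) f)
    = Cmp (DCat E A) (FA (MFun G A) f) (At (\<alpha> A) (Dom (DCat D A) f))"
  using nt_naturality[OF component_nt[OF A] F.MFun[OF A], of f] f by (simp add: Hom_def)

lemma component_restrict:
  assumes u: "small_ftr u A B" and Y: "Y \<in> Obj (DCat D B)"
  shows "Cmp (DCat E A) (At (\<alpha> A) (FO (DFun D u) Y)) (At (MIso F u) Y)
    = Cmp (DCat E A) (At (MIso G u) Y) (FA (DFun E u) (At (\<alpha> B) Y))"
proof -
  have "At ((\<alpha> A \<triangleleft> DFun D u) \<cdot> MIso F u) Y = At (MIso G u \<cdot> (DFun E u \<triangleright> \<alpha> B)) Y"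
    using component_compat[OF small_ftrD(1)[OF u]] small_ftrD(2,3)[OF u] by simp
  moreover have "NSrc (\<alpha> B) = MFun F B"
    using component_nt[OF small_ftrD(6)[OF u]] by (simp add: nt_between_def)
  ultimately show ?thesis
    using Y F.MIso_sel[OF u] F.MFun_simps[OF small_ftrD(6)[OF u]]
      F.E.DFun_simps[OF u] F.D.DFun_simps[OF u] by simp
qed

lemma component_restrict_inv:
  assumes u: "small_ftr u A B" and Y: "Y \<in> Obj (DCat D B)"
  shows "Cmp (DCat E A) (FA (DFun E u) (At (\<alpha> B) Y)) (inv_arr (DCat E A) (At (MIso F u) Y))
    = Cmp (DCat E A) (inv_arr (DCat E A) (At (MIso G u) Y)) (At (\<alpha> A) (FO (DFun D u) Y))"
proof -
  interpret EA: category "DCat E A" by (rule F.E.DCat[OF small_ftrD(5)[OF u]])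
  note [simp] = F.E.DFun_simps[OF u] F.D.DFun_simps[OF u]
    component_simps[OF small_ftrD(5)[OF u]] component_simps[OF small_ftrD(6)[OF u]]
    F.MIso[OF u Y] G.MIso[OF u Y] Y
  show ?thesis
    by (rule EA.inv_square[OF _ _ _ _ component_restrict[OF u Y]]) (simp_all add: Hom_def)
qed

text \<open>Both composites \<open>u\<^sub>! F X \<rightarrow> G u\<^sub>! X\<close> have the transpose \<open>F X \<rightarrow> G X \<rightarrow> G u\<^sup>* u\<^sub>! X \<cong> u\<^sup>* G u\<^sub>! X\<close>.\<close>

lemma component_left_mate:
  assumes u: "small_ftr u A B" and X: "X \<in> Obj (DCat D A)"
  shows "Cmp (DCat E B) (At (\<alpha> B) (FO (lan D u) X)) (At (left_mate D E F u) X)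
    = Cmp (DCat E B) (At (left_mate D E G u) X) (FA (lan E u) (At (\<alpha> A) X))"
proof -
  interpret l: lan_pair D u A B by (rule F.D.lan_pair[OF u])
  interpret l': lan_pair E u A B by (rule F.E.lan_pair[OF u])
  note A = small_ftrD(5)[OF u] and B = small_ftrD(6)[OF u]
  note [simp] = F.MFun_simps[OF A] F.MFun_simps[OF B]
    G.MFun_simps[OF A] G.MFun_simps[OF B] F.MIso[OF u] G.MIso[OF u] X
    component_simps[OF A] component_simps[OF B] small_ftrD(2)[OF u]
  let ?W = "FO (lan D u) X" and ?\<eta> = "At (lan_unit D u) X" and ?c = "Cmp (DCat E A)"
    and ?lF = "At (left_mate D E F u) X" and ?lG = "At (left_mate D E G u) X"
    and ?\<eta>F = "At (lan_unit E u) (FO (MFun F A) X)" and ?\<eta>G = "At (lan_unit E u) (FO (MFun G A) X)"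
    and ?\<gamma>F = "At (MIso F u) (FO (lan D u) X)" and ?\<gamma>G = "At (MIso G u) (FO (lan D u) X)"
  have W [simp]: "?W \<in> Obj (DCat D B)" by simp
  have [simp]: "?lF \<in> Arr (DCat E B)" "Dom (DCat E B) ?lF = FO (lan E u) (FO (MFun F A) X)"
    "Cod (DCat E B) ?lF = FO (MFun F B) ?W"
    "?lG \<in> Arr (DCat E B)" "Dom (DCat E B) ?lG = FO (lan E u) (FO (MFun G A) X)"
    "Cod (DCat E B) ?lG = FO (MFun G B) ?W"
    using F.left_mate(3)[OF u X] G.left_mate(3)[OF u X] by (simp_all add: Hom_def)
  have iF: "iso_arr (DCat E A) ?\<gamma>F" and iG: "iso_arr (DCat E A) ?\<gamma>G" by simp_all
  show ?thesis
  proof (rule l'.left_eqI)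
    show "Cmp (DCat E B) (At (\<alpha> B) ?W) ?lF
        \<in> Hom (DCat E B) (FO (lan E u) (FO (MFun F A) X)) (FO (MFun G B) ?W)"
      "Cmp (DCat E B) ?lG (FA (lan E u) (At (\<alpha> A) X))
        \<in> Hom (DCat E B) (FO (lan E u) (FO (MFun F A) X)) (FO (MFun G B) ?W)"
      by (simp_all add: Hom_def)
    have "?c (FA (DFun E u) (Cmp (DCat E B) (At (\<alpha> B) ?W) ?lF)) ?\<eta>F
        = ?c (FA (DFun E u) (At (\<alpha> B) ?W)) (?c (FA (DFun E u) ?lF) ?\<eta>F)"
      by (simp add: l'.C.cmp_assoc)
    also have "\<dots> = ?c (FA (DFun E u) (At (\<alpha> B) ?W))
        (?c (inv_arr (DCat E A) ?\<gamma>F) (FA (MFun F A) ?\<eta>))"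
      unfolding F.left_mate(4)[OF u X] by (simp add: F.left_mate_arr_def)
    also have "\<dots> = ?c (?c (FA (DFun E u) (At (\<alpha> B) ?W)) (inv_arr (DCat E A) ?\<gamma>F)) (FA (MFun F A) ?\<eta>)"
      using iF by (simp add: l'.C.cmp_assoc)
    also have "\<dots> = ?c (inv_arr (DCat E A) ?\<gamma>G)
        (?c (At (\<alpha> A) (FO (DFun D u) ?W)) (FA (MFun F A) ?\<eta>))"
      unfolding component_restrict_inv[OF u W] using iG by (simp add: l'.C.cmp_assoc)
    also have "?c (At (\<alpha> A) (FO (DFun D u) ?W)) (FA (MFun F A) ?\<eta>)
        = ?c (FA (MFun G A) ?\<eta>) (At (\<alpha> A) X)"
      using component_natural[OF A, of ?\<eta>] by simp
    also have "?c (inv_arr (DCat E A) ?\<gamma>G) \<dots> = ?c (G.left_mate_arr u X) (At (\<alpha> A) X)"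
      using iG by (simp add: G.left_mate_arr_def l'.C.cmp_assoc)
    also have "\<dots> = ?c (FA (DFun E u) ?lG) (?c ?\<eta>G (At (\<alpha> A) X))"
      unfolding G.left_mate(4)[OF u X, symmetric] by (simp add: l'.C.cmp_assoc)
    also have "?c ?\<eta>G (At (\<alpha> A) X) = ?c (FA (DFun E u) (FA (lan E u) (At (\<alpha> A) X))) ?\<eta>F"
      using l'.unit_natural[of "At (\<alpha> A) X"] by simp
    also have "?c (FA (DFun E u) ?lG) \<dots>
        = ?c (FA (DFun E u) (Cmp (DCat E B) ?lG (FA (lan E u) (At (\<alpha> A) X)))) ?\<eta>F"
      by (simp add: l'.C.cmp_assoc)
    finally show "?c (FA (DFun E u) (Cmp (DCat E B) (At (\<alpha> B) ?W) ?lF)) ?\<eta>F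
        = ?c (FA (DFun E u) (Cmp (DCat E B) ?lG (FA (lan E u) (At (\<alpha> A) X)))) ?\<eta>F" .
  qed simp
qed

text \<open>Both composites \<open>F u\<^sub>* X \<rightarrow> u\<^sub>* G X\<close> have the transpose \<open>u\<^sup>* F u\<^sub>* X \<cong> F u\<^sup>* u\<^sub>* X \<rightarrow> F X \<rightarrow> G X\<close>.\<close>

lemma component_right_mate:
  assumes u: "small_ftr u A B" and X: "X \<in> Obj (DCat D A)"
  shows "Cmp (DCat E B) (FA (ran E u) (At (\<alpha> A) X)) (At (right_mate D E F u) X)
    = Cmp (DCat E B) (At (right_mate D E G u) X) (At (\<alpha> B) (FO (ran D u) X))"
proof -
  interpret r: ran_pair D u A B by (rule F.D.ran_pair[OF u])
  interpret r': ran_pair E u A B by (rule F.E.ran_pair[OF u])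
  note A = small_ftrD(5)[OF u] and B = small_ftrD(6)[OF u]
  note [simp] = F.MFun_simps[OF A] F.MFun_simps[OF B]
    G.MFun_simps[OF A] G.MFun_simps[OF B] F.MIso[OF u] G.MIso[OF u] X
    component_simps[OF A] component_simps[OF B] small_ftrD(2)[OF u]
  let ?W = "FO (ran D u) X" and ?\<epsilon> = "At (ran_counit D u) X" and ?c = "Cmp (DCat E A)"
    and ?rF = "At (right_mate D E F u) X" and ?rG = "At (right_mate D E G u) X"
    and ?\<epsilon>F = "At (ran_counit E u) (FO (MFun F A) X)" and ?\<epsilon>G = "At (ran_counit E u) (FO (MFun G A) X)"
    and ?\<gamma>F = "At (MIso F u) (FO (ran D u) X)" and ?\<gamma>G = "At (MIso G u) (FO (ran D u) X)"
  have W [simp]: "?W \<in> Obj (DCat D B)" by simp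
  have [simp]: "?rF \<in> Arr (DCat E B)" "Dom (DCat E B) ?rF = FO (MFun F B) ?W"
    "Cod (DCat E B) ?rF = FO (ran E u) (FO (MFun F A) X)"
    "?rG \<in> Arr (DCat E B)" "Dom (DCat E B) ?rG = FO (MFun G B) ?W"
    "Cod (DCat E B) ?rG = FO (ran E u) (FO (MFun G A) X)"
    using F.right_mate(2)[OF u X] G.right_mate(2)[OF u X] by (simp_all add: Hom_def)
  show ?thesis
  proof (rule r'.right_eqI)
    show "Cmp (DCat E B) (FA (ran E u) (At (\<alpha> A) X)) ?rF
        \<in> Hom (DCat E B) (FO (MFun F B) ?W) (FO (ran E u) (FO (MFun G A) X))"
      "Cmp (DCat E B) ?rG (At (\<alpha> B) ?W)
        \<in> Hom (DCat E B) (FO (MFun F B) ?W) (FO (ran E u) (FO (MFun G A) X))"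
      by (simp_all add: Hom_def)
    have "?c ?\<epsilon>G (FA (DFun E u) (Cmp (DCat E B) (FA (ran E u) (At (\<alpha> A) X)) ?rF))
        = ?c (?c ?\<epsilon>G (FA (DFun E u) (FA (ran E u) (At (\<alpha> A) X)))) (FA (DFun E u) ?rF)"
      by (simp add: r'.D.cmp_assoc)
    also have "?c ?\<epsilon>G (FA (DFun E u) (FA (ran E u) (At (\<alpha> A) X))) = ?c (At (\<alpha> A) X) ?\<epsilon>F"
      using r'.counit_natural[of "At (\<alpha> A) X"] by simp
    also have "?c \<dots> (FA (DFun E u) ?rF) = ?c (At (\<alpha> A) X) (?c ?\<epsilon>F (FA (DFun E u) ?rF))"
      by (simp add: r'.D.cmp_assoc)
    also have "\<dots> = ?c (?c (At (\<alpha> A) X) (FA (MFun F A) ?\<epsilon>)) ?\<gamma>F"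
      unfolding F.right_mate(3)[OF u X] by (simp add: F.right_mate_arr_def r'.D.cmp_assoc)
    also have "?c (At (\<alpha> A) X) (FA (MFun F A) ?\<epsilon>)
        = ?c (FA (MFun G A) ?\<epsilon>) (At (\<alpha> A) (FO (DFun D u) ?W))"
      using component_natural[OF A, of ?\<epsilon>] by simp
    also have "?c \<dots> ?\<gamma>F = ?c (FA (MFun G A) ?\<epsilon>) (?c (At (\<alpha> A) (FO (DFun D u) ?W)) ?\<gamma>F)"
      by (simp add: r'.D.cmp_assoc)
    also have "\<dots> = ?c (G.right_mate_arr u X) (FA (DFun E u) (At (\<alpha> B) ?W))"
      unfolding component_restrict[OF u W] by (simp add: G.right_mate_arr_def r'.D.cmp_assoc)
    also have "\<dots> = ?c ?\<epsilon>G (FA (DFun E u) (Cmp (DCat E B) ?rG (At (\<alpha> B) ?W)))"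
      unfolding G.right_mate(3)[OF u X, symmetric] by (simp add: r'.D.cmp_assoc)
    finally show "?c ?\<epsilon>G (FA (DFun E u) (Cmp (DCat E B) (FA (ran E u) (At (\<alpha> A) X)) ?rF))
        = ?c ?\<epsilon>G (FA (DFun E u) (Cmp (DCat E B) ?rG (At (\<alpha> B) ?W)))" .
  qed simp
qed

text \<open>Invertibility of the right mates is what allows \<open>\<alpha>\<close> to be moved past their inverses.\<close>

lemma component_comparison:
  assumes i: "small_ftr i B U" and n: "small_ftr n U S" and e: "small_ftr e B S"
    and rightF: "\<forall>X \<in> Obj (DCat D B). iso_arr (DCat E U) (At (right_mate D E F i) X)"
    and leftF: "\<forall>Y \<in> Obj (DCat D U). iso_arr (DCat E B) (FA (DFun E e) (At (left_mate D E F n) Y))"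
    and rightG: "\<forall>X \<in> Obj (DCat D B). iso_arr (DCat E U) (At (right_mate D E G i) X)"
    and leftG: "\<forall>Y \<in> Obj (DCat D U). iso_arr (DCat E B) (FA (DFun E e) (At (left_mate D E G n) Y))"
    and X: "X \<in> Obj (DCat D B)"
  shows "Cmp (DCat E B) (At (\<alpha> B) (FO (DFun D e) (FO (lan D n) (FO (ran D i) X))))
      (At (F.comparison i n e) X)
    = Cmp (DCat E B) (At (G.comparison i n e) X)
      (FA (DFun E e) (FA (lan E n) (FA (ran E i) (At (\<alpha> B) X))))"
proof -
  interpret l: lan_pair D n U S by (rule F.D.lan_pair[OF n])
  interpret l': lan_pair E n U S by (rule F.E.lan_pair[OF n])
  interpret r: ran_pair D i B U by (rule F.D.ran_pair[OF i])
  interpret r': ran_pair E i B U by (rule F.E.ran_pair[OF i])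
  note B = small_ftrD(5)[OF i] and U = small_ftrD(6)[OF i] and S = small_ftrD(6)[OF n]
  let ?R = "FO (ran D i) X" let ?L = "FO (lan D n) ?R"
  let ?rF = "At (right_mate D E F i) X" and ?rG = "At (right_mate D E G i) X"
    and ?lF = "At (left_mate D E F n) ?R" and ?lG = "At (left_mate D E G n) ?R"
    and ?\<gamma>F = "At (MIso F e) ?L" and ?\<gamma>G = "At (MIso G e) ?L"
    and ?a = "FA (ran E i) (At (\<alpha> B) X)" and ?iv = "inv_arr (DCat E U)"
  note [simp] = F.MFun_simps[OF B] F.MFun_simps[OF U] F.MFun_simps[OF S]
    G.MFun_simps[OF B] G.MFun_simps[OF U] G.MFun_simps[OF S]
    F.D.DFun_simps[OF e] F.E.DFun_simps[OF e] X F.MIso[OF e] G.MIso[OF e]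
    component_simps[OF B] component_simps[OF U] component_simps[OF S]
  have R [simp]: "?R \<in> Obj (DCat D U)" and L [simp]: "?L \<in> Obj (DCat D S)" by simp_all
  have r [simp]: "iso_arr (DCat E U) ?rF" "Dom (DCat E U) ?rF = FO (MFun F U) ?R"
    "Cod (DCat E U) ?rF = FO (ran E i) (FO (MFun F B) X)"
    "iso_arr (DCat E U) ?rG" "Dom (DCat E U) ?rG = FO (MFun G U) ?R"
    "Cod (DCat E U) ?rG = FO (ran E i) (FO (MFun G B) X)"
    using bspec[OF rightF X] bspec[OF rightG X] F.right_mate(2)[OF i X] G.right_mate(2)[OF i X]
    by (simp_all add: Hom_def)
  have l [simp]: "?lF \<in> Arr (DCat E S)" "Dom (DCat E S) ?lF = FO (lan E n) (FO (MFun F U) ?R)"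
    "Cod (DCat E S) ?lF = FO (MFun F S) ?L"
    "?lG \<in> Arr (DCat E S)" "Dom (DCat E S) ?lG = FO (lan E n) (FO (MFun G U) ?R)"
    "Cod (DCat E S) ?lG = FO (MFun G S) ?L"
    using F.left_mate(3)[OF n R] G.left_mate(3)[OF n R] by (simp_all add: Hom_def)
  have right: "Cmp (DCat E U) (At (\<alpha> U) ?R) (?iv ?rF) = Cmp (DCat E U) (?iv ?rG) ?a"
    by (rule l'.C.inv_square) (use component_right_mate[OF i X] in \<open>simp_all add: Hom_def\<close>)
  have "Cmp (DCat E B) (At (\<alpha> B) (FO (DFun D e) ?L)) (At (F.comparison i n e) X)
      = Cmp (DCat E B) (Cmp (DCat E B) (At (\<alpha> B) (FO (DFun D e) ?L)) ?\<gamma>F)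
        (FA (DFun E e) (Cmp (DCat E S) ?lF (FA (lan E n) (?iv ?rF))))"
    unfolding F.comparison(1)[OF i n e rightF leftF X] by (simp add: r'.D.cmp_assoc)
  also have "\<dots> = Cmp (DCat E B) ?\<gamma>G (FA (DFun E e)
      (Cmp (DCat E S) (Cmp (DCat E S) (At (\<alpha> S) ?L) ?lF) (FA (lan E n) (?iv ?rF))))"
    unfolding component_restrict[OF e L] by (simp add: r'.D.cmp_assoc)
  also have "Cmp (DCat E S) (Cmp (DCat E S) (At (\<alpha> S) ?L) ?lF) (FA (lan E n) (?iv ?rF))
      = Cmp (DCat E S) ?lG (FA (lan E n) (Cmp (DCat E U) (At (\<alpha> U) ?R) (?iv ?rF)))"
    unfolding component_left_mate[OF n R] by (simp add: l'.D.cmp_assoc)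
  also have "\<dots> = Cmp (DCat E S) (Cmp (DCat E S) ?lG (FA (lan E n) (?iv ?rG))) (FA (lan E n) ?a)"
    unfolding right by (simp add: l'.D.cmp_assoc)
  also have "Cmp (DCat E B) ?\<gamma>G (FA (DFun E e) \<dots>)
      = Cmp (DCat E B) (At (G.comparison i n e) X) (FA (DFun E e) (FA (lan E n) ?a))"
    unfolding G.comparison(1)[OF i n e rightG leftG X] by (simp add: r'.D.cmp_assoc)
  finally show ?thesis .
qed

end

section \<open>Exactness of a modification\<close>

text \<open>Kan extensions in a shifted derivator are by definition Kan extensions along products with \<open>A\<close>,
  with the same choices of adjoints.\<close>

lemma shift_kan:
  "DCat (shift A D) B = DCat D (A \<otimes> B)"
  "DFun (shift A D) u = DFun D (ftr_prod (fid A) u)"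
  "lan (shift A D) u = lan D (ftr_prod (fid A) u)"
  "lan_unit (shift A D) u = lan_unit D (ftr_prod (fid A) u)"
  "lan_counit (shift A D) u = lan_counit D (ftr_prod (fid A) u)"
  "ran (shift A D) u = ran D (ftr_prod (fid A) u)"
  "ran_unit (shift A D) u = ran_unit D (ftr_prod (fid A) u)"
  "ran_counit (shift A D) u = ran_counit D (ftr_prod (fid A) u)"
  by (simp_all add: shift_def lan_def lan_unit_def lan_counit_def ran_def ran_unit_def ran_counit_def)

lemma shift_mates:
  "MIso (shift_mor A F) u = MIso F (ftr_prod (fid A) u)"
  "left_mate (shift A D) (shift A E) (shift_mor A F) u = left_mate D E F (ftr_prod (fid A) u)"
  "right_mate (shift A D) (shift A E) (shift_mor A F) u = right_mate D E F (ftr_prod (fid A) u)"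
  by (simp_all add: left_mate_def right_mate_def shift_kan shift_mor_def ftr_prod_def)

text \<open>The functors \<open>A \<times> \<one> \<rightarrow> A \<times> ulcorner \<rightarrow> A \<times> square \<leftarrow> A \<times> \<one>\<close> from which the suspension of \<open>shift A D\<close> is built.\<close>

abbreviation susp_in :: "'u::universe scat \<Rightarrow> 'u sftr" where
  "susp_in A \<equiv> ftr_prod (fid A) (point ulcorner (corner 0 0))"

abbreviation susp_incl :: "'u::universe scat \<Rightarrow> 'u sftr" where
  "susp_incl A \<equiv> ftr_prod (fid A) ulcorner_incl"

abbreviation susp_out :: "'u::universe scat \<Rightarrow> 'u sftr" where
  "susp_out A \<equiv> ftr_prod (fid A) (point square (corner 1 1))"

lemma suspension_shift:
  "suspension (shift A D) = DFun D (susp_out A) \<odot> lan D (susp_incl A) \<odot> ran D (susp_in A)"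
  by (simp add: suspension_def shift_kan)

lemma susp_ftrs:
  fixes A :: "'u::universe scat"
  assumes A: "small_cat A"
  shows "small_ftr (susp_in A) (A \<otimes> one) (A \<otimes> ulcorner)"
    and "small_ftr (susp_incl A) (A \<otimes> ulcorner) (A \<otimes> square)"
    and "small_ftr (susp_out A) (A \<otimes> one) (A \<otimes> square)"
proof -
  have "corner 0 0 \<in> Obj (ulcorner :: 'u scat)" "corner 1 1 \<in> Obj (square :: 'u scat)"
    using ulcorner_initial square_terminal unfolding initial_obj_def terminal_obj_def by blast+
  note pts = small_ftr_point[OF small_cat_ulcorner this(1)] small_ftr_point[OF small_cat_square this(2)]
  show "small_ftr (susp_in A) (A \<otimes> one) (A \<otimes> ulcorner)"
    "small_ftr (susp_incl A) (A \<otimes> ulcorner) (A \<otimes> square)"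
    "small_ftr (susp_out A) (A \<otimes> one) (A \<otimes> square)"
    by (rule small_ftr_prod[OF small_ftr_fid[OF A]], rule pts small_ftr_ulcorner_incl)+
qed

lemma suspension_functor:
  assumes D: "derivator D" and A: "small_cat A"
  shows "functor_between (suspension (shift A D)) (DCat D (A \<otimes> one)) (DCat D (A \<otimes> one))"
    and "X \<in> Obj (DCat D (A \<otimes> one)) \<Longrightarrow> FO (suspension (shift A D)) X
      = FO (DFun D (susp_out A)) (FO (lan D (susp_incl A)) (FO (ran D (susp_in A)) X))"
    and "f \<in> Arr (DCat D (A \<otimes> one)) \<Longrightarrow> FA (suspension (shift A D)) f
      = FA (DFun D (susp_out A)) (FA (lan D (susp_incl A)) (FA (ran D (susp_in A)) f))"
proof -
  interpret derivator D by fact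
  note s = susp_ftrs[OF A]
  interpret l: lan_pair D "susp_incl A" "A \<otimes> ulcorner" "A \<otimes> square" by (rule lan_pair[OF s(2)])
  interpret r: ran_pair D "susp_in A" "A \<otimes> one" "A \<otimes> ulcorner" by (rule ran_pair[OF s(1)])
  show "functor_between (suspension (shift A D)) (DCat D (A \<otimes> one)) (DCat D (A \<otimes> one))"
    unfolding suspension_shift by (rule functor_fcomp[OF functor_fcomp[OF r.R l.L] DFun[OF s(3)]])
  show "X \<in> Obj (DCat D (A \<otimes> one)) \<Longrightarrow> FO (suspension (shift A D)) X
      = FO (DFun D (susp_out A)) (FO (lan D (susp_incl A)) (FO (ran D (susp_in A)) X))"
    "f \<in> Arr (DCat D (A \<otimes> one)) \<Longrightarrow> FA (suspension (shift A D)) f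
      = FA (DFun D (susp_out A)) (FA (lan D (susp_incl A)) (FA (ran D (susp_in A)) f))"
    by (simp_all add: suspension_shift)
qed

context derivator_morphism
begin

lemma suspension_comparison_shift:
  "suspension_comparison (shift A D) (shift A E) (shift_mor A F)
    = comparison (susp_in A) (susp_incl A) (susp_out A)"
  by (simp add: suspension_comparison_def comparison_def shift_kan shift_mates Let_def)

lemma canonical_exact_structure:
  assumes A: "small_cat A"
  shows "NSrc (canonical_exact_structure D E F A) = MFun F A \<odot> suspension_at D A"
    and "NTgt (canonical_exact_structure D E F A) = suspension_at E A \<odot> MFun F A"
    and "X \<in> Obj (DCat D A) \<Longrightarrow> At (canonical_exact_structure D E F A) X =
      (let s = slice_at A one (unat 0); r = prod_fst A one; Y = FO (DFun D r) X; B = A \<otimes> one in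
      Cmp (DCat E A) (FA (DFun E s) (FA (suspension (shift A E)) (inv_arr (DCat E B) (At (MIso F r) X))))
        (Cmp (DCat E A) (FA (DFun E s) (inv_arr (DCat E B)
            (At (comparison (susp_in A) (susp_incl A) (susp_out A)) Y)))
          (inv_arr (DCat E A) (At (MIso F s) (FO (suspension (shift A D)) Y)))))"
proof -
  let ?s = "slice_at A one (unat 0)" and ?r = "prod_fst A one"
    and ?\<psi> = "comparison (susp_in A) (susp_incl A) (susp_out A)"
  have s: "small_ftr ?s A (A \<otimes> one)" by (rule small_ftr_slice_at[OF A small_cat_one]) simp
  have r: "small_ftr ?r (A \<otimes> one) A" by (rule small_ftr_prod_fst[OF A small_cat_one])
  note i = susp_ftrs(1)[OF A]
  note \<Sigma>D = suspension_functor(1)[OF D.derivator_axioms A] and \<Sigma>E = suspension_functor(1)[OF E.derivator_axioms A]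
  note FA = MFun[OF A] and FB = MFun[OF small_ftrD(5)[OF r]]
  interpret ri: ran_pair D "susp_in A" "A \<otimes> one" "A \<otimes> ulcorner" by (rule D.ran_pair[OF i])
  have sel: "Src (NSrc ?\<psi>) = DCat D (A \<otimes> one)" "Tgt (NSrc ?\<psi>) = DCat E (A \<otimes> one)"
    using ri.counit functor_simps(2)[OF E.DFun[OF susp_ftrs(3)[OF A]]]
    by (simp_all add: comparison_def right_mate_def nt_between_def)
  note unfold = canonical_exact_structure_def exact_structure_one_def suspension_comparison_shift Let_def
  note [simp] = functor_simps[OF \<Sigma>D] functor_simps[OF \<Sigma>E] functor_simps[OF FA] functor_simps[OF FB]
    D.DFun_simps[OF s] E.DFun_simps[OF s] D.DFun_simps[OF r]
    E.DFun_simps[OF r] MIso_sel[OF s] MIso_sel[OF r]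
  show "NSrc (canonical_exact_structure D E F A) = MFun F A \<odot> suspension_at D A"
    using fcomp_assoc[OF functor_fcomp[OF D.DFun[OF r] \<Sigma>D] D.DFun[OF s], of "MFun F A"]
    by (simp add: unfold suspension_at_def)
  have "(DFun E ?s \<odot> suspension (shift A E)) \<odot> DFun E ?r \<odot> MFun F A
      = suspension_at E A \<odot> MFun F A"
    using fcomp_assoc[OF FA E.DFun[OF r], of "DFun E ?s \<odot> suspension (shift A E)"]
      fcomp_assoc[OF E.DFun[OF r] \<Sigma>E, of "DFun E ?s"]
    by (simp add: suspension_at_def)
  then show "NTgt (canonical_exact_structure D E F A) = suspension_at E A \<odot> MFun F A"
    by (simp add: unfold)
  interpret EB: category "DCat E (A \<otimes> one)" by (rule E.DCat[OF small_ftrD(5)[OF r]])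
  assume X: "X \<in> Obj (DCat D A)"
  have "inv_arr (DCat E (A \<otimes> one)) (At (MIso F ?r) X) \<in> Arr (DCat E (A \<otimes> one))"
    using MIso(1)[OF r X] by simp
  with X show "At (canonical_exact_structure D E F A) X =
      (let s = slice_at A one (unat 0); r = prod_fst A one; Y = FO (DFun D r) X; B = A \<otimes> one in
      Cmp (DCat E A) (FA (DFun E s) (FA (suspension (shift A E)) (inv_arr (DCat E B) (At (MIso F r) X))))
        (Cmp (DCat E A) (FA (DFun E s) (inv_arr (DCat E B) (At ?\<psi> Y)))
          (inv_arr (DCat E A) (At (MIso F s) (FO (suspension (shift A D)) Y)))))"
    by (simp add: unfold sel del: One_nat_def)
qed

end

context derivator_morphism
begin

text \<open>The two invertibility statements on which \<open>comparison\<close> depends hold for the morphism induced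
  by \<open>F\<close> on the derivators shifted by \<open>A\<close>.\<close>

lemma exact_comparison:
  assumes ex: "exact_morphism D E F" and A: "small_cat A"
  shows "\<forall>X \<in> Obj (DCat D (A \<otimes> one)). iso_arr (DCat E (A \<otimes> ulcorner)) (At (right_mate D E F (susp_in A)) X)"
    and "\<forall>Y \<in> Obj (DCat D (A \<otimes> ulcorner)). iso_arr (DCat E (A \<otimes> one))
      (FA (DFun E (susp_out A)) (At (left_mate D E F (susp_incl A)) Y))"
proof -
  interpret exact_morphism D E F by fact
  show "\<forall>X \<in> Obj (DCat D (A \<otimes> one)). iso_arr (DCat E (A \<otimes> ulcorner)) (At (right_mate D E F (susp_in A)) X)"
    using right_mate_iso_sieve[OF A small_cat_ulcorner ulcorner_initial ulcorner_sieve preserves_terminal]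
    by blast
  show "\<forall>Y \<in> Obj (DCat D (A \<otimes> ulcorner)). iso_arr (DCat E (A \<otimes> one))
      (FA (DFun E (susp_out A)) (At (left_mate D E F (susp_incl A)) Y))"
    using left_mate_iso_terminal[OF A small_ftr_ulcorner_incl square_terminal preserves_pushouts] by blast
qed

end

theorem corollary10p12:
  fixes D :: "('u::universe, 'o, 'm) pder" and E :: "('u, 'p, 'q) pder"
    and F G :: "('u, 'o, 'm, 'p, 'q) pmor" and \<alpha> :: "'u scat \<Rightarrow> ('o, 'm, 'p, 'q) nt"
  assumes "strong_stable_derivator D" and "strong_stable_derivator E"
    and "exact_morphism D E F" and "exact_morphism D E G"
    and "modification D E F G \<alpha>"
    and "small_cat A"
  shows "(suspension_at E A \<triangleright> \<alpha> A) \<cdot> canonical_exact_structure D E F A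
    = canonical_exact_structure D E G A \<cdot> (\<alpha> A \<triangleleft> suspension_at D A)"
proof -
  interpret D: strong_stable_derivator D by fact
  interpret E: strong_stable_derivator E by fact
  interpret F: exact_morphism D E F by fact
  interpret G: exact_morphism D E G by fact
  interpret modification D E F G \<alpha> by fact
  interpret derivator_modification D E F G \<alpha> ..
  note A = \<open>small_cat A\<close>
  let ?s = "slice_at A one (unat 0)" and ?r = "prod_fst A one" and ?B = "A \<otimes> one"
    and ?\<Sigma>D = "suspension (shift A D)" and ?\<Sigma>E = "suspension (shift A E)"
    and ?\<sigma>F = "canonical_exact_structure D E F A" and ?\<sigma>G = "canonical_exact_structure D E G A"
  have s: "small_ftr ?s A ?B" by (rule small_ftr_slice_at[OF A small_cat_one]) simp
  have r: "small_ftr ?r ?B A" by (rule small_ftr_prod_fst[OF A small_cat_one])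
  have B: "small_cat ?B" by (rule small_ftrD(5)[OF r])
  note i = susp_ftrs[OF A]
  note \<Sigma>D = suspension_functor[OF D.derivator_axioms A] and \<Sigma>E = suspension_functor[OF E.derivator_axioms A]
  interpret EA: category "DCat E A" by (rule E.DCat[OF A])
  interpret EB: category "DCat E ?B" by (rule E.DCat[OF B])
  note [simp] = functor_simps[OF \<Sigma>D(1)] functor_simps[OF \<Sigma>E(1)]
    D.DFun_simps[OF s] E.DFun_simps[OF s] D.DFun_simps[OF r]
    E.DFun_simps[OF r] functor_simps[OF F.MFun_functor[OF A]]
    functor_simps[OF G.MFun_functor[OF A]] functor_simps[OF F.MFun_functor[OF B]]
    functor_simps[OF G.MFun_functor[OF B]] component_simps[OF A] component_simps[OF B]
    F.MIso[OF s] G.MIso[OF s] F.MIso[OF r] G.MIso[OF r]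
  have \<alpha>: "NSrc (\<alpha> A) = MFun F A" "NTgt (\<alpha> A) = MFun G A"
    using component_nt[OF A] by (simp_all add: nt_between_def)
  note exF = F.exact_comparison[OF assms(3) A] and exG = G.exact_comparison[OF assms(4) A]
  have susp: "Src (suspension_at D A) = DCat D A" "Src (suspension_at E A) = DCat E A"
    by (simp_all add: suspension_at_def)
  show ?thesis
  proof (rule nt_ext)
    show "NSrc ((suspension_at E A \<triangleright> \<alpha> A) \<cdot> ?\<sigma>F) = NSrc (?\<sigma>G \<cdot> (\<alpha> A \<triangleleft> suspension_at D A))"
      by (simp add: F.canonical_exact_structure(1)[OF A] \<alpha>)
    show "NTgt ((suspension_at E A \<triangleright> \<alpha> A) \<cdot> ?\<sigma>F) = NTgt (?\<sigma>G \<cdot> (\<alpha> A \<triangleleft> suspension_at D A))"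
      by (simp add: G.canonical_exact_structure(2)[OF A] \<alpha>)
    show "At ((suspension_at E A \<triangleright> \<alpha> A) \<cdot> ?\<sigma>F)
        \<in> extensional (Obj (Src (NSrc (?\<sigma>G \<cdot> (\<alpha> A \<triangleleft> suspension_at D A)))))"
      "At (?\<sigma>G \<cdot> (\<alpha> A \<triangleleft> suspension_at D A))
        \<in> extensional (Obj (Src (NSrc (?\<sigma>G \<cdot> (\<alpha> A \<triangleleft> suspension_at D A)))))"
      by (simp_all add: vcomp_def F.canonical_exact_structure(1)[OF A] whisk_r_def)
  next
    fix X assume "X \<in> Obj (Src (NSrc (?\<sigma>G \<cdot> (\<alpha> A \<triangleleft> suspension_at D A))))"
    then have X [simp]: "X \<in> Obj (DCat D A)" by (simp add: susp)
    define Y where "Y = FO (DFun D ?r) X"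
    define Z where "Z = FO ?\<Sigma>D Y"
    have Y [simp]: "Y \<in> Obj (DCat D ?B)" by (simp add: Y_def)
    have Z [simp]: "Z \<in> Obj (DCat D ?B)" by (simp add: Z_def)
    define \<psi>F where "\<psi>F = At (F.comparison (susp_in A) (susp_incl A) (susp_out A)) Y"
    define \<psi>G where "\<psi>G = At (G.comparison (susp_in A) (susp_incl A) (susp_out A)) Y"
    define rF where "rF = inv_arr (DCat E ?B) (At (MIso F ?r) X)"
    define rG where "rG = inv_arr (DCat E ?B) (At (MIso G ?r) X)"
    define sF where "sF = inv_arr (DCat E A) (At (MIso F ?s) Z)"
    define sG where "sG = inv_arr (DCat E A) (At (MIso G ?s) Z)"
    let ?a = "Cmp (DCat E A)" and ?b = "Cmp (DCat E ?B)" and ?iv = "inv_arr (DCat E ?B)"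
    let ?S = "FA (DFun E ?s)" and ?T = "FA ?\<Sigma>E"
    have \<psi>: "iso_arr (DCat E ?B) \<psi>F" "Dom (DCat E ?B) \<psi>F = FO ?\<Sigma>E (FO (MFun F ?B) Y)"
      "Cod (DCat E ?B) \<psi>F = FO (MFun F ?B) Z"
      "iso_arr (DCat E ?B) \<psi>G" "Dom (DCat E ?B) \<psi>G = FO ?\<Sigma>E (FO (MFun G ?B) Y)"
      "Cod (DCat E ?B) \<psi>G = FO (MFun G ?B) Z"
      using F.comparison(2,3)[OF i exF Y] G.comparison(2,3)[OF i exG Y]
      by (simp_all add: \<psi>F_def \<psi>G_def Hom_def Z_def \<Sigma>D(2) \<Sigma>E(2) del: One_nat_def)
    have rs: "rF \<in> Arr (DCat E ?B)" "Dom (DCat E ?B) rF = FO (MFun F ?B) Y"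
      "Cod (DCat E ?B) rF = FO (DFun E ?r) (FO (MFun F A) X)"
      "rG \<in> Arr (DCat E ?B)" "Dom (DCat E ?B) rG = FO (MFun G ?B) Y"
      "Cod (DCat E ?B) rG = FO (DFun E ?r) (FO (MFun G A) X)"
      "sF \<in> Arr (DCat E A)" "Dom (DCat E A) sF = FO (MFun F A) (FO (DFun D ?s) Z)"
      "Cod (DCat E A) sF = FO (DFun E ?s) (FO (MFun F ?B) Z)"
      "sG \<in> Arr (DCat E A)" "Dom (DCat E A) sG = FO (MFun G A) (FO (DFun D ?s) Z)"
      "Cod (DCat E A) sG = FO (DFun E ?s) (FO (MFun G ?B) Z)"
      by (simp_all add: rF_def rG_def sF_def sG_def Y_def)
    note [simp] = \<psi> rs
    \<comment> \<open>The exact structure is a composite of three inverses, and \<open>\<alpha>\<close> passes through each of them.\<close>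
    have 1: "?b (FA (DFun E ?r) (At (\<alpha> A) X)) rF = ?b rG (At (\<alpha> ?B) Y)"
      unfolding rF_def rG_def Y_def by (rule component_restrict_inv[OF r X])
    have 3: "?a (?S (At (\<alpha> ?B) Z)) sF = ?a sG (At (\<alpha> A) (FO (DFun D ?s) Z))"
      unfolding sF_def sG_def by (rule component_restrict_inv[OF s Z])
    have "?b (At (\<alpha> ?B) Z) \<psi>F = ?b \<psi>G (?T (At (\<alpha> ?B) Y))"
      using component_comparison[OF i exF exG Y] component_simps(1)[OF B Y]
      by (simp add: \<psi>F_def \<psi>G_def Z_def \<Sigma>D(2) \<Sigma>E(3) del: One_nat_def)
    then have 2: "?b (?T (At (\<alpha> ?B) Y)) (?iv \<psi>F) = ?b (?iv \<psi>G) (At (\<alpha> ?B) Z)"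
      by (intro EB.inv_square) (simp_all add: Hom_def)
    have \<sigma>F: "At ?\<sigma>F X = ?a (?S (?T rF)) (?a (?S (?iv \<psi>F)) sF)"
      and \<sigma>G: "At ?\<sigma>G X = ?a (?S (?T rG)) (?a (?S (?iv \<psi>G)) sG)"
      using F.canonical_exact_structure(3)[OF A X] G.canonical_exact_structure(3)[OF A X]
      by (simp_all add: Let_def rF_def rG_def sF_def sG_def \<psi>F_def \<psi>G_def Y_def Z_def del: One_nat_def)
    have "?a (?S (?T (FA (DFun E ?r) (At (\<alpha> A) X)))) (At ?\<sigma>F X)
        = ?a (?S (?T (?b (FA (DFun E ?r) (At (\<alpha> A) X)) rF))) (?a (?S (?iv \<psi>F)) sF)"
      unfolding \<sigma>F by (simp add: EA.cmp_assoc Y_def)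
    also have "\<dots> = ?a (?S (?T rG)) (?a (?S (?b (?T (At (\<alpha> ?B) Y)) (?iv \<psi>F))) sF)"
      unfolding 1 by (simp add: EA.cmp_assoc)
    also have "\<dots> = ?a (?S (?T rG)) (?a (?S (?iv \<psi>G)) (?a (?S (At (\<alpha> ?B) Z)) sF))"
      unfolding 2 by (simp add: EA.cmp_assoc)
    also have "\<dots> = ?a (At ?\<sigma>G X) (At (\<alpha> A) (FO (DFun D ?s) Z))"
      unfolding 3 \<sigma>G by (simp add: EA.cmp_assoc)
    finally show "At ((suspension_at E A \<triangleright> \<alpha> A) \<cdot> ?\<sigma>F) X = At (?\<sigma>G \<cdot> (\<alpha> A \<triangleleft> suspension_at D A)) X"
      by (simp add: F.canonical_exact_structure(1)[OF A] \<alpha> susp)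
        (simp add: suspension_at_def Y_def Z_def)
  qed
qed

end
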